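(* Let $X$ be a geodesic metric space and $\mathcal{P}$ a collection of subsets of $X$. Then $X$ is hyperbolic relative to $\mathcal{P}$ if and only if there exist $\mu,R_0$ so that (1) for each $K$ there exists $B$ so that $diam(N_K(P)\cap N_K(Q))\le B$ for all distinct $P,Q\in\mathcal{P}$; (2) for each $k$ and $R\ge R_0$ there exists $K$ so that if $d(x,P)+d(y,P)\le k$ for some $P\in\mathcal{P}$ and $d(x,y)\ge K$ then $trans_{\mu,R}([x,y])\subseteq B_K(x)\cup B_K(y)$ and there exists $z\in trans_{\mu,R}([x,y])\cap N_\mu(P)$; (3) for each $R\ge R_0$ there exists $D$ so that if $\Delta=\gamma_0\cup\gamma_1\cup\gamma_2$ is a geodesic triangle then $$trans_{\mu,R}(\gamma_0)\subseteq N_D(trans_{\mu,R}(\gamma_1)\cup trans_{\mu,R}(\gamma_2)).$$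
   Context: $N_K(A)=\{x\in X:d(x,A)\le K\}$; $B_K(x)$ is the ball of radius $K$ at $x$; $[x,y]$ is any geodesic from $x$ to $y$. An almost-geodesic is a continuous quasi-geodesic. **Transient points.** For a path $\alpha$ in $X$, $deep_{\mu,c}(\alpha)$ is the set of $x\in\alpha$ for which there is a subpath $\beta$ of $\alpha$ containing $x$, with endpoints $x_1,x_2\in N_\mu(P)$ for some $P\in\mathcal{P}$, and $d(x,x_i)>c$ for $i=1,2$; $trans_{\mu,c}(\alpha)=\alpha\setminus deep_{\mu,c}(\alpha)$. **Relative hyperbolicity.** $(\alpha_1)$ is condition (1) of the claim. $(\alpha_2)$: there are $\epsilon\in(0,1/2)$, $M\ge0$ such that for each $P\in\mathcal{P}$ and $x,y\in N_{\epsilon d(x,y)}(P)$, any geodesic from $x$ to $y$ intersects $N_M(P)$. $X$ is $( * )$-asymptotically tree-graded with respect to $\mathcal{P}$ if for every $C\ge0$ there are $\sigma,\delta$ such that every triangle with $(1,C)$-almost-geodesic sides $\gamma_1,\gamma_2,\gamma_3$ satisfies either (C) some ball of radius $\sigma$ intersects all sides, or (P) there is $P\in\mathcal{P}$ such that $N_\sigma(P)$ intersects all sides and the entrance points $x_i$ and exit points $y_i$ of $\gamma_i$ in/from $N_\sigma(P)$ satisfy $d(y_i,x_{i+1})\le\delta$ (indices mod 3, sides oriented cyclically). $X$ is hyperbolic relative to $\mathcal{P}$ if $(\alpha_1)$, $(\alpha_2)$ hold and $X$ is $( * )$-asymptotically tree-graded with respect to $\mathcal{P}$. *)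

theory Defs
  imports "HOL-Analysis.Analysis"
begin

(* The emptiness guard encodes the convention d(x,{}) = infinity, since infdist x {} = 0. *)
definition nbhd :: "real \<Rightarrow> 'a::metric_space set \<Rightarrow> 'a set" where
  "nbhd K A = {x. A \<noteq> {} \<and> infdist x A \<le> K}"

(* A path is a map g together with a compact parameter interval {a..b};
   the values of g outside {a..b} are irrelevant. *)

definition quasi_geodesic :: "real \<Rightarrow> real \<Rightarrow> (real \<Rightarrow> 'a::metric_space) \<Rightarrow> real \<Rightarrow> real \<Rightarrow> bool" where
  "quasi_geodesic L C g a b \<longleftrightarrow> a \<le> b \<and>
     (\<forall>s\<in>{a..b}. \<forall>t\<in>{a..b}.
        \<bar>s - t\<bar> / L - C \<le> dist (g s) (g t) \<and> dist (g s) (g t) \<le> L * \<bar>s - t\<bar> + C)"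

definition almost_geodesic :: "real \<Rightarrow> real \<Rightarrow> (real \<Rightarrow> 'a::metric_space) \<Rightarrow> real \<Rightarrow> real \<Rightarrow> bool" where
  "almost_geodesic L C g a b \<longleftrightarrow> quasi_geodesic L C g a b \<and> continuous_on {a..b} g"

definition geodesic :: "(real \<Rightarrow> 'a::metric_space) \<Rightarrow> real \<Rightarrow> real \<Rightarrow> bool" where
  "geodesic g a b \<longleftrightarrow> a \<le> b \<and> (\<forall>s\<in>{a..b}. \<forall>t\<in>{a..b}. dist (g s) (g t) = \<bar>s - t\<bar>)"

definition geodesic_from_to ::
  "'a::metric_space \<Rightarrow> 'a \<Rightarrow> (real \<Rightarrow> 'a) \<Rightarrow> real \<Rightarrow> real \<Rightarrow> bool" where
  "geodesic_from_to x y g a b \<longleftrightarrow> geodesic g a b \<and> g a = x \<and> g b = y"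

definition geodesic_metric_space :: "'a::metric_space itself \<Rightarrow> bool" where
  "geodesic_metric_space _ \<longleftrightarrow> (\<forall>x y::'a. \<exists>g a b. geodesic_from_to x y g a b)"

(* The subpaths of a path are its restrictions to subintervals {s..u}. *)
definition deep_points ::
  "'a::metric_space set set \<Rightarrow> real \<Rightarrow> real \<Rightarrow> (real \<Rightarrow> 'a) \<Rightarrow> real \<Rightarrow> real \<Rightarrow> 'a set" where
  "deep_points \<P> \<mu> c g a b =
     {x \<in> g ` {a..b}. \<exists>s u. a \<le> s \<and> s \<le> u \<and> u \<le> b \<and> x \<in> g ` {s..u} \<and>
        (\<exists>P\<in>\<P>. g s \<in> nbhd \<mu> P \<and> g u \<in> nbhd \<mu> P) \<and> dist x (g s) > c \<and> dist x (g u) > c}"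

definition trans_points ::
  "'a::metric_space set set \<Rightarrow> real \<Rightarrow> real \<Rightarrow> (real \<Rightarrow> 'a) \<Rightarrow> real \<Rightarrow> real \<Rightarrow> 'a set" where
  "trans_points \<P> \<mu> c g a b = g ` {a..b} - deep_points \<P> \<mu> c g a b"

(* Sides are indexed by {0,1,2} and oriented cyclically: side i ends where side i+1 (mod 3) starts. *)
definition cyclic_triangle :: "(nat \<Rightarrow> real \<Rightarrow> 'a) \<Rightarrow> (nat \<Rightarrow> real) \<Rightarrow> (nat \<Rightarrow> real) \<Rightarrow> bool" where
  "cyclic_triangle \<gamma> a b \<longleftrightarrow> (\<forall>i<3. \<gamma> i (b i) = \<gamma> (Suc i mod 3) (a (Suc i mod 3)))"

definition entrance_point :: "(real \<Rightarrow> 'a) \<Rightarrow> real \<Rightarrow> real \<Rightarrow> 'a set \<Rightarrow> 'a \<Rightarrow> bool" where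
  "entrance_point g a b S x \<longleftrightarrow>
     (\<exists>t\<in>{a..b}. x = g t \<and> g t \<in> S \<and> (\<forall>s\<in>{a..<t}. g s \<notin> S))"

definition exit_point :: "(real \<Rightarrow> 'a) \<Rightarrow> real \<Rightarrow> real \<Rightarrow> 'a set \<Rightarrow> 'a \<Rightarrow> bool" where
  "exit_point g a b S y \<longleftrightarrow>
     (\<exists>t\<in>{a..b}. y = g t \<and> g t \<in> S \<and> (\<forall>s\<in>{t<..b}. g s \<notin> S))"

(* The boundedness conjunct is needed because diameter is unspecified on unbounded sets. *)
definition alpha1 :: "'a::metric_space set set \<Rightarrow> bool" where
  "alpha1 \<P> \<longleftrightarrow> (\<forall>K. \<exists>B. \<forall>P\<in>\<P>. \<forall>Q\<in>\<P>. P \<noteq> Q \<longrightarrow>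
     bounded (nbhd K P \<inter> nbhd K Q) \<and> diameter (nbhd K P \<inter> nbhd K Q) \<le> B)"

definition alpha2 :: "'a::metric_space set set \<Rightarrow> bool" where
  "alpha2 \<P> \<longleftrightarrow> (\<exists>\<epsilon> M. 0 < \<epsilon> \<and> \<epsilon> < 1/2 \<and> 0 \<le> M \<and>
     (\<forall>P\<in>\<P>. \<forall>x y. x \<in> nbhd (\<epsilon> * dist x y) P \<and> y \<in> nbhd (\<epsilon> * dist x y) P \<longrightarrow>
        (\<forall>g a b. geodesic_from_to x y g a b \<longrightarrow> g ` {a..b} \<inter> nbhd M P \<noteq> {})))"

definition asymptotically_tree_graded :: "'a::metric_space set set \<Rightarrow> bool" where
  "asymptotically_tree_graded \<P> \<longleftrightarrow> (\<forall>C\<ge>0. \<exists>\<sigma> \<delta>. \<forall>\<gamma> a b.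
     cyclic_triangle \<gamma> a b \<and> (\<forall>i<3. almost_geodesic 1 C (\<gamma> i) (a i) (b i)) \<longrightarrow>
       (\<exists>p. \<forall>i<3. cball p \<sigma> \<inter> \<gamma> i ` {a i..b i} \<noteq> {}) \<or>
       (\<exists>P\<in>\<P>. (\<forall>i<3. nbhd \<sigma> P \<inter> \<gamma> i ` {a i..b i} \<noteq> {}) \<and>
          (\<exists>x y. (\<forall>i<3. entrance_point (\<gamma> i) (a i) (b i) (nbhd \<sigma> P) (x i) \<and>
                          exit_point (\<gamma> i) (a i) (b i) (nbhd \<sigma> P) (y i)) \<and>
                 (\<forall>i<3. dist (y i) (x (Suc i mod 3)) \<le> \<delta>))))"

definition hyperbolic_relative_to :: "'a::metric_space set set \<Rightarrow> bool" where
  "hyperbolic_relative_to \<P> \<longleftrightarrow> alpha1 \<P> \<and> alpha2 \<P> \<and> asymptotically_tree_graded \<P>"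

end

theory Submission imports Defs
begin

text \<open>The common ground of the two descriptions is the notion of a gate: a gate of a point \<open>x\<close> in
  \<open>N\<^sub>k(P)\<close> is the first point in \<open>N\<^sub>k(P)\<close> of some geodesic issuing from \<open>x\<close>. Two facts about gates
  carry the proof. Any two gates of \<open>x\<close> in the same \<open>N\<^sub>k(P)\<close> are uniformly close
  (\<open>coarse_gates\<close>), so a piece \<open>P\<close> has a coarse projection; and if the gates of \<open>x\<close> and \<open>y\<close> are far
  apart, every geodesic from \<open>x\<close> to \<open>y\<close> comes close to both of them (\<open>geodesic_passes_gate\<close>).

  In both directions the pieces first turn out to have bounded excursions: a geodesic that starts
  and ends near \<open>P\<close> but avoids \<open>N\<^sub>\<mu>(P)\<close> in between is short. Hence geodesics with ends in \<open>N\<^sub>\<mu>(P)\<close>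
  stay in some \<open>N\<^sub>\<mu>\<^sub>'(P)\<close>. As distinct pieces overlap boundedly, for all large \<open>R\<close> the point where a
  geodesic begins a long stay in \<open>N\<^sub>\<mu>(P)\<close> is transient, and a connected run of deep points belongs to
  a single piece.

  Suppose that \<open>X\<close> is relatively hyperbolic. Uniqueness of gates comes from the triangle spanned by \<open>x\<close> and
  two of its gates. Cutting a side of a triangle at a transient point and applying
  tree-gradedness to almost-geodesic triangles whose first two sides are the two halves shows that
  the point is close to the union of the other two sides; almost-geodesics are needed because the
  third side is a geodesic with a short segment attached. If the nearby point is deep for a piece
  \<open>Q\<close>, then comparing the gates of the three vertices in \<open>Q\<close> yields a nearby transient point
  (\<open>transient_upgrade\<close>).

  Conversely, suppose that transient points concentrate near the ends along pieces and that
  triangles are thin on transient points. Here uniqueness of gates is the main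
  difficulty. If \<open>x\<close> had two remote gates, then every point between them would be close to a gate
  of \<open>x\<close>, and a geodesic to any of these gates would finish with a long stretch along a piece other than
  \<open>P\<close>. Two such gates at moderate distance from each other share that piece, which
  therefore has a large overlap with \<open>P\<close>. Once gates are coarsely unique, a geodesic whose ends are relatively close to a piece
  meets a fixed neighbourhood of it by \<open>geodesic_passes_gate\<close>. For tree-gradedness, a transient point of a geodesic lies near every
  \<open>(1, C)\<close>-almost-geodesic with the same ends, by comparing lengths. Walking along one side of a triangle,
  from transient points near the third side to transient points near the second, one either meets a point near both, or
  crosses a run of deep points; the piece of that run is the one required, and uniqueness of gates
  matches the entrance and exit points.\<close>

section \<open>Neighbourhoods, geodesics and transient points\<close>

lemma nbhd_mono: "x \<in> nbhd k P \<Longrightarrow> k \<le> k' \<Longrightarrow> x \<in> nbhd k' P"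
  by (auto simp: nbhd_def)

lemma nbhd_dist:
  assumes "x \<in> nbhd k P" "dist x y \<le> d"
  shows "y \<in> nbhd (k + d) P"
  using assms infdist_triangle[of y P x] by (auto simp: nbhd_def dist_commute)

lemma nbhd_obtain:
  assumes "x \<in> nbhd k P"
  obtains p where "p \<in> P" "dist x p \<le> k + 1"
proof -
  have ne: "P \<noteq> {}" and "infdist x P < k + 1" using assms by (auto simp: nbhd_def)
  then have "(INF p\<in>P. dist x p) < k + 1" by (simp add: infdist_def)
  then obtain p where "p \<in> P" "dist x p < k + 1"
    using ne by (auto simp: cINF_less_iff)
  then show ?thesis using that by force
qed

lemma nbhd_mem: "p \<in> P \<Longrightarrow> dist x p \<le> k \<Longrightarrow> x \<in> nbhd k P"
  using infdist_le[of p P x] by (auto simp: nbhd_def)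

lemma closed_nbhd: "closed (nbhd k P)"
  by (cases "P = {}") (auto simp: nbhd_def intro!: closed_Collect_le continuous_intros)

lemma geodesic_dist:
  "geodesic g a b \<Longrightarrow> s \<in> {a..b} \<Longrightarrow> t \<in> {a..b} \<Longrightarrow> dist (g s) (g t) = \<bar>s - t\<bar>"
  by (simp add: geodesic_def)

lemma geodesic_sub: "geodesic g a b \<Longrightarrow> a \<le> s \<Longrightarrow> s \<le> u \<Longrightarrow> u \<le> b \<Longrightarrow> geodesic g s u"
  by (auto simp: geodesic_def)

lemma geodesic_continuous: "geodesic g a b \<Longrightarrow> continuous_on {a..b} g"
  unfolding geodesic_def continuous_on_iff
  by (metis dist_commute dist_real_def)

lemma geodesic_rev: "geodesic g a b \<Longrightarrow> geodesic (\<lambda>t. g (-t)) (-b) (-a)"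
  unfolding geodesic_def by (auto simp: abs_minus_commute)

lemma geodesic_from_to_rev:
  "geodesic_from_to x y g a b \<Longrightarrow> geodesic_from_to y x (\<lambda>t. g (-t)) (-b) (-a)"
  using geodesic_rev by (auto simp: geodesic_from_to_def)

lemma rev_image: "(\<lambda>t. g (-t)) ` {-b..-a} = g ` {a..b::real}"
proof -
  have "(\<lambda>t. g (-t)) ` {-b..-a} = g ` (uminus ` {-b..-a})" by (simp add: image_image del: image_uminus_atLeastAtMost)
  then show ?thesis by simp
qed

lemma deep_points_rev_subset:
  "deep_points \<P> \<mu> c g a b \<subseteq> deep_points \<P> \<mu> c (\<lambda>t. g (-t)) (-b) (-a)"
proof
  fix x assume x: "x \<in> deep_points \<P> \<mu> c g a b"
  then obtain s u P where "x \<in> g ` {a..b}" "a \<le> s" "s \<le> u" "u \<le> b" "x \<in> g ` {s..u}" "P \<in> \<P>"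
    "g s \<in> nbhd \<mu> P" "g u \<in> nbhd \<mu> P" "dist x (g s) > c" "dist x (g u) > c"
    by (auto simp: deep_points_def)
  then show "x \<in> deep_points \<P> \<mu> c (\<lambda>t. g (-t)) (-b) (-a)"
    unfolding deep_points_def
    by (intro CollectI conjI exI[of _ "-u"] exI[of _ "-s"] bexI[of _ P]) (auto simp: rev_image)
qed

lemma trans_points_rev:
  "trans_points \<P> \<mu> c (\<lambda>t. g (-t)) (-b) (-a) = trans_points \<P> \<mu> c g a b"
  using deep_points_rev_subset[of \<P> \<mu> c g a b] deep_points_rev_subset[of \<P> \<mu> c "\<lambda>t. g (-t)" "-b" "-a"]
  by (auto simp: trans_points_def rev_image)

lemma trans_points_iff:
  assumes "geodesic g a b" "t \<in> {a..b}" "0 \<le> c"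
  shows "g t \<in> trans_points \<P> \<mu> c g a b \<longleftrightarrow>
    \<not> (\<exists>s u. a \<le> s \<and> s < t - c \<and> t + c < u \<and> u \<le> b \<and> (\<exists>P\<in>\<P>. g s \<in> nbhd \<mu> P \<and> g u \<in> nbhd \<mu> P))"
    (is "?L \<longleftrightarrow> \<not> ?R")
proof
  assume L: ?L
  show "\<not> ?R"
  proof
    assume ?R
    then obtain s u P where *: "a \<le> s" "s < t - c" "t + c < u" "u \<le> b" "P \<in> \<P>"
       "g s \<in> nbhd \<mu> P" "g u \<in> nbhd \<mu> P" by auto
    then have "dist (g t) (g s) > c" "dist (g t) (g u) > c"
      using geodesic_dist[OF assms(1), of t s] geodesic_dist[OF assms(1), of t u] assms by auto
    then have "g t \<in> deep_points \<P> \<mu> c g a b"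
      unfolding deep_points_def using * assms(2,3)
      by (intro CollectI conjI exI[of _ s] exI[of _ u] bexI[of _ P]) auto
    then show False using L by (auto simp: trans_points_def)
  qed
next
  assume nR: "\<not> ?R"
  have "g t \<notin> deep_points \<P> \<mu> c g a b"
  proof
    assume "g t \<in> deep_points \<P> \<mu> c g a b"
    then obtain s u P r where *: "a \<le> s" "s \<le> u" "u \<le> b" "r \<in> {s..u}" "g t = g r" "P \<in> \<P>"
      "g s \<in> nbhd \<mu> P" "g u \<in> nbhd \<mu> P" "dist (g t) (g s) > c" "dist (g t) (g u) > c"
      by (auto simp: deep_points_def)
    have "r = t" using geodesic_dist[OF assms(1), of t r] * assms by auto
    then have st: "s \<le> t" "t \<le> u" using * by auto
    have "dist (g t) (g s) = t - s" "dist (g t) (g u) = u - t"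
      using geodesic_dist[OF assms(1), of t s] geodesic_dist[OF assms(1), of t u] *(1,3) st by auto
    then have "s < t - c" "t + c < u" using *(9,10) by linarith+
    then show False using nR * by blast
  qed
  then show ?L using assms by (auto simp: trans_points_def)
qed

lemma trans_points_sub:
  assumes "geodesic g a b" "0 \<le> c" "a \<le> s" "u \<le> b" "t \<in> {s..u}" "g t \<in> trans_points \<P> \<mu> c g a b"
  shows "g t \<in> trans_points \<P> \<mu> c g s u"
proof -
  have "geodesic g s u" using geodesic_sub[OF assms(1,3) _ assms(4)] assms(5) by auto
  moreover have "t \<in> {a..b}" using assms by auto
  ultimately show ?thesis
    using assms trans_points_iff[of g a b t c \<P> \<mu>] trans_points_iff[of g s u t c \<P> \<mu>]
    by (meson order_trans)
qed

lemma trans_points_ends: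
  assumes "geodesic g a b" "0 \<le> c"
  shows "g a \<in> trans_points \<P> \<mu> c g a b" "g b \<in> trans_points \<P> \<mu> c g a b"
proof -
  have "a \<le> b" using assms by (simp add: geodesic_def)
  then show "g a \<in> trans_points \<P> \<mu> c g a b" "g b \<in> trans_points \<P> \<mu> c g a b"
    using assms by (subst trans_points_iff; force)+
qed

lemma trans_points_image: "trans_points \<P> \<mu> c g a b \<subseteq> g ` {a..b}"
  by (auto simp: trans_points_def)

lemma first_hit:
  fixes g :: "real \<Rightarrow> 'a::metric_space"
  assumes "continuous_on {a..b} g" "closed S" "t \<in> {a..b}" "g t \<in> S"
  obtains e where "e \<in> {a..t}" "g e \<in> S" "\<And>r. r \<in> {a..<e} \<Longrightarrow> g r \<notin> S"
proof -
  have c: "continuous_on {a..t} g" using assms by (auto elim: continuous_on_subset)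
  have "closed ({a..t} \<inter> g -` S)"
    by (rule continuous_closed_preimage[OF c]) (use assms in auto)
  then have "compact ({a..t} \<inter> g -` S)"
    by (metis compact_Icc compact_Int_closed inf.left_idem)
  moreover have "t \<in> {a..t} \<inter> g -` S" using assms by auto
  ultimately obtain e where e: "e \<in> {a..t} \<inter> g -` S" "\<And>r. r \<in> {a..t} \<inter> g -` S \<Longrightarrow> e \<le> r"
    using compact_attains_inf by (metis empty_iff)
  show ?thesis by (rule that[of e]) (use e in force)+
qed

lemma last_hit:
  fixes g :: "real \<Rightarrow> 'a::metric_space"
  assumes "continuous_on {a..b} g" "closed S" "t \<in> {a..b}" "g t \<in> S"
  obtains e where "e \<in> {t..b}" "g e \<in> S" "\<And>r. r \<in> {e<..b} \<Longrightarrow> g r \<notin> S"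
proof -
  have "continuous_on {-b..-a} (\<lambda>t. g (-t))"
    by (rule continuous_on_compose2[OF assms(1)]) (auto intro!: continuous_intros)
  from first_hit[OF this assms(2), of "-t"] assms
  obtain e where e: "e \<in> {-b..-t}" "g (-e) \<in> S" and *: "\<And>r. r \<in> {-b..<e} \<Longrightarrow> g (-r) \<notin> S"
    by auto
  have "g r \<notin> S" if "r \<in> {-e<..b}" for r using *[of "-r"] that by auto
  then show ?thesis using that[of "-e"] e by auto
qed

lemma obtain_geodesic:
  assumes "geodesic_metric_space TYPE('a::metric_space)"
  obtains g a b where "geodesic_from_to (x::'a) y g a b" "b - a = dist x y"
proof -
  obtain g a b where g: "geodesic_from_to x y g a b"
    using assms unfolding geodesic_metric_space_def by blast
  then have "b - a = dist x y" by (auto simp: geodesic_from_to_def geodesic_def)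
  with g show ?thesis using that by blast
qed

lemma geodesic_from_to_length: "geodesic_from_to x y g a b \<Longrightarrow> b - a = dist x y"
  by (auto simp: geodesic_from_to_def geodesic_def)

section \<open>Gates\<close>

text \<open>The access paths are kept apart from the gates themselves: several arguments compare points on a
  chosen access path, while the final bounds concern the gates only.\<close>

definition access ::
  "real \<Rightarrow> 'a::metric_space set \<Rightarrow> 'a \<Rightarrow> 'a \<Rightarrow> (real \<Rightarrow> 'a) \<Rightarrow> real \<Rightarrow> real \<Rightarrow> bool" where
  "access k P x e g a b \<longleftrightarrow>
     geodesic_from_to x e g a b \<and> e \<in> nbhd k P \<and> (\<forall>t\<in>{a..<b}. g t \<notin> nbhd k P)"

definition gate :: "real \<Rightarrow> 'a::metric_space set \<Rightarrow> 'a \<Rightarrow> 'a \<Rightarrow> bool" where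
  "gate k P x e \<longleftrightarrow> (\<exists>g a b. access k P x e g a b)"

lemma gate_nbhd: "gate k P x e \<Longrightarrow> e \<in> nbhd k P"
  by (auto simp: gate_def access_def)

lemma gate_first:
  assumes "geodesic_from_to x y g a b" "t \<in> {a..b}" "g t \<in> nbhd k P"
  obtains e where "e \<in> {a..t}" "gate k P x (g e)" "\<And>r. r \<in> {a..<e} \<Longrightarrow> g r \<notin> nbhd k P"
proof -
  have g: "geodesic g a b" "g a = x" using assms by (auto simp: geodesic_from_to_def)
  from first_hit[OF geodesic_continuous[OF g(1)] closed_nbhd assms(2,3)]
  obtain e where e: "e \<in> {a..t}" "g e \<in> nbhd k P" "\<And>r. r \<in> {a..<e} \<Longrightarrow> g r \<notin> nbhd k P" by blast
  have "geodesic g a e" by (rule geodesic_sub[OF g(1)]) (use e assms in auto)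
  then have "gate k P x (g e)" unfolding gate_def access_def geodesic_from_to_def using e g
    by (intro exI[of _ g] exI[of _ a] exI[of _ e]) auto
  then show ?thesis using that e by blast
qed

lemma gate_last:
  assumes "geodesic_from_to x y g a b" "t \<in> {a..b}" "g t \<in> nbhd k P"
  obtains e where "e \<in> {t..b}" "gate k P y (g e)" "\<And>r. r \<in> {e<..b} \<Longrightarrow> g r \<notin> nbhd k P"
proof -
  from gate_first[OF geodesic_from_to_rev[OF assms(1)], of "-t" k P] assms
  obtain e where e: "e \<in> {-b..-t}" "gate k P y (g (-e))" and *: "\<And>r. r \<in> {-b..<e} \<Longrightarrow> g (-r) \<notin> nbhd k P"
    by auto
  have "g r \<notin> nbhd k P" if "r \<in> {-e<..b}" for r using *[of "-r"] that by auto
  then show ?thesis using that[of "-e"] e by auto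
qed

lemma gate_exists:
  assumes "geodesic_metric_space TYPE('a)" and y: "(y::'a::metric_space) \<in> nbhd k P"
  obtains e where "gate k P x e" "dist x e \<le> dist x y"
proof -
  obtain g a b where g: "geodesic_from_to x y g a b" using obtain_geodesic[OF assms(1)] by metis
  then have gg: "geodesic g a b" "g b = y" "g a = x" "a \<le> b" by (auto simp: geodesic_from_to_def geodesic_def)
  have "b \<in> {a..b}" "g b \<in> nbhd k P" using gg y by auto
  from gate_first[OF g this] obtain e where e: "e \<in> {a..b}" "gate k P x (g e)" by blast
  have "dist x (g e) \<le> dist x y"
    using geodesic_dist[OF gg(1), of a e] geodesic_dist[OF gg(1), of a b] e gg by auto
  with e that show ?thesis by blast
qed

section \<open>Families of sets with bounded excursions\<close>

definition bounded_excursions :: "'a::metric_space set set \<Rightarrow> real \<Rightarrow> bool" where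
  "bounded_excursions \<P> \<mu> \<longleftrightarrow> (\<forall>k. \<exists>K. \<forall>P\<in>\<P>. \<forall>g a b. geodesic g a b \<and> g a \<in> nbhd k P \<and> g b \<in> nbhd k P \<and>
     (\<forall>t\<in>{a<..<b}. g t \<notin> nbhd \<mu> P) \<longrightarrow> b - a \<le> K)"

text \<open>Let \<open>k \<ge> \<mu>\<close>. A point outside \<open>N\<^sub>k(P)\<close> lies on an excursion whose ends are the last point of
  \<open>N\<^sub>k(P)\<close> before it and the first one after it, so its distance from \<open>N\<^sub>k(P)\<close> is at most the length of that
  excursion.\<close>

lemma bounded_excursions_hull:
  assumes "bounded_excursions \<P> \<mu>"
  obtains k' where "k \<le> k'" "\<mu> \<le> k'" "\<And>P g a b t. P \<in> \<P> \<Longrightarrow> geodesic g a b \<Longrightarrow> g a \<in> nbhd k P \<Longrightarrow> g b \<in> nbhd k P \<Longrightarrow>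
    t \<in> {a..b} \<Longrightarrow> g t \<in> nbhd k' P"
proof -
  define h where "h = max k \<mu>"
  obtain K where K: "\<forall>P\<in>\<P>. \<forall>g a b. geodesic g a b \<and> g a \<in> nbhd h P \<and> g b \<in> nbhd h P \<and>
     (\<forall>t\<in>{a<..<b}. g t \<notin> nbhd \<mu> P) \<longrightarrow> b - a \<le> K"
    using assms[unfolded bounded_excursions_def, rule_format, of h] ..
  have "g t \<in> nbhd (h + max K 0) P"
    if P: "P \<in> \<P>" and g: "geodesic g a b" "g a \<in> nbhd k P" "g b \<in> nbhd k P" "t \<in> {a..b}" for P g a b t
  proof (cases "g t \<in> nbhd h P")
    case True then show ?thesis by (rule nbhd_mono) auto
  next
    case False
    have ab: "g a \<in> nbhd h P" "g b \<in> nbhd h P" using g by (auto intro: nbhd_mono simp: h_def)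
    have ct: "continuous_on {a..t} g" "continuous_on {t..b} g" using geodesic_continuous[OF g(1)] g(4)
      by (auto elim: continuous_on_subset)
    obtain s where s: "s \<in> {a..t}" "g s \<in> nbhd h P" "\<And>r. r \<in> {s<..t} \<Longrightarrow> g r \<notin> nbhd h P"
      using last_hit[OF ct(1) closed_nbhd, of a h P] ab g(4) by auto
    obtain u where u: "u \<in> {t..b}" "g u \<in> nbhd h P" "\<And>r. r \<in> {t..<u} \<Longrightarrow> g r \<notin> nbhd h P"
      using first_hit[OF ct(2) closed_nbhd, of b h P] ab g(4) by auto
    have "u - s \<le> K"
    proof (rule K[rule_format, OF P], intro conjI ballI)
      show "geodesic g s u" using g s u by (auto intro: geodesic_sub)
      fix r assume r: "r \<in> {s<..<u}"
      have "g r \<notin> nbhd h P" using s(3)[of r] u(3)[of r] r by (cases "r \<le> t") auto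
      then show "g r \<notin> nbhd \<mu> P" using nbhd_mono[of _ \<mu> P h] by (auto simp: h_def)
    qed (use s u in auto)
    then have "dist (g s) (g t) \<le> max K 0"
      using geodesic_dist[OF g(1), of s t] g s u by auto
    then show ?thesis using nbhd_dist[OF s(2)] by auto
  qed
  then show ?thesis using that[of "h + max K 0"] by (auto simp: h_def)
qed

text \<open>The \<open>\<mu>'\<close>-neighbourhood of a piece contains every geodesic with both ends in its
  \<open>\<mu>\<close>-neighbourhood, and \<open>R\<close> exceeds all distances within the intersection of two such
  neighbourhoods. So no stretch of length \<open>R\<close> of a geodesic can lie between points of \<open>N\<^sub>\<mu>(P)\<close>
  and also between points of \<open>N\<^sub>\<mu>(Q)\<close> for distinct pieces \<open>P\<close> and \<open>Q\<close>.\<close>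

locale peripheral =
  fixes \<P> :: "'a::metric_space set set" and \<mu> \<mu>' R :: real
  assumes geod: "geodesic_metric_space TYPE('a)"
    and R_pos: "0 < R"
    and intersections: "\<exists>B. \<forall>P\<in>\<P>. \<forall>Q\<in>\<P>. P \<noteq> Q \<longrightarrow>
        (\<forall>x\<in>nbhd k P \<inter> nbhd k Q. \<forall>y\<in>nbhd k P \<inter> nbhd k Q. dist x y \<le> B)"
    and excursions: "bounded_excursions \<P> \<mu>"
    and hull_mu: "\<lbrakk>P \<in> \<P>; geodesic g a b; g a \<in> nbhd \<mu> P; g b \<in> nbhd \<mu> P; t \<in> {a..b}\<rbrakk> \<Longrightarrow> g t \<in> nbhd \<mu>' P"
    and separated: "\<lbrakk>P \<in> \<P>; Q \<in> \<P>; P \<noteq> Q; x \<in> nbhd \<mu>' P; x \<in> nbhd \<mu>' Q; y \<in> nbhd \<mu>' P; y \<in> nbhd \<mu>' Q\<rbrakk>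
        \<Longrightarrow> dist x y < R"
begin

abbreviation "Trans g a b \<equiv> trans_points \<P> \<mu> R g a b"

lemma intersection_bound:
  obtains B where "0 \<le> B" "\<And>P Q x y. \<lbrakk>P \<in> \<P>; Q \<in> \<P>; P \<noteq> Q; x \<in> nbhd k P; x \<in> nbhd k Q; y \<in> nbhd k P; y \<in> nbhd k Q\<rbrakk>
    \<Longrightarrow> dist x y \<le> B"
proof -
  obtain B where B: "\<forall>P\<in>\<P>. \<forall>Q\<in>\<P>. P \<noteq> Q \<longrightarrow>
        (\<forall>x\<in>nbhd k P \<inter> nbhd k Q. \<forall>y\<in>nbhd k P \<inter> nbhd k Q. dist x y \<le> B)" using intersections[of k] ..
  show ?thesis
  proof (rule that[of "max B 0"])
    fix P Q x y
    assume "P \<in> \<P>" "Q \<in> \<P>" "P \<noteq> Q" "x \<in> nbhd k P" "x \<in> nbhd k Q" "y \<in> nbhd k P" "y \<in> nbhd k Q"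
    then have "dist x y \<le> B" using B by blast
    then show "dist x y \<le> max B 0" by simp
  qed simp
qed

lemma excursion_bound:
  obtains K where "0 \<le> K" "\<And>P g a b. \<lbrakk>P \<in> \<P>; geodesic g a b; g a \<in> nbhd k P; g b \<in> nbhd k P;
     \<And>t. t\<in>{a<..<b} \<Longrightarrow> g t \<notin> nbhd \<mu> P\<rbrakk> \<Longrightarrow> b - a \<le> K"
proof -
  obtain K where K: "\<forall>P\<in>\<P>. \<forall>g a b. geodesic g a b \<and> g a \<in> nbhd k P \<and> g b \<in> nbhd k P \<and>
     (\<forall>t\<in>{a<..<b}. g t \<notin> nbhd \<mu> P) \<longrightarrow> b - a \<le> K"
    using excursions unfolding bounded_excursions_def by blast
  have "b - a \<le> max K 0" if "P \<in> \<P>" "geodesic g a b" "g a \<in> nbhd k P" "g b \<in> nbhd k P"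
     "\<And>t. t\<in>{a<..<b} \<Longrightarrow> g t \<notin> nbhd \<mu> P" for P g a b
    using K that by (meson max.coboundedI1)
  then show ?thesis using that[of "max K 0"] by fastforce
qed

lemma hull:
  obtains k' where "k \<le> k'" "\<mu> \<le> k'" "\<And>P g a b t. \<lbrakk>P \<in> \<P>; geodesic g a b; g a \<in> nbhd k P; g b \<in> nbhd k P;
    t \<in> {a..b}\<rbrakk> \<Longrightarrow> g t \<in> nbhd k' P"
  by (rule bounded_excursions_hull[OF excursions, of k]) blast

text \<open>The initial and the final part of a geodesic outside \<open>N\<^sub>\<mu>(P)\<close> are excursions, so a long geodesic
  with ends near \<open>P\<close> reaches \<open>N\<^sub>\<mu>(P)\<close> soon after its start and leaves it shortly before its end.\<close>

lemma near_peripheral: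
  obtains K where "0 \<le> K" "\<And>P g a b. \<lbrakk>P \<in> \<P>; geodesic g a b; g a \<in> nbhd k P; g b \<in> nbhd k P; K < b - a\<rbrakk>
    \<Longrightarrow> \<exists>s u. s \<in> {a..a + K} \<and> s \<le> b \<and> g s \<in> nbhd \<mu> P \<and> u \<in> {b - K..b} \<and> a \<le> u \<and> g u \<in> nbhd \<mu> P"
proof -
  define h where "h = max k \<mu>"
  obtain K where K0: "0 \<le> K" and K: "\<And>P g a b. \<lbrakk>P \<in> \<P>; geodesic g a b; g a \<in> nbhd h P; g b \<in> nbhd h P;
     \<And>t. t\<in>{a<..<b} \<Longrightarrow> g t \<notin> nbhd \<mu> P\<rbrakk> \<Longrightarrow> b - a \<le> K"
    by (rule excursion_bound[of h]) blast
  have "\<exists>s u. s \<in> {a..a + K} \<and> s \<le> b \<and> g s \<in> nbhd \<mu> P \<and> u \<in> {b - K..b} \<and> a \<le> u \<and> g u \<in> nbhd \<mu> P"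
    if P: "P \<in> \<P>" and g: "geodesic g a b" "g a \<in> nbhd k P" "g b \<in> nbhd k P" "K < b - a" for P g a b
  proof -
    have ab: "g a \<in> nbhd h P" "g b \<in> nbhd h P" using g by (auto intro: nbhd_mono simp: h_def)
    have mh: "x \<in> nbhd \<mu> P \<Longrightarrow> x \<in> nbhd h P" for x by (auto intro: nbhd_mono simp: h_def)
    obtain t where t: "t \<in> {a<..<b}" "g t \<in> nbhd \<mu> P"
      using K[OF P g(1) ab] g(4) by fastforce
    note c = geodesic_continuous[OF g(1)]
    obtain s where s: "s \<in> {a..t}" "g s \<in> nbhd \<mu> P" "\<And>r. r \<in> {a..<s} \<Longrightarrow> g r \<notin> nbhd \<mu> P"
      using first_hit[OF c closed_nbhd, of t \<mu> P] t by auto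
    obtain u where u: "u \<in> {t..b}" "g u \<in> nbhd \<mu> P" "\<And>r. r \<in> {u<..b} \<Longrightarrow> g r \<notin> nbhd \<mu> P"
      using last_hit[OF c closed_nbhd, of t \<mu> P] t by auto
    have "s - a \<le> K"
      by (rule K[OF P, of g]) (use g s t ab in \<open>auto intro: geodesic_sub mh\<close>)
    moreover have "b - u \<le> K"
      by (rule K[OF P, of g]) (use g u t ab in \<open>auto intro: geodesic_sub mh\<close>)
    ultimately show ?thesis using s u t by (intro exI[of _ s] exI[of _ u]) auto
  qed
  then show ?thesis using that[of K] K0 by blast
qed

text \<open>If the entrance point into \<open>N\<^sub>\<mu>(P)\<close> were deep, then not because of \<open>P\<close>, which has not been met
  before; and another piece would accompany \<open>P\<close> for a distance \<open>R\<close> beyond the entrance point.\<close>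

lemma first_point_transient:
  assumes P: "P \<in> \<P>" and g: "geodesic g a b" and s: "s \<in> {a..b}" "g s \<in> nbhd \<mu> P"
    and first: "\<And>r. r \<in> {a..<s} \<Longrightarrow> g r \<notin> nbhd \<mu> P"
    and u: "u \<in> {s..b}" "g u \<in> nbhd \<mu> P" "R \<le> u - s"
  shows "g s \<in> Trans g a b"
proof (rule ccontr)
  assume "g s \<notin> Trans g a b"
  then obtain r1 r2 Q where r: "a \<le> r1" "r1 < s - R" "s + R < r2" "r2 \<le> b" "Q \<in> \<P>"
    "g r1 \<in> nbhd \<mu> Q" "g r2 \<in> nbhd \<mu> Q"
    using trans_points_iff[OF g s(1), of R \<P> \<mu>] R_pos by auto
  have "Q \<noteq> P" using first[of r1] r R_pos by auto
  have gQ: "geodesic g r1 r2" and gP: "geodesic g s u"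
    using g r s u R_pos by (auto intro: geodesic_sub)
  have "g s \<in> nbhd \<mu>' Q" "g (s + R) \<in> nbhd \<mu>' Q"
    by (rule hull_mu[OF r(5) gQ r(6,7)]; use r R_pos in auto)+
  moreover have "g s \<in> nbhd \<mu>' P" "g (s + R) \<in> nbhd \<mu>' P"
    by (rule hull_mu[OF P gP s(2) u(2)]; use u R_pos in auto)+
  ultimately have "dist (g s) (g (s + R)) < R" using separated[OF P r(5)] \<open>Q \<noteq> P\<close> by auto
  then show False using geodesic_dist[OF g, of s "s + R"] s u R_pos by auto
qed

text \<open>For a larger neighbourhood the entrance point itself need not be transient, but the point where the geodesic
  then reaches \<open>N\<^sub>\<mu>(P)\<close> is, and it comes soon after.\<close>

lemma entry_transient:
  assumes "\<mu> \<le> k"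
  obtains K where "0 \<le> K" "\<And>P g a b e u. \<lbrakk>P \<in> \<P>; geodesic g a b; a \<le> e; e \<le> u; u \<le> b; g e \<in> nbhd k P;
     \<And>r. r \<in> {a..<e} \<Longrightarrow> g r \<notin> nbhd k P; g u \<in> nbhd k P; K < u - e\<rbrakk> \<Longrightarrow>
     \<exists>t\<in>{e..e + K}. t \<le> u \<and> g t \<in> Trans g a b \<and> g t \<in> nbhd \<mu> P"
proof -
  obtain K where K0: "0 \<le> K" and K: "\<And>P g a b. \<lbrakk>P \<in> \<P>; geodesic g a b; g a \<in> nbhd k P; g b \<in> nbhd k P; K < b - a\<rbrakk>
    \<Longrightarrow> \<exists>s u. s \<in> {a..a + K} \<and> s \<le> b \<and> g s \<in> nbhd \<mu> P \<and> u \<in> {b - K..b} \<and> a \<le> u \<and> g u \<in> nbhd \<mu> P"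
    by (rule near_peripheral[of k]) blast
  have "\<exists>t\<in>{e..e + (2 * K + R)}. t \<le> u \<and> g t \<in> Trans g a b \<and> g t \<in> nbhd \<mu> P"
    if P: "P \<in> \<P>" and g: "geodesic g a b" "a \<le> e" "e \<le> u" "u \<le> b" "g e \<in> nbhd k P"
     and first: "\<And>r. r \<in> {a..<e} \<Longrightarrow> g r \<notin> nbhd k P" and u: "g u \<in> nbhd k P" "2 * K + R < u - e" for P g a b e u
  proof -
    have "geodesic g e u" using g by (auto intro: geodesic_sub)
    then obtain s v where sv: "s \<in> {e..e + K}" "s \<le> u" "g s \<in> nbhd \<mu> P" "v \<in> {u - K..u}" "e \<le> v" "g v \<in> nbhd \<mu> P"
      using K[OF P, of g e u] g u R_pos K0 by auto
    have "s \<in> {a..b}" using sv g by auto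
    then obtain t where t: "t \<in> {a..s}" "g t \<in> nbhd \<mu> P" "\<And>r. r \<in> {a..<t} \<Longrightarrow> g r \<notin> nbhd \<mu> P"
      using first_hit[OF geodesic_continuous[OF g(1)] closed_nbhd _ sv(3)] by blast
    have te: "e \<le> t" using first[of t] t nbhd_mono[OF t(2) assms] by force
    have "g t \<in> Trans g a b"
      by (rule first_point_transient[OF P g(1), of t v]) (use t sv g u te R_pos K0 in auto)
    then show ?thesis using t te sv K0 R_pos by (intro bexI[of _ t]) auto
  qed
  then show ?thesis using that[of "2 * K + R"] K0 R_pos by auto
qed

text \<open>The rest of the access path beyond a point near \<open>P\<close> is an excursion.\<close>

lemma access_bound:
  assumes "\<mu> \<le> k"
  obtains K where "0 \<le> K"
    "\<And>P x e g a b t. \<lbrakk>P \<in> \<P>; access k P x e g a b; t \<in> {a..b}; g t \<in> nbhd k' P\<rbrakk> \<Longrightarrow> dist (g t) e \<le> K"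
proof -
  define h where "h = max k k'"
  obtain K where K0: "0 \<le> K" and K: "\<And>P g a b. \<lbrakk>P \<in> \<P>; geodesic g a b; g a \<in> nbhd h P; g b \<in> nbhd h P;
     \<And>t. t\<in>{a<..<b} \<Longrightarrow> g t \<notin> nbhd \<mu> P\<rbrakk> \<Longrightarrow> b - a \<le> K"
    by (rule excursion_bound[of h]) blast
  have "dist (g t) e \<le> K"
    if P: "P \<in> \<P>" and acc: "access k P x e g a b" and t: "t \<in> {a..b}" "g t \<in> nbhd k' P" for P x e g a b t
  proof -
    have g: "geodesic g a b" "g b \<in> nbhd k P" "g b = e"
      and *: "\<And>r. r \<in> {a..<b} \<Longrightarrow> g r \<notin> nbhd k P"
      using acc by (auto simp: access_def geodesic_from_to_def)
    have "b - t \<le> K"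
    proof (rule K[OF P, of g])
      show "g t \<in> nbhd h P" "g b \<in> nbhd h P" using g t by (auto intro: nbhd_mono simp: h_def)
      fix r assume "r \<in> {t<..<b}"
      then show "g r \<notin> nbhd \<mu> P" using *[of r] t nbhd_mono[OF _ assms] by auto
    qed (use g t in \<open>auto intro: geodesic_sub\<close>)
    then show ?thesis using geodesic_dist[OF g(1), of t b] t g by auto
  qed
  then show ?thesis using that[of K] K0 by blast
qed

lemma gate_raise:
  assumes "\<mu> \<le> k" "k \<le> k'"
  obtains K where "0 \<le> K" "\<And>P x e. P \<in> \<P> \<Longrightarrow> gate k P x e \<Longrightarrow> \<exists>e'. gate k' P x e' \<and> dist e e' \<le> K"
proof -
  obtain K where K0: "0 \<le> K" and K: "\<And>P x e g a b t. \<lbrakk>P \<in> \<P>; access k P x e g a b; t \<in> {a..b};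
     g t \<in> nbhd k' P\<rbrakk> \<Longrightarrow> dist (g t) e \<le> K"
    by (rule access_bound[OF assms(1), of k']) blast
  have "\<exists>e'. gate k' P x e' \<and> dist e e' \<le> K" if P: "P \<in> \<P>" and "gate k P x e" for P x e
  proof -
    obtain g a b where acc: "access k P x e g a b" using \<open>gate k P x e\<close> by (auto simp: gate_def)
    have g: "geodesic_from_to x e g a b" and b: "b \<in> {a..b}" "g b \<in> nbhd k' P"
      using acc nbhd_mono[OF _ assms(2)] by (auto simp: access_def geodesic_from_to_def geodesic_def)
    from gate_first[OF g b] obtain t where t: "t \<in> {a..b}" "gate k' P x (g t)" by blast
    have "dist (g t) e \<le> K" by (rule K[OF P acc t(1) gate_nbhd[OF t(2)]])
    then show ?thesis using t by (auto simp: dist_commute)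
  qed
  then show ?thesis using that[of K] K0 by blast
qed

text \<open>A geodesic with ends near \<open>P\<close> meets \<open>N\<^sub>\<mu>(P)\<close> close to both ends; what lies well between the two
  meeting points is deep, and its first point in \<open>N\<^sub>\<mu>(P)\<close> is transient.\<close>

lemma transient_near_ends:
  obtains K where "0 \<le> K" "\<And>P x y g a b. \<lbrakk>P \<in> \<P>; x \<in> nbhd k P; y \<in> nbhd k P; K \<le> dist x y; geodesic_from_to x y g a b\<rbrakk>
    \<Longrightarrow> Trans g a b \<subseteq> cball x K \<union> cball y K \<and> (\<exists>z. z \<in> Trans g a b \<inter> nbhd \<mu> P)"
proof -
  obtain K where K0: "0 \<le> K" and K: "\<And>P g a b. \<lbrakk>P \<in> \<P>; geodesic g a b; g a \<in> nbhd k P; g b \<in> nbhd k P; K < b - a\<rbrakk>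
    \<Longrightarrow> \<exists>s u. s \<in> {a..a + K} \<and> s \<le> b \<and> g s \<in> nbhd \<mu> P \<and> u \<in> {b - K..b} \<and> a \<le> u \<and> g u \<in> nbhd \<mu> P"
    by (rule near_peripheral[of k]) blast
  define K' where "K' = 2 * K + R + 1"
  have "Trans g a b \<subseteq> cball x K' \<union> cball y K' \<and> (\<exists>z. z \<in> Trans g a b \<inter> nbhd \<mu> P)"
    if P: "P \<in> \<P>" and xy: "x \<in> nbhd k P" "y \<in> nbhd k P" "K' \<le> dist x y" and g: "geodesic_from_to x y g a b"
    for P x y g a b
  proof -
    have gg: "geodesic g a b" "g a = x" "g b = y" "b - a = dist x y"
      using g geodesic_from_to_length[OF g] by (auto simp: geodesic_from_to_def)
    obtain s u where s: "s \<in> {a..a + K}" "s \<le> b" "g s \<in> nbhd \<mu> P" and u: "u \<in> {b - K..b}" "a \<le> u" "g u \<in> nbhd \<mu> P"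
      using K[OF P gg(1)] gg xy R_pos K0 unfolding K'_def by auto
    have sab: "s \<in> {a..b}" using s by auto
    have "p \<in> cball x K' \<union> cball y K'" if p: "p \<in> Trans g a b" for p
    proof -
      obtain t where t: "t \<in> {a..b}" "p = g t" using p trans_points_image[of \<P> \<mu> R g a b] by auto
      \<comment> \<open>Otherwise \<open>s\<close> and \<open>u\<close> would witness that \<open>p\<close> is deep.\<close>
      have "\<not> (s < t - R \<and> t + R < u)"
        using p trans_points_iff[OF gg(1) t(1), of R \<P> \<mu>] R_pos s u t(2) P by auto
      then have "t - a \<le> K' \<or> b - t \<le> K'" using s u K0 by (auto simp: K'_def)
      then show ?thesis
        using geodesic_dist[OF gg(1), of a t] geodesic_dist[OF gg(1), of b t] t gg by auto
    qed
    moreover obtain e where e: "e \<in> {a..s}" "g e \<in> nbhd \<mu> P" "\<And>r. r \<in> {a..<e} \<Longrightarrow> g r \<notin> nbhd \<mu> P"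
      using first_hit[OF geodesic_continuous[OF gg(1)] closed_nbhd sab s(3)] by blast
    have "g e \<in> Trans g a b"
      by (rule first_point_transient[OF P gg(1) _ e(2,3), of u])
        (use e s u gg xy K0 R_pos in \<open>auto simp: K'_def\<close>)
    ultimately show ?thesis using e(2) by blast
  qed
  then show ?thesis using that[of K'] K0 R_pos by (auto simp: K'_def)
qed

end

section \<open>Uniqueness of gates and thin triangles\<close>

text \<open>Weak thinness puts transient points only near arbitrary points of the other two sides. It is
  the form in which tree-gradedness yields thinness; together with uniqueness of gates it implies
  that geodesics pass close to gates, and this in turn improves it to thinness proper.\<close>

definition weakly_thin :: "'a::metric_space set set \<Rightarrow> real \<Rightarrow> real \<Rightarrow> bool" where
  "weakly_thin \<P> \<mu> R \<longleftrightarrow> (\<exists>D. \<forall>x y z g a b h c d f m n.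
     geodesic_from_to x y g a b \<and> geodesic_from_to y z h c d \<and> geodesic_from_to x z f m n \<longrightarrow>
     (\<forall>p\<in>trans_points \<P> \<mu> R g a b. \<exists>q\<in>h ` {c..d} \<union> f ` {m..n}. dist p q \<le> D))"

definition thin :: "'a::metric_space set set \<Rightarrow> real \<Rightarrow> real \<Rightarrow> bool" where
  "thin \<P> \<mu> R \<longleftrightarrow> (\<exists>D. \<forall>x y z g a b h c d f m n.
     geodesic_from_to x y g a b \<and> geodesic_from_to y z h c d \<and> geodesic_from_to x z f m n \<longrightarrow>
     (\<forall>p\<in>trans_points \<P> \<mu> R g a b. \<exists>q\<in>trans_points \<P> \<mu> R h c d \<union> trans_points \<P> \<mu> R f m n. dist p q \<le> D))"

definition coarse_gates :: "'a::metric_space set set \<Rightarrow> real \<Rightarrow> bool" where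
  "coarse_gates \<P> \<mu> \<longleftrightarrow> (\<forall>k\<ge>\<mu>. \<exists>\<delta>. \<forall>P\<in>\<P>. \<forall>x e e'. gate k P x e \<and> gate k P x e' \<longrightarrow> dist e e' \<le> \<delta>)"

locale gated = peripheral +
  assumes weakly_thin: "weakly_thin \<P> \<mu> R"
    and coarse_gates: "coarse_gates \<P> \<mu>"
begin

lemma gate_unique:
  assumes "\<mu> \<le> k" "\<mu> \<le> k'"
  obtains \<delta> where "0 \<le> \<delta>" "\<And>P x e e'. \<lbrakk>P \<in> \<P>; gate k P x e; gate k' P x e'\<rbrakk> \<Longrightarrow> dist e e' \<le> \<delta>"
proof -
  define h where "h = max k k'"
  have h: "k \<le> h" "k' \<le> h" "\<mu> \<le> h" using assms by (auto simp: h_def)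
  obtain \<delta> where \<delta>: "\<forall>P\<in>\<P>. \<forall>x e e'. gate h P x e \<and> gate h P x e' \<longrightarrow> dist e e' \<le> \<delta>"
    using coarse_gates[unfolded coarse_gates_def, rule_format, OF h(3)] ..
  obtain K1 where K1: "0 \<le> K1" "\<And>P x e. P \<in> \<P> \<Longrightarrow> gate k P x e \<Longrightarrow> \<exists>e'. gate h P x e' \<and> dist e e' \<le> K1"
    by (rule gate_raise[OF assms(1) h(1)]) blast
  obtain K2 where K2: "0 \<le> K2" "\<And>P x e. P \<in> \<P> \<Longrightarrow> gate k' P x e \<Longrightarrow> \<exists>e'. gate h P x e' \<and> dist e e' \<le> K2"
    by (rule gate_raise[OF assms(2) h(2)]) blast
  show ?thesis
  proof (rule that[of "max 0 \<delta> + K1 + K2"])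
    fix P x e e' assume P: "P \<in> \<P>" and e: "gate k P x e" "gate k' P x e'"
    obtain f where f: "gate h P x f" "dist e f \<le> K1" using K1(2)[OF P e(1)] by blast
    obtain f' where f': "gate h P x f'" "dist e' f' \<le> K2" using K2(2)[OF P e(2)] by blast
    have "dist f f' \<le> \<delta>" using \<delta> P f f' by blast
    then show "dist e e' \<le> max 0 \<delta> + K1 + K2"
      using f f' dist_triangle[of e e' f] dist_triangle[of f e' f'] by (simp add: dist_commute)
  qed (use K1 K2 in auto)
qed

text \<open>Let \<open>m\<close> be the midpoint of a geodesic between the two gates \<open>e\<close> and \<open>f\<close>. The geodesic from \<open>x\<close>
  to \<open>m\<close> enters the neighbourhood of \<open>P\<close> near \<open>e\<close>, where it has a transient point. This point
  cannot be near the geodesic from \<open>y\<close> to \<open>m\<close>: that one enters near \<open>f\<close> and from there on covers only about half of the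
  distance between the gates, so it stays far from \<open>e\<close>. So it is near the geodesic from \<open>x\<close> to \<open>y\<close>.\<close>

lemma geodesic_passes_gate:
  assumes k: "\<mu> \<le> k"
  obtains L K where "0 \<le> L" "0 \<le> K"
    "\<And>P x y e f g a b. \<lbrakk>P \<in> \<P>; gate k P x e; gate k P y f; L < dist e f; geodesic_from_to x y g a b\<rbrakk>
       \<Longrightarrow> \<exists>t\<in>{a..b}. dist (g t) e \<le> K"
proof -
  obtain \<kappa> where \<kappa>: "k \<le> \<kappa>" "\<mu> \<le> \<kappa>" and
    hull: "\<And>P g a b t. \<lbrakk>P \<in> \<P>; geodesic g a b; g a \<in> nbhd k P; g b \<in> nbhd k P; t \<in> {a..b}\<rbrakk> \<Longrightarrow> g t \<in> nbhd \<kappa> P"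
    by (rule hull[of k]) blast
  obtain \<delta> where d0: "0 \<le> \<delta>" and \<delta>: "\<And>P x e e'. \<lbrakk>P \<in> \<P>; gate k P x e; gate \<kappa> P x e'\<rbrakk> \<Longrightarrow> dist e e' \<le> \<delta>"
    by (rule gate_unique[OF k \<kappa>(2)]) blast
  obtain E where E0: "0 \<le> E" and E: "\<And>P g a b e u. \<lbrakk>P \<in> \<P>; geodesic g a b; a \<le> e; e \<le> u; u \<le> b; g e \<in> nbhd \<kappa> P;
     \<And>r. r \<in> {a..<e} \<Longrightarrow> g r \<notin> nbhd \<kappa> P; g u \<in> nbhd \<kappa> P; E < u - e\<rbrakk> \<Longrightarrow>
     \<exists>t\<in>{e..e + E}. t \<le> u \<and> g t \<in> Trans g a b \<and> g t \<in> nbhd \<mu> P"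
    by (rule entry_transient[OF \<kappa>(2)]) blast
  obtain D where D: "\<And>x y z g a b h c d f m n p. \<lbrakk>geodesic_from_to x y g a b; geodesic_from_to y z h c d;
      geodesic_from_to x z f m n; p \<in> Trans g a b\<rbrakk> \<Longrightarrow> \<exists>q\<in>h ` {c..d} \<union> f ` {m..n}. dist p q \<le> D"
    using weakly_thin unfolding weakly_thin_def by metis
  define c where "c = \<delta> + E + max D 0"
  obtain G where G0: "0 \<le> G" and G: "\<And>P x e g a b t. \<lbrakk>P \<in> \<P>; access \<kappa> P x e g a b; t \<in> {a..b};
     g t \<in> nbhd (k + c) P\<rbrakk> \<Longrightarrow> dist (g t) e \<le> G"
    by (rule access_bound[OF \<kappa>(2), of "k + c"]) blast
  define L where "L = 4 * \<delta> + 2 * c + G + 2 * E"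
  have "\<exists>t\<in>{a..b}. dist (g t) e \<le> c"
    if P: "P \<in> \<P>" and e: "gate k P x e" and f: "gate k P y f" and L: "L < dist e f"
      and g: "geodesic_from_to x y g a b" for P x y e f g a b
  proof -
    obtain j p q where j: "geodesic_from_to e f j p q" "q - p = dist e f"
      by (rule obtain_geodesic[OF geod]) blast
    define m where "m = j ((p + q) / 2)"
    have jj: "geodesic j p q" "j p = e" "j q = f" "p \<le> q" using j by (auto simp: geodesic_from_to_def geodesic_def)
    have m: "m \<in> nbhd \<kappa> P" unfolding m_def
      by (rule hull[OF P jj(1)]) (use jj gate_nbhd[OF e] gate_nbhd[OF f] in auto)
    have em: "dist e m = dist e f / 2" and fm: "dist f m = dist e f / 2"
      using geodesic_dist[OF jj(1), of p "(p+q)/2"] geodesic_dist[OF jj(1), of q "(p+q)/2"] jj j(2)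
      by (auto simp: m_def field_simps)
    obtain h l n where h: "geodesic_from_to x m h l n" by (rule obtain_geodesic[OF geod]) blast
    have hh: "geodesic h l n" "h n = m" "n \<in> {l..n}" "h n \<in> nbhd \<kappa> P"
      using h m by (auto simp: geodesic_from_to_def geodesic_def)
    obtain s where s: "s \<in> {l..n}" "gate \<kappa> P x (h s)" "\<And>r. r \<in> {l..<s} \<Longrightarrow> h r \<notin> nbhd \<kappa> P"
      using gate_first[OF h hh(3,4)] by blast
    have es: "dist e (h s) \<le> \<delta>" by (rule \<delta>[OF P e s(2)])
    have "n - s = dist (h s) m" using geodesic_dist[OF hh(1) s(1) hh(3)] s(1) hh by auto
    then have "E < n - s" using em es L dist_triangle[of e m "h s"] G0 E0 d0 by (simp add: L_def c_def)
    then obtain t where t: "t \<in> {s..s + E}" "t \<le> n" "h t \<in> Trans h l n"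
      using E[OF P hh(1), of s n] s hh gate_nbhd[OF s(2)] by auto
    have "dist (h s) (h t) \<le> E" using geodesic_dist[OF hh(1) s(1), of t] t s by auto
    then have et: "dist (h t) e \<le> \<delta> + E" using es dist_triangle[of "h t" e "h s"] by (simp add: dist_commute)
    obtain i u v where i: "geodesic_from_to y m i u v" by (rule obtain_geodesic[OF geod]) blast
    obtain w where w: "w \<in> i ` {u..v} \<union> g ` {a..b}" "dist (h t) w \<le> D"
      using D[OF h geodesic_from_to_rev[OF i] g t(3)] by (auto simp: rev_image)
    have we: "dist w e \<le> c" using w et dist_triangle[of w e "h t"] by (simp add: dist_commute c_def)
    have "w \<notin> i ` {u..v}"
    proof
      assume "w \<in> i ` {u..v}"
      then obtain r where r: "r \<in> {u..v}" "w = i r" by blast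
      have ii: "geodesic i u v" "i u = y" "i v = m" "v \<in> {u..v}" "i v \<in> nbhd \<kappa> P"
        using i m by (auto simp: geodesic_from_to_def geodesic_def)
      obtain s' where s': "s' \<in> {u..v}" "gate \<kappa> P y (i s')" "\<And>r. r \<in> {u..<s'} \<Longrightarrow> i r \<notin> nbhd \<kappa> P"
        using gate_first[OF i ii(4,5)] by blast
      have fs: "dist f (i s') \<le> \<delta>" by (rule \<delta>[OF P f s'(2)])
      have wP: "w \<in> nbhd (k + c) P" using nbhd_dist[OF gate_nbhd[OF e], of w c] we by (simp add: dist_commute)
      show False
      proof (cases "r \<le> s'")
        case True
        have "access \<kappa> P y (i s') i u s'" unfolding access_def geodesic_from_to_def
          using s' gate_nbhd[OF s'(2)] ii by (auto intro: geodesic_sub)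
        then have "dist w (i s') \<le> G" using G[OF P, of y "i s'" i u s' r] r True wP by auto
        then have "dist e f \<le> c + G + \<delta>"
          using we fs dist_triangle[of e f w] dist_triangle[of w f "i s'"] by (simp add: dist_commute)
        then show False using L d0 E0 G0 by (simp add: L_def c_def)
      next
        case False
        have "dist (i s') w \<le> dist (i s') m"
          using geodesic_dist[OF ii(1) s'(1) r(1)] geodesic_dist[OF ii(1) s'(1) ii(4)] False r ii by auto
        also have "\<dots> \<le> \<delta> + dist e f / 2" using fm fs dist_triangle[of "i s'" m f] by (simp add: dist_commute)
        finally have "dist e f \<le> 2 * (c + 2 * \<delta>)"
          using we fs dist_triangle[of e f w] dist_triangle[of w f "i s'"] by (simp add: dist_commute)
        then show False using L d0 E0 G0 by (simp add: L_def)
      qed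
    qed
    then show ?thesis using w we by auto
  qed
  then show ?thesis using that[of L c] d0 E0 G0 by (auto simp: L_def c_def)
qed

text \<open>Suppose the point of \<open>\<beta>\<close> near the given transient point \<open>p\<close> is deep for a piece \<open>Q\<close>. The extreme points of
  \<open>\<beta>\<close> in \<open>N\<^sub>\<mu>(Q)\<close> are transient, and they are gates of \<open>B\<close> and \<open>C\<close>. The stay of \<open>\<alpha>\<close> near
  \<open>Q\<close> runs from a gate of \<open>A\<close> to a gate of \<open>B\<close>, and \<open>p\<close>, being transient, is close to one of them. If
  it is close to the gate of \<open>B\<close>, or to that of \<open>A\<close> when the latter is near the gate of \<open>C\<close>, then \<open>\<beta>\<close> has a transient point
  nearby. Otherwise the gates of \<open>A\<close> and \<open>C\<close> are far apart, so \<open>\<gamma>\<close> makes a long stay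
  near \<open>Q\<close>, whose beginning is transient and close to the gate of \<open>A\<close>.\<close>

lemma transient_upgrade:
  obtains D' where "\<And>A B C \<alpha> a b \<beta> c d \<gamma> m n t r. \<lbrakk>geodesic_from_to A B \<alpha> a b; geodesic_from_to B C \<beta> c d;
      geodesic_from_to A C \<gamma> m n; t \<in> {a..b}; \<alpha> t \<in> Trans \<alpha> a b; r \<in> {c..d}; dist (\<alpha> t) (\<beta> r) \<le> D\<rbrakk>
      \<Longrightarrow> \<exists>z\<in>Trans \<beta> c d \<union> Trans \<gamma> m n. dist (\<alpha> t) z \<le> D'"
proof -
  define k where "k = max (\<mu>' + D) \<mu>"
  have k: "\<mu> \<le> k" by (simp add: k_def)
  obtain K1 where K10: "0 \<le> K1" and K1: "\<And>P g a b. \<lbrakk>P \<in> \<P>; geodesic g a b; g a \<in> nbhd k P; g b \<in> nbhd k P; K1 < b - a\<rbrakk>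
    \<Longrightarrow> \<exists>s u. s \<in> {a..a + K1} \<and> s \<le> b \<and> g s \<in> nbhd \<mu> P \<and> u \<in> {b - K1..b} \<and> a \<le> u \<and> g u \<in> nbhd \<mu> P"
    by (rule near_peripheral[of k]) blast
  define K2 where "K2 = K1 + R"
  obtain \<delta> where \<delta>: "0 \<le> \<delta>" "\<And>P x e e'. \<lbrakk>P \<in> \<P>; gate k P x e; gate \<mu> P x e'\<rbrakk> \<Longrightarrow> dist e e' \<le> \<delta>"
    by (rule gate_unique[OF k order_refl]) blast
  obtain \<delta>r where \<delta>r: "0 \<le> \<delta>r" "\<And>P x e. P \<in> \<P> \<Longrightarrow> gate \<mu> P x e \<Longrightarrow> \<exists>e'. gate k P x e' \<and> dist e e' \<le> \<delta>r"
    by (rule gate_raise[OF order_refl k]) blast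
  obtain L K3 where L0: "0 \<le> L" "0 \<le> K3" and
    pass: "\<And>P x y e f g a b. \<lbrakk>P \<in> \<P>; gate k P x e; gate k P y f; L < dist e f; geodesic_from_to x y g a b\<rbrakk>
       \<Longrightarrow> \<exists>t\<in>{a..b}. dist (g t) e \<le> K3"
    by (rule geodesic_passes_gate[OF k]) blast
  define k3 where "k3 = k + K3"
  have k3: "\<mu> \<le> k3" "k \<le> k3" using k L0 by (auto simp: k3_def)
  obtain \<delta>2 where \<delta>2: "0 \<le> \<delta>2" "\<And>P x e e'. \<lbrakk>P \<in> \<P>; gate k P x e; gate k3 P x e'\<rbrakk> \<Longrightarrow> dist e e' \<le> \<delta>2"
    by (rule gate_unique[OF k k3(1)]) blast
  obtain E where E0: "0 \<le> E" and E: "\<And>P g a b e u. \<lbrakk>P \<in> \<P>; geodesic g a b; a \<le> e; e \<le> u; u \<le> b; g e \<in> nbhd k3 P;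
     \<And>r. r \<in> {a..<e} \<Longrightarrow> g r \<notin> nbhd k3 P; g u \<in> nbhd k3 P; E < u - e\<rbrakk> \<Longrightarrow>
     \<exists>t\<in>{e..e + E}. t \<le> u \<and> g t \<in> Trans g a b \<and> g t \<in> nbhd \<mu> P"
    by (rule entry_transient[OF k3(1)]) blast
  define L' where "L' = L + \<delta>2 + K3 + E"
  define D' where "D' = max D 0 + K2 + \<delta> + \<delta>r + \<delta>2 + L' + E"
  have pos: "0 \<le> K2" "0 \<le> L'" using K10 R_pos L0 \<delta>2 E0 by (auto simp: K2_def L'_def)
  have "\<exists>z\<in>Trans \<beta> c d \<union> Trans \<gamma> m n. dist (\<alpha> t) z \<le> D'"
    if \<alpha>: "geodesic_from_to A B \<alpha> a b" and \<beta>: "geodesic_from_to B C \<beta> c d"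
      and \<gamma>: "geodesic_from_to A C \<gamma> m n" and t: "t \<in> {a..b}" "\<alpha> t \<in> Trans \<alpha> a b"
      and r: "r \<in> {c..d}" "dist (\<alpha> t) (\<beta> r) \<le> D" for A B C \<alpha> a b \<beta> c d \<gamma> m n t r
  proof (cases "\<beta> r \<in> Trans \<beta> c d")
    case True
    then show ?thesis using r(2) \<delta> \<delta>r \<delta>2 E0 pos by (intro bexI[of _ "\<beta> r"]) (auto simp: D'_def)
  next
    case False
    have ga: "geodesic \<alpha> a b" and gb: "geodesic \<beta> c d" and gc: "geodesic \<gamma> m n"
      using \<alpha> \<beta> \<gamma> by (auto simp: geodesic_from_to_def)
    obtain s0 u0 Q where su0: "c \<le> s0" "s0 < r - R" "r + R < u0" "u0 \<le> d" and Q: "Q \<in> \<P>"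
        and Qsu: "\<beta> s0 \<in> nbhd \<mu> Q" "\<beta> u0 \<in> nbhd \<mu> Q"
      using False trans_points_iff[OF gb r(1), of R \<P> \<mu>] R_pos by auto
    have mem: "s0 \<in> {c..d}" "u0 \<in> {c..d}" using su0 R_pos r by auto
    obtain s where s: "s \<in> {c..s0}" "gate \<mu> Q B (\<beta> s)" "\<And>r. r \<in> {c..<s} \<Longrightarrow> \<beta> r \<notin> nbhd \<mu> Q"
      using gate_first[OF \<beta> mem(1) Qsu(1)] by blast
    obtain u where u: "u \<in> {u0..d}" "gate \<mu> Q C (\<beta> u)" "\<And>r. r \<in> {u<..d} \<Longrightarrow> \<beta> r \<notin> nbhd \<mu> Q"
      using gate_last[OF \<beta> mem(2) Qsu(2)] by blast
    have sT: "\<beta> s \<in> Trans \<beta> c d"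
      by (rule first_point_transient[OF Q gb _ gate_nbhd[OF s(2)] s(3), of u])
        (use s u gate_nbhd[OF u(2)] su0 R_pos r in auto)
    \<comment> \<open>The last point in \<open>N\<^sub>\<mu>(Q)\<close> is the first one of the reversed geodesic.\<close>
    have uT: "\<beta> u \<in> Trans \<beta> c d"
    proof -
      have "(\<lambda>t. \<beta> (-t)) (-u) \<in> Trans (\<lambda>t. \<beta> (-t)) (-d) (-c)"
      proof (rule first_point_transient[OF Q geodesic_rev[OF gb], of _ "-s"])
        fix r assume "r \<in> {-d..<-u}" then show "\<beta> (-r) \<notin> nbhd \<mu> Q" using u(3)[of "-r"] by auto
      qed (use s u gate_nbhd[OF u(2)] gate_nbhd[OF s(2)] su0 R_pos r in auto)
      then show ?thesis by (simp add: trans_points_rev)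
    qed
    have "\<beta> r \<in> nbhd \<mu>' Q"
      by (rule hull_mu[OF Q geodesic_sub[OF gb, of s u]])
        (use s u su0 R_pos r gate_nbhd[OF u(2)] gate_nbhd[OF s(2)] in auto)
    then have "\<alpha> t \<in> nbhd (\<mu>' + D) Q" using r(2) by (intro nbhd_dist[of "\<beta> r"]) (auto simp: dist_commute)
    then have tk: "\<alpha> t \<in> nbhd k Q" by (rule nbhd_mono) (simp add: k_def)
    obtain e where e: "e \<in> {a..t}" "gate k Q A (\<alpha> e)" using gate_first[OF \<alpha> t(1) tk] by blast
    obtain f where f: "f \<in> {t..b}" "gate k Q B (\<alpha> f)" using gate_last[OF \<alpha> t(1) tk] by blast
    \<comment> \<open>Well inside a long stay near \<open>Q\<close> the point would be deep.\<close>
    have "t - e \<le> K2 \<or> f - t \<le> K2"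
    proof (cases "K1 < f - e")
      case True
      have "geodesic \<alpha> e f" using e f t by (auto intro: geodesic_sub[OF ga])
      then obtain s' u' where s': "s' \<in> {e..e + K1}" "\<alpha> s' \<in> nbhd \<mu> Q" and u': "u' \<in> {f - K1..f}" "\<alpha> u' \<in> nbhd \<mu> Q"
        using K1[OF Q, of \<alpha> e f] True gate_nbhd[OF e(2)] gate_nbhd[OF f(2)] by auto
      have "\<not> (a \<le> s' \<and> s' < t - R \<and> t + R < u' \<and> u' \<le> b \<and> (\<exists>P\<in>\<P>. \<alpha> s' \<in> nbhd \<mu> P \<and> \<alpha> u' \<in> nbhd \<mu> P))"
        using t(2) trans_points_iff[OF ga t(1), of R \<P> \<mu>] R_pos by auto
      then have "\<not> (s' < t - R \<and> t + R < u')" using Q s' u' e f by auto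
      then show ?thesis using s' u' by (auto simp: K2_def)
    qed (use e f R_pos in \<open>auto simp: K2_def\<close>)
    then consider "f - t \<le> K2" | "t - e \<le> K2" by blast
    then show ?thesis
    proof cases
      case 1
      have "dist (\<alpha> t) (\<alpha> f) \<le> K2" using geodesic_dist[OF ga t(1), of f] f t 1 by auto
      moreover have "dist (\<alpha> f) (\<beta> s) \<le> \<delta>" by (rule \<delta>(2)[OF Q f(2) s(2)])
      ultimately have "dist (\<alpha> t) (\<beta> s) \<le> D'"
        using dist_triangle[of "\<alpha> t" "\<beta> s" "\<alpha> f"] \<delta>r \<delta>2 pos E0 by (simp add: D'_def)
      then show ?thesis using sT by blast
    next
      case 2
      have te: "dist (\<alpha> t) (\<alpha> e) \<le> K2" using geodesic_dist[OF ga t(1), of e] e t 2 by auto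
      obtain v where v: "gate k Q C v" "dist (\<beta> u) v \<le> \<delta>r" using \<delta>r(2)[OF Q u(2)] by blast
      show ?thesis
      proof (cases "L' < dist v (\<alpha> e)")
        case False
        have "dist (\<alpha> t) (\<beta> u) \<le> D'"
          using te v False dist_triangle[of "\<alpha> t" "\<beta> u" "\<alpha> e"] dist_triangle[of "\<alpha> e" "\<beta> u" v] \<delta> \<delta>2 pos E0
          by (simp add: D'_def dist_commute)
        then show ?thesis using uT by blast
      next
        case True
        then have "L < dist v (\<alpha> e)" using \<delta>2 L0 E0 by (simp add: L'_def)
        then obtain q where q: "q \<in> {-n..-m}" "dist (\<gamma> (-q)) v \<le> K3"
          using pass[OF Q v(1) e(2) _ geodesic_from_to_rev[OF \<gamma>]] by auto
        have qm: "-q \<in> {m..n}" and qQ: "\<gamma> (-q) \<in> nbhd k3 Q"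
          using q nbhd_dist[OF gate_nbhd[OF v(1)], of "\<gamma> (-q)" K3] by (auto simp: k3_def dist_commute)
        obtain e2 where e2: "e2 \<in> {m..-q}" "gate k3 Q A (\<gamma> e2)" "\<And>r. r \<in> {m..<e2} \<Longrightarrow> \<gamma> r \<notin> nbhd k3 Q"
          using gate_first[OF \<gamma> qm qQ] by blast
        have ee: "dist (\<alpha> e) (\<gamma> e2) \<le> \<delta>2" by (rule \<delta>2(2)[OF Q e(2) e2(2)])
        have "-q - e2 = dist (\<gamma> (-q)) (\<gamma> e2)" using geodesic_dist[OF gc qm, of e2] e2 qm by auto
        then have "E < -q - e2"
          using True ee q(2) dist_triangle[of v "\<alpha> e" "\<gamma> (-q)"] dist_triangle[of "\<gamma> (-q)" "\<alpha> e" "\<gamma> e2"] L0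
          by (simp add: L'_def dist_commute)
        then obtain t' where t': "t' \<in> {e2..e2 + E}" "t' \<le> -q" "\<gamma> t' \<in> Trans \<gamma> m n"
          using E[OF Q gc, of e2 "-q"] e2 qm qQ gate_nbhd[OF e2(2)] by auto
        have "dist (\<gamma> e2) (\<gamma> t') \<le> E" using geodesic_dist[OF gc, of e2 t'] e2 t' qm by auto
        then have "dist (\<alpha> t) (\<gamma> t') \<le> D'"
          using te ee dist_triangle[of "\<alpha> t" "\<gamma> t'" "\<alpha> e"] dist_triangle[of "\<alpha> e" "\<gamma> t'" "\<gamma> e2"] \<delta> \<delta>r pos
          by (simp add: D'_def)
        then show ?thesis using t' by blast
      qed
    qed
  qed
  then show ?thesis using that[of D'] by blast
qed

text \<open>A nearby point on the third side is treated by reversing the first side, which exchanges the roles of the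
  other two.\<close>

lemma thin_triangles: "thin \<P> \<mu> R"
proof -
  obtain D where D: "\<And>x y z g a b h c d f m n p. \<lbrakk>geodesic_from_to x y g a b; geodesic_from_to y z h c d;
      geodesic_from_to x z f m n; p \<in> Trans g a b\<rbrakk> \<Longrightarrow> \<exists>q\<in>h ` {c..d} \<union> f ` {m..n}. dist p q \<le> D"
    using weakly_thin unfolding weakly_thin_def by metis
  obtain D' where D': "\<And>A B C \<alpha> a b \<beta> c d \<gamma> m n t r. \<lbrakk>geodesic_from_to A B \<alpha> a b; geodesic_from_to B C \<beta> c d;
      geodesic_from_to A C \<gamma> m n; t \<in> {a..b}; \<alpha> t \<in> Trans \<alpha> a b; r \<in> {c..d}; dist (\<alpha> t) (\<beta> r) \<le> D\<rbrakk>
      \<Longrightarrow> \<exists>z\<in>Trans \<beta> c d \<union> Trans \<gamma> m n. dist (\<alpha> t) z \<le> D'"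
    by (rule transient_upgrade[of D]) blast
  have "\<exists>q\<in>Trans h c d \<union> Trans f m n. dist p q \<le> D'"
    if g: "geodesic_from_to x y g a b" and h: "geodesic_from_to y z h c d" and f: "geodesic_from_to x z f m n"
      and p: "p \<in> Trans g a b" for x y z g a b h c d f m n p
  proof -
    obtain t where t: "t \<in> {a..b}" "p = g t" using p trans_points_image[of \<P> \<mu> R g a b] by auto
    obtain q where "q \<in> h ` {c..d} \<union> f ` {m..n}" "dist p q \<le> D" using D[OF g h f p] by blast
    then consider r where "r \<in> {c..d}" "dist p (h r) \<le> D" | r where "r \<in> {m..n}" "dist p (f r) \<le> D" by auto
    then show ?thesis
    proof cases
      case 1 then show ?thesis using D'[OF g h f t(1)] p t by auto
    next
      case 2
      have "\<exists>z\<in>Trans f m n \<union> Trans h c d. dist (g (- (-t))) z \<le> D'"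
        by (rule D'[OF geodesic_from_to_rev[OF g] f h, of "-t"]) (use 2 p t in \<open>auto simp: trans_points_rev\<close>)
      then show ?thesis using t by auto
    qed
  qed
  then show ?thesis unfolding thin_def by blast
qed

end

section \<open>Gates in spaces with thin transient triangles\<close>

context peripheral
begin

text \<open>The parameters of transient points form a compact set, covered by the closed conditions \<open>A\<close> and
  \<open>B\<close>. Unless some transient point satisfies both, there are a last point of kind \<open>A\<close> and a first point
  of kind \<open>B\<close> with only deep points in between. The deep parameters attached to a single piece form an open
  set, these sets are disjoint for distinct pieces, and so by connectedness the gap belongs to one piece.\<close>

lemma transient_gap:
  assumes g: "geodesic g a b" and AB: "closed A" "closed B" "Trans g a b \<subseteq> A \<union> B" "g a \<in> A" "g b \<in> B"
  obtains t1 t2 where "t1 \<in> {a..b}" "t2 \<in> {a..b}" "t1 \<le> t2" "g t1 \<in> Trans g a b \<inter> A" "g t2 \<in> Trans g a b \<inter> B"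
    "t1 = t2 \<or> (\<exists>Q\<in>\<P>. \<forall>t\<in>{t1..t2}. g t \<in> nbhd \<mu>' Q)"
proof -
  define deep where "deep Q = (\<Union>s\<in>{s\<in>{a..b}. g s \<in> nbhd \<mu> Q}. \<Union>u\<in>{u\<in>{a..b}. g u \<in> nbhd \<mu> Q}. {s + R<..<u - R})" for Q
  have open_deep: "open (deep Q)" for Q unfolding deep_def by (intro open_UN ballI) simp
  define T where "T = {t\<in>{a..b}. g t \<in> Trans g a b}"
  have ab: "a \<le> b" using g by (simp add: geodesic_def)
  have deep_hull: "g r \<in> nbhd \<mu>' Q" if t: "t \<in> deep Q" and "Q \<in> \<P>" "r \<in> {t - R..t + R}" for t Q r
  proof -
    obtain s u where su: "s \<in> {a..b}" "u \<in> {a..b}" "g s \<in> nbhd \<mu> Q" "g u \<in> nbhd \<mu> Q" "s + R < t" "t < u - R"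
      using t unfolding deep_def by auto
    show ?thesis by (rule hull_mu[OF that(2) geodesic_sub[OF g, of s u] su(3,4)]) (use su that R_pos in auto)
  qed
  have deep_sub: "t - R \<in> {a..b}" "t + R \<in> {a..b}" if "t \<in> deep Q" for t Q
    using that R_pos unfolding deep_def by auto
  have deep_disj: "Q = Q'" if "t \<in> deep Q" "t \<in> deep Q'" "Q \<in> \<P>" "Q' \<in> \<P>" for t Q Q'
  proof (rule ccontr)
    assume "Q \<noteq> Q'"
    then have "dist (g (t - R)) (g (t + R)) < R"
      using separated[OF that(3,4)] deep_hull[OF that(1,3)] deep_hull[OF that(2,4)] R_pos by auto
    then show False using geodesic_dist[OF g deep_sub[OF that(1)]] R_pos by auto
  qed
  \<comment> \<open>In terms of parameters, the transient points form the complement of an open set.\<close>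
  have T_eq: "T = {a..b} - (\<Union>Q\<in>\<P>. deep Q)"
  proof (rule set_eqI)
    fix t
    have "(\<exists>Q\<in>\<P>. t \<in> deep Q) \<longleftrightarrow> (\<exists>s u. a \<le> s \<and> s < t - R \<and> t + R < u \<and> u \<le> b \<and>
        (\<exists>P\<in>\<P>. g s \<in> nbhd \<mu> P \<and> g u \<in> nbhd \<mu> P))" if "t \<in> {a..b}"
    proof
      assume "\<exists>Q\<in>\<P>. t \<in> deep Q"
      then obtain Q s u where "Q \<in> \<P>" "s \<in> {a..b}" "u \<in> {a..b}" "g s \<in> nbhd \<mu> Q" "g u \<in> nbhd \<mu> Q" "s + R < t" "t < u - R"
        unfolding deep_def by auto
      then show "\<exists>s u. a \<le> s \<and> s < t - R \<and> t + R < u \<and> u \<le> b \<and> (\<exists>P\<in>\<P>. g s \<in> nbhd \<mu> P \<and> g u \<in> nbhd \<mu> P)"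
        by (intro exI[of _ s] exI[of _ u] conjI bexI[of _ Q]) auto
    next
      assume "\<exists>s u. a \<le> s \<and> s < t - R \<and> t + R < u \<and> u \<le> b \<and> (\<exists>P\<in>\<P>. g s \<in> nbhd \<mu> P \<and> g u \<in> nbhd \<mu> P)"
      then obtain Q s u where *: "Q \<in> \<P>" "a \<le> s" "u \<le> b" "g s \<in> nbhd \<mu> Q" "g u \<in> nbhd \<mu> Q" "s < t - R" "t + R < u"
        by auto
      then have "s \<in> {a..b}" "u \<in> {a..b}" "t \<in> {s + R<..<u - R}" using that R_pos by auto
      then show "\<exists>Q\<in>\<P>. t \<in> deep Q" using * unfolding deep_def by blast
    qed
    then show "t \<in> T \<longleftrightarrow> t \<in> {a..b} - (\<Union>Q\<in>\<P>. deep Q)"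
      unfolding T_def using trans_points_iff[OF g, of t R \<P> \<mu>] R_pos by auto
  qed
  have "closed T" unfolding T_eq using open_deep by (intro closed_Diff) auto
  have cp: "compact (T \<inter> ({a..b} \<inter> g -` S))" if "closed S" for S
  proof -
    have "closed ({a..b} \<inter> g -` S)"
      by (rule continuous_closed_preimage[OF geodesic_continuous[OF g] _ that]) auto
    then have "closed (T \<inter> ({a..b} \<inter> g -` S))" using \<open>closed T\<close> by (rule closed_Int[rotated])
    then have "compact ({a..b} \<inter> (T \<inter> ({a..b} \<inter> g -` S)))" by (intro compact_Int_closed) auto
    moreover have "{a..b} \<inter> (T \<inter> ({a..b} \<inter> g -` S)) = T \<inter> ({a..b} \<inter> g -` S)" by auto
    ultimately show ?thesis by simp
  qed
  define TA TB where "TA = T \<inter> ({a..b} \<inter> g -` A)" and "TB = T \<inter> ({a..b} \<inter> g -` B)"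
  have aT: "a \<in> TA" and bT: "b \<in> TB"
    using trans_points_ends[OF g, of R \<P> \<mu>] R_pos ab AB(4,5) by (auto simp: TA_def TB_def T_def)
  have TAB: "T = TA \<union> TB" using AB(3) by (auto simp: TA_def TB_def T_def)
  obtain t2 where t2: "t2 \<in> TB" "\<And>t. t \<in> TB \<Longrightarrow> t2 \<le> t"
    using compact_attains_inf[of TB] cp[OF AB(2)] bT unfolding TB_def by blast
  have "compact (TA \<inter> {..t2})" using compact_Int_closed[OF cp[OF AB(1)], of "{..t2}"] by (simp add: TA_def)
  moreover have "a \<in> TA \<inter> {..t2}" using aT t2(1) by (auto simp: TB_def)
  ultimately obtain t1 where t1: "t1 \<in> TA \<inter> {..t2}" "\<And>t. t \<in> TA \<inter> {..t2} \<Longrightarrow> t \<le> t1"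
    using compact_attains_sup by (metis empty_iff)
  have in_ab: "t1 \<in> {a..b}" "t2 \<in> {a..b}" using t1 t2 by (auto simp: TA_def TB_def)
  have "\<exists>Q\<in>\<P>. \<forall>t\<in>{t1..t2}. g t \<in> nbhd \<mu>' Q" if "t1 \<noteq> t2"
  proof -
    have lt: "t1 < t2" using that t1 by auto
    have cover: "{t1<..<t2} \<subseteq> (\<Union>Q\<in>\<P>. deep Q)"
    proof
      fix t assume t: "t \<in> {t1<..<t2}"
      then have "t \<notin> TA" "t \<notin> TB" using t1(2)[of t] t2(2)[of t] by auto
      then have "t \<notin> T" using TAB by auto
      then show "t \<in> (\<Union>Q\<in>\<P>. deep Q)" using t in_ab unfolding T_eq by auto
    qed
    have mid: "(t1 + t2) / 2 \<in> {t1<..<t2}" using lt by auto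
    then obtain Q where Q: "Q \<in> \<P>" "(t1 + t2) / 2 \<in> deep Q" using cover by blast
    have "deep Q \<inter> {t1<..<t2} = {} \<or> (\<Union>Q'\<in>\<P> - {Q}. deep Q') \<inter> {t1<..<t2} = {}"
    proof (rule connectedD)
      show "connected {t1<..<t2}" by simp
      show "deep Q \<inter> (\<Union>Q'\<in>\<P> - {Q}. deep Q') \<inter> {t1<..<t2} = {}" using deep_disj Q(1) by blast
      show "{t1<..<t2} \<subseteq> deep Q \<union> (\<Union>Q'\<in>\<P> - {Q}. deep Q')" using cover by blast
    qed (use open_deep in auto)
    then have "{t1<..<t2} \<subseteq> deep Q" using Q mid cover by blast
    then have sub: "{t1<..<t2} \<subseteq> {a..b} \<inter> g -` nbhd \<mu>' Q" using deep_hull[OF _ Q(1)] in_ab R_pos by fastforce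
    have "closed ({a..b} \<inter> g -` nbhd \<mu>' Q)"
      by (rule continuous_closed_preimage[OF geodesic_continuous[OF g] _ closed_nbhd]) auto
    then have "closure {t1<..<t2} \<subseteq> {a..b} \<inter> g -` nbhd \<mu>' Q" by (rule closure_minimal[OF sub])
    then have "{t1..t2} \<subseteq> {a..b} \<inter> g -` nbhd \<mu>' Q" using lt by simp
    then show ?thesis using Q(1) by blast
  qed
  then show ?thesis
    using that[of t1 t2] in_ab t1 t2 by (auto simp: TA_def TB_def T_def)
qed

end

locale thin_family = peripheral +
  assumes ends: "\<exists>K. \<forall>P\<in>\<P>. \<forall>g a b. geodesic g a b \<and> g a \<in> nbhd k P \<and> g b \<in> nbhd k P \<longrightarrow>
      (\<forall>p\<in>trans_points \<P> \<mu> R g a b. dist p (g a) \<le> K \<or> dist p (g b) \<le> K)"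
    and thin: "thin \<P> \<mu> R"
begin

lemma ends_bound:
  obtains K where "0 \<le> K" "\<And>P x y g a b p. \<lbrakk>P \<in> \<P>; geodesic_from_to x y g a b; x \<in> nbhd k P; y \<in> nbhd k P; p \<in> Trans g a b\<rbrakk>
    \<Longrightarrow> dist p x \<le> K \<or> dist p y \<le> K"
proof -
  obtain K where K: "\<forall>P\<in>\<P>. \<forall>g a b. geodesic g a b \<and> g a \<in> nbhd k P \<and> g b \<in> nbhd k P \<longrightarrow>
      (\<forall>p\<in>trans_points \<P> \<mu> R g a b. dist p (g a) \<le> K \<or> dist p (g b) \<le> K)"
    using ends[of k] ..
  show ?thesis
  proof (rule that[of "max K 0"])
    fix P x y g a b p
    assume "P \<in> \<P>" "geodesic_from_to x y g a b" "x \<in> nbhd k P" "y \<in> nbhd k P" "p \<in> Trans g a b"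
    then have "dist p x \<le> K \<or> dist p y \<le> K" using K unfolding geodesic_from_to_def by blast
    then show "dist p x \<le> max K 0 \<or> dist p y \<le> max K 0" by auto
  qed simp
qed

lemma thin_bound:
  obtains D where "0 \<le> D" "\<And>x y z g a b h c d f m n p. \<lbrakk>geodesic_from_to x y g a b; geodesic_from_to y z h c d;
      geodesic_from_to x z f m n; p \<in> Trans g a b\<rbrakk> \<Longrightarrow> \<exists>q\<in>Trans h c d \<union> Trans f m n. dist p q \<le> D"
proof -
  obtain D where D: "\<And>x y z g a b h c d f m n p. \<lbrakk>geodesic_from_to x y g a b; geodesic_from_to y z h c d;
      geodesic_from_to x z f m n; p \<in> Trans g a b\<rbrakk> \<Longrightarrow> \<exists>q\<in>Trans h c d \<union> Trans f m n. dist p q \<le> D"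
    using thin unfolding thin_def by metis
  show ?thesis
  proof (rule that[of "max D 0"])
    fix x y z g a b h c d f m n p
    assume "geodesic_from_to x y g a b" "geodesic_from_to y z h c d" "geodesic_from_to x z f m n" "p \<in> Trans g a b"
    from D[OF this] obtain q where "q\<in>Trans h c d \<union> Trans f m n" "dist p q \<le> D" by blast
    then show "\<exists>q\<in>Trans h c d \<union> Trans f m n. dist p q \<le> max D 0" by (intro bexI[of _ q]) auto
  qed simp
qed

text \<open>If a geodesic from \<open>x\<close> stays long near \<open>P\<close>, it has a transient point close to its entrance and far from its
  end. In the triangle with a gate \<open>e\<close> as third vertex, that point is near \<open>e\<close>: the side along
  \<open>P\<close> has transient points only at its ends, and points of the access path that are near \<open>P\<close>
  are near \<open>e\<close>.\<close>

lemma long_stay_gate: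
  assumes "\<mu> \<le> \<kappa>" "\<mu> \<le> k"
  obtains c c' where "0 \<le> c" "0 \<le> c'" "\<And>P x e m h p q s. \<lbrakk>P \<in> \<P>; gate \<kappa> P x e; e \<in> nbhd k P;
     geodesic_from_to x m h p q; m \<in> nbhd k P; s \<in> {p..q}; h s \<in> nbhd k P;
     \<And>r. r \<in> {p..<s} \<Longrightarrow> h r \<notin> nbhd k P; c < q - s\<rbrakk> \<Longrightarrow> dist (h s) e \<le> c'"
proof -
  obtain E where E0: "0 \<le> E" and E: "\<And>P g a b e u. \<lbrakk>P \<in> \<P>; geodesic g a b; a \<le> e; e \<le> u; u \<le> b; g e \<in> nbhd k P;
     \<And>r. r \<in> {a..<e} \<Longrightarrow> g r \<notin> nbhd k P; g u \<in> nbhd k P; E < u - e\<rbrakk> \<Longrightarrow>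
     \<exists>t\<in>{e..e + E}. t \<le> u \<and> g t \<in> Trans g a b \<and> g t \<in> nbhd \<mu> P"
    by (rule entry_transient[OF assms(2)]) blast
  obtain D where D0: "0 \<le> D" and D: "\<And>x y z g a b h c d f m n p. \<lbrakk>geodesic_from_to x y g a b; geodesic_from_to y z h c d;
      geodesic_from_to x z f m n; p \<in> Trans g a b\<rbrakk> \<Longrightarrow> \<exists>q\<in>Trans h c d \<union> Trans f m n. dist p q \<le> D"
    by (rule thin_bound) blast
  obtain K where K0: "0 \<le> K" and K: "\<And>P x y g a b p. \<lbrakk>P \<in> \<P>; geodesic_from_to x y g a b; x \<in> nbhd k P; y \<in> nbhd k P;
     p \<in> Trans g a b\<rbrakk> \<Longrightarrow> dist p x \<le> K \<or> dist p y \<le> K"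
    by (rule ends_bound[of k]) blast
  obtain G where G0: "0 \<le> G" and G: "\<And>P x e g a b t. \<lbrakk>P \<in> \<P>; access \<kappa> P x e g a b; t \<in> {a..b};
     g t \<in> nbhd (\<mu> + D) P\<rbrakk> \<Longrightarrow> dist (g t) e \<le> G"
    by (rule access_bound[OF assms(1), of "\<mu> + D"]) blast
  define c where "c = E + D + K"
  define c' where "c' = E + D + K + G"
  have "dist (h s) e \<le> c'"
    if P: "P \<in> \<P>" and e: "gate \<kappa> P x e" "e \<in> nbhd k P" and h: "geodesic_from_to x m h p q"
      and m: "m \<in> nbhd k P" and s: "s \<in> {p..q}" "h s \<in> nbhd k P" "\<And>r. r \<in> {p..<s} \<Longrightarrow> h r \<notin> nbhd k P"
      and c: "c < q - s" for P x e m h p q s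
  proof -
    have hh: "geodesic h p q" "h q = m" using h by (auto simp: geodesic_from_to_def)
    obtain t where t: "t \<in> {s..s + E}" "t \<le> q" "h t \<in> Trans h p q" "h t \<in> nbhd \<mu> P"
      using E[OF P hh(1), of s q] s hh m c D0 K0 by (auto simp: c_def)
    have st: "dist (h s) (h t) \<le> E" using geodesic_dist[OF hh(1) s(1), of t] t s by auto
    have tm: "dist (h t) m = q - t" using geodesic_dist[OF hh(1), of t q] t s hh by auto
    obtain f a b where f: "access \<kappa> P x e f a b" using e(1) by (auto simp: gate_def)
    obtain i u v where i: "geodesic_from_to m e i u v" by (rule obtain_geodesic[OF geod]) blast
    have "geodesic_from_to x e f a b" using f by (auto simp: access_def)
    from D[OF h i this t(3)] obtain w where w: "w \<in> Trans i u v \<union> Trans f a b" "dist (h t) w \<le> D" by blast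
    have "dist w e \<le> K + G"
    proof (cases "w \<in> Trans i u v")
      case True
      have "\<not> dist w m \<le> K" using tm c t w(2) dist_triangle[of "h t" m w] by (auto simp: c_def)
      then show ?thesis using K[OF P i m e(2) True] G0 by auto
    next
      case False
      then obtain r where r: "r \<in> {a..b}" "w = f r" using w trans_points_image[of \<P> \<mu> R f a b] by blast
      then show ?thesis using G[OF P f r(1)] nbhd_dist[OF t(4) w(2)] K0 by auto
    qed
    then show ?thesis using st w(2) dist_triangle[of "h s" e "h t"] dist_triangle[of "h t" e w] by (simp add: c'_def)
  qed
  then show ?thesis using that[of c c'] E0 D0 K0 G0 by (auto simp: c_def c'_def)
qed

text \<open>Let \<open>w\<close> and \<open>w'\<close> be remote gates of \<open>x\<close>. Transient points of the access path to \<open>w\<close> are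
  near the other access path or near \<open>w\<close> or \<open>w'\<close>. Points near the other access path lie far from \<open>w\<close>, since
  close to \<open>P\<close> the two paths are apart. So the passage from the former to the latter kind is a long
  gap, and the piece of this gap accompanies the path almost up to its end \<open>w\<close>. The constant \<open>k1\<close> does not depend on how
  long this part is required to be; \<open>three_gates\<close> relies on this.\<close>

lemma distant_gates_final_piece:
  assumes k: "\<mu> \<le> k"
  obtains k1 where "\<And>r0. \<exists>r. \<forall>P\<in>\<P>. \<forall>x w w' h a b h' a' b'. access k P x w h a b \<and> access k P x w' h' a' b' \<and> r < dist w w' \<longrightarrow>
      (\<exists>v\<in>Trans h a b. \<exists>Q\<in>\<P>. Q \<noteq> P \<and> v \<in> nbhd k1 Q \<and> w \<in> nbhd k1 Q \<and> r0 < dist v w)"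
proof -
  obtain D where D0: "0 \<le> D" and D: "\<And>x y z g a b h c d f m n p. \<lbrakk>geodesic_from_to x y g a b; geodesic_from_to y z h c d;
      geodesic_from_to x z f m n; p \<in> Trans g a b\<rbrakk> \<Longrightarrow> \<exists>q\<in>Trans h c d \<union> Trans f m n. dist p q \<le> D"
    by (rule thin_bound) blast
  obtain K where K0: "0 \<le> K" and K: "\<And>P x y g a b p. \<lbrakk>P \<in> \<P>; geodesic_from_to x y g a b; x \<in> nbhd k P; y \<in> nbhd k P;
     p \<in> Trans g a b\<rbrakk> \<Longrightarrow> dist p x \<le> K \<or> dist p y \<le> K"
    by (rule ends_bound[of k]) blast
  define K' where "K' = D + K"
  have K'0: "0 \<le> K'" using D0 K0 by (simp add: K'_def)
  obtain G where G0: "0 \<le> G" and G: "\<And>P x e g a b t. \<lbrakk>P \<in> \<P>; access k P x e g a b; t \<in> {a..b};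
     g t \<in> nbhd (k + K') P\<rbrakk> \<Longrightarrow> dist (g t) e \<le> G"
    by (rule access_bound[OF k, of "k + K'"]) blast
  obtain G2 where G20: "0 \<le> G2" and G2: "\<And>P x e g a b t. \<lbrakk>P \<in> \<P>; access k P x e g a b; t \<in> {a..b};
     g t \<in> nbhd \<mu>' P\<rbrakk> \<Longrightarrow> dist (g t) e \<le> G2"
    by (rule access_bound[OF k, of "\<mu>'"]) blast
  define k1 where "k1 = \<mu>' + K'"
  have "\<exists>r. \<forall>P\<in>\<P>. \<forall>x w w' h a b h' a' b'. access k P x w h a b \<and> access k P x w' h' a' b' \<and> r < dist w w' \<longrightarrow>
      (\<exists>v\<in>Trans h a b. \<exists>Q\<in>\<P>. Q \<noteq> P \<and> v \<in> nbhd k1 Q \<and> w \<in> nbhd k1 Q \<and> r0 < dist v w)" for r0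
  proof -
    define \<rho> where "\<rho> = max (max K' G2) r0"
    obtain G3 where G30: "0 \<le> G3" and G3: "\<And>P x e g a b t. \<lbrakk>P \<in> \<P>; access k P x e g a b; t \<in> {a..b};
       g t \<in> nbhd (k + (\<rho> + D + 1)) P\<rbrakk> \<Longrightarrow> dist (g t) e \<le> G3"
      by (rule access_bound[OF k, of "k + (\<rho> + D + 1)"]) blast
    define r where "r = \<rho> + D + 1 + G3 + K' + G"
    have "\<exists>v\<in>Trans h a b. \<exists>Q\<in>\<P>. Q \<noteq> P \<and> v \<in> nbhd k1 Q \<and> w \<in> nbhd k1 Q \<and> r0 < dist v w"
      if P: "P \<in> \<P>" and h: "access k P x w h a b" and h': "access k P x w' h' a' b'" and r: "r < dist w w'"
      for P x w w' h a b h' a' b'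
    proof -
      have hg: "geodesic_from_to x w h a b" "geodesic_from_to x w' h' a' b'" and wP: "w \<in> nbhd k P" "w' \<in> nbhd k P"
        using h h' by (auto simp: access_def)
      then have gg: "geodesic h a b" "h a = x" "h b = w" "a \<le> b" "geodesic h' a' b'" "h' a' = x" "h' b' = w'" "a' \<le> b'"
        by (auto simp: geodesic_from_to_def geodesic_def)
      obtain i u v where i: "geodesic_from_to w w' i u v" by (rule obtain_geodesic[OF geod]) blast
      define A where "A = nbhd D (h' ` {a'..b'})"
      define B where "B = cball w K' \<union> cball w' K'"
      have "Trans h a b \<subseteq> A \<union> B"
      proof
        fix p assume "p \<in> Trans h a b"
        from D[OF hg(1) i hg(2) this]
        obtain q where q: "q \<in> Trans i u v \<union> Trans h' a' b'" "dist p q \<le> D" by blast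
        show "p \<in> A \<union> B"
        proof (cases "q \<in> Trans i u v")
          case True
          then have "dist q w \<le> K \<or> dist q w' \<le> K" by (rule K[OF P i wP])
          then show ?thesis using q(2) dist_triangle[of p w q] dist_triangle[of p w' q]
            by (auto simp: B_def K'_def dist_commute)
        next
          case False
          then have "q \<in> h' ` {a'..b'}" using q trans_points_image[of \<P> \<mu> R h' a' b'] by blast
          then show ?thesis using nbhd_mem[OF _ q(2)] by (simp add: A_def)
        qed
      qed
      moreover have "h a \<in> A" unfolding A_def by (rule nbhd_mem[of x]) (use gg D0 in \<open>auto intro: rev_image_eqI[of a']\<close>)
      moreover have "h b \<in> B" using gg K'0 by (auto simp: B_def)
      moreover have "closed A" "closed B" using closed_nbhd by (auto simp: A_def B_def)
      ultimately obtain t1 t2 where t: "t1 \<in> {a..b}" "t2 \<in> {a..b}" "t1 \<le> t2" "h t1 \<in> Trans h a b \<inter> A" "h t2 \<in> Trans h a b \<inter> B"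
        and Qex: "t1 = t2 \<or> (\<exists>Q\<in>\<P>. \<forall>t\<in>{t1..t2}. h t \<in> nbhd \<mu>' Q)"
        using transient_gap[OF gg(1), of A B] by metis
      \<comment> \<open>Near the other gate, the access path would be near \<open>P\<close>, hence near its own gate as well.\<close>
      have t2w: "dist (h t2) w \<le> K'"
      proof (rule ccontr)
        assume "\<not> ?thesis"
        then have *: "dist w' (h t2) \<le> K'" using t(5) by (auto simp: B_def dist_commute)
        then have "dist (h t2) w \<le> G" by (intro G[OF P h t(2)] nbhd_dist[OF wP(2)])
        then have "dist w w' \<le> K' + G" using * dist_triangle[of w w' "h t2"] by (simp add: dist_commute)
        then show False using r G30 D0 K'0 by (simp add: r_def \<rho>_def)
      qed
      \<comment> \<open>If \<open>h t1\<close> were near \<open>w\<close>, its neighbour on the other access path would be near \<open>P\<close>, hence near \<open>w'\<close>.\<close>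
      have far: "\<rho> < dist (h t1) w"
      proof (rule ccontr)
        assume "\<not> ?thesis"
        then have *: "dist (h t1) w \<le> \<rho>" by simp
        obtain y where y: "y \<in> h' ` {a'..b'}" "dist (h t1) y \<le> D + 1"
          by (rule nbhd_obtain[of "h t1" D "h' ` {a'..b'}"]) (use t(4) in \<open>auto simp: A_def\<close>)
        then obtain t' where t': "t' \<in> {a'..b'}" "y = h' t'" by auto
        have wy: "dist w y \<le> \<rho> + D + 1" using * y dist_triangle[of w y "h t1"] by (simp add: dist_commute)
        have "dist y w' \<le> G3" unfolding t' by (rule G3[OF P h' t'(1) nbhd_dist[OF wP(1)]]) (use wy t' in auto)
        then show False using wy r dist_triangle[of w w' y] K'0 G0 by (simp add: r_def)
      qed
      then have "t1 \<noteq> t2" using t2w by (auto simp: \<rho>_def)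
      then obtain Q where Q: "Q \<in> \<P>" "\<And>t. t\<in>{t1..t2} \<Longrightarrow> h t \<in> nbhd \<mu>' Q" using Qex by blast
      have "Q \<noteq> P"
      proof
        assume "Q = P"
        then have "dist (h t1) w \<le> G2" by (intro G2[OF P h t(1)]) (use Q t in auto)
        then show False using far by (simp add: \<rho>_def)
      qed
      moreover have "h t1 \<in> nbhd k1 Q" using nbhd_mono[OF Q(2)] K'0 t by (auto simp: k1_def)
      moreover have "w \<in> nbhd k1 Q" unfolding k1_def
        by (rule nbhd_dist[OF Q(2)[of t2] t2w]) (use t in auto)
      moreover have "r0 < dist (h t1) w" using far by (simp add: \<rho>_def)
      ultimately show ?thesis using Q(1) t(4) by blast
    qed
    note piece = this
    show ?thesis by (intro exI[of _ r] ballI allI impI; elim conjE; rule piece)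
  qed
  then show ?thesis by (rule that)
qed

text \<open>Suppose the gates \<open>w1\<close> and \<open>w2\<close>, at distance at most \<open>l'\<close>, were both remote from \<open>w0\<close>, and consider the final pieces \<open>Q1\<close> and \<open>Q2\<close> of
  their access paths. The second path passes near the point \<open>v1\<close> where the first one joins \<open>Q1\<close>,
  and it ends at bounded distance from \<open>Q1\<close>, so its final part is near \<open>Q1\<close> as well as
  \<open>Q2\<close>. Hence \<open>Q1 = Q2\<close>, and this piece is near \<open>w1\<close> and \<open>w2\<close>, as is \<open>P\<close>; so these are within \<open>l\<close>.\<close>

lemma three_gates:
  assumes k: "\<mu> \<le> k"
  obtains l where "0 \<le> l" "\<And>l'. \<exists>r\<ge>0. \<forall>P\<in>\<P>. \<forall>x w0 w1 w2. gate k P x w0 \<and> gate k P x w1 \<and> gate k P x w2 \<and>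
     l < dist w1 w2 \<and> dist w1 w2 \<le> l' \<longrightarrow> dist w1 w0 \<le> r \<or> dist w2 w0 \<le> r"
proof -
  obtain k1 where k1: "\<And>r0. \<exists>r. \<forall>P\<in>\<P>. \<forall>x w w' h a b h' a' b'. access k P x w h a b \<and> access k P x w' h' a' b' \<and> r < dist w w' \<longrightarrow>
      (\<exists>v\<in>Trans h a b. \<exists>Q\<in>\<P>. Q \<noteq> P \<and> v \<in> nbhd k1 Q \<and> w \<in> nbhd k1 Q \<and> r0 < dist v w)"
    by (rule distant_gates_final_piece[OF k]) blast
  obtain l where l: "0 \<le> l" "\<And>P Q x y. \<lbrakk>P \<in> \<P>; Q \<in> \<P>; P \<noteq> Q; x \<in> nbhd (max k k1) P; x \<in> nbhd (max k k1) Q;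
     y \<in> nbhd (max k k1) P; y \<in> nbhd (max k k1) Q\<rbrakk> \<Longrightarrow> dist x y \<le> l"
    by (rule intersection_bound[of "max k k1"]) blast
  obtain D where D0: "0 \<le> D" and D: "\<And>x y z g a b h c d f m n p. \<lbrakk>geodesic_from_to x y g a b; geodesic_from_to y z h c d;
      geodesic_from_to x z f m n; p \<in> Trans g a b\<rbrakk> \<Longrightarrow> \<exists>q\<in>Trans h c d \<union> Trans f m n. dist p q \<le> D"
    by (rule thin_bound) blast
  obtain K where K0: "0 \<le> K" and K: "\<And>P x y g a b p. \<lbrakk>P \<in> \<P>; geodesic_from_to x y g a b; x \<in> nbhd k P; y \<in> nbhd k P;
     p \<in> Trans g a b\<rbrakk> \<Longrightarrow> dist p x \<le> K \<or> dist p y \<le> K"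
    by (rule ends_bound[of k]) blast
  obtain G where G0: "0 \<le> G" and G: "\<And>P x e g a b t. \<lbrakk>P \<in> \<P>; access k P x e g a b; t \<in> {a..b};
     g t \<in> nbhd (k + (D + K)) P\<rbrakk> \<Longrightarrow> dist (g t) e \<le> G"
    by (rule access_bound[OF k, of "k + (D + K)"]) blast
  have "\<exists>r\<ge>0. \<forall>P\<in>\<P>. \<forall>x w0 w1 w2. gate k P x w0 \<and> gate k P x w1 \<and> gate k P x w2 \<and>
     l < dist w1 w2 \<and> dist w1 w2 \<le> l' \<longrightarrow> dist w1 w0 \<le> r \<or> dist w2 w0 \<le> r" for l'
  proof -
    define m where "m = k1 + max l' 0 + D"
    obtain k2 where hull: "\<And>P g a b t. \<lbrakk>P \<in> \<P>; geodesic g a b; g a \<in> nbhd m P; g b \<in> nbhd m P; t \<in> {a..b}\<rbrakk>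
        \<Longrightarrow> g t \<in> nbhd k2 P"
      by (rule hull[of m]) blast
    obtain B where B0: "0 \<le> B" and B: "\<And>P Q x y. \<lbrakk>P \<in> \<P>; Q \<in> \<P>; P \<noteq> Q; x \<in> nbhd k2 P; x \<in> nbhd k2 Q;
       y \<in> nbhd k2 P; y \<in> nbhd k2 Q\<rbrakk> \<Longrightarrow> dist x y \<le> B"
      by (rule intersection_bound[of k2]) blast
    define r0 where "r0 = B + 1 + max l' 0 + D + D + K + G"
    obtain r where r: "\<forall>P\<in>\<P>. \<forall>x w w' h a b h' a' b'. access k P x w h a b \<and> access k P x w' h' a' b' \<and> r < dist w w' \<longrightarrow>
      (\<exists>v\<in>Trans h a b. \<exists>Q\<in>\<P>. Q \<noteq> P \<and> v \<in> nbhd k1 Q \<and> w \<in> nbhd k1 Q \<and> r0 < dist v w)"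
      using k1[of r0] ..
    have False if P: "P \<in> \<P>" and w0: "gate k P x w0" and w1: "gate k P x w1" and w2: "gate k P x w2"
      and d: "l < dist w1 w2" "dist w1 w2 \<le> l'" and far: "max r 0 < dist w1 w0" "max r 0 < dist w2 w0" for P x w0 w1 w2
    proof -
      obtain h0 a0 b0 h1 a1 b1 h2 a2 b2 where h: "access k P x w0 h0 a0 b0" "access k P x w1 h1 a1 b1" "access k P x w2 h2 a2 b2"
        using w0 w1 w2 unfolding gate_def by blast
      have far': "r < dist w1 w0" "r < dist w2 w0" using far by auto
      obtain v1 Q1 where Q1: "v1 \<in> Trans h1 a1 b1" "Q1 \<in> \<P>" "Q1 \<noteq> P" "v1 \<in> nbhd k1 Q1" "w1 \<in> nbhd k1 Q1" "r0 < dist v1 w1"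
        using r[rule_format, OF P, of x w1 h1 a1 b1 w0 h0 a0 b0] h far' by blast
      obtain v2 Q2 where Q2: "v2 \<in> Trans h2 a2 b2" "Q2 \<in> \<P>" "Q2 \<noteq> P" "v2 \<in> nbhd k1 Q2" "w2 \<in> nbhd k1 Q2" "r0 < dist v2 w2"
        using r[rule_format, OF P, of x w2 h2 a2 b2 w0 h0 a0 b0] h far' by blast
      have hg: "geodesic_from_to x w1 h1 a1 b1" "geodesic_from_to x w2 h2 a2 b2" and wP: "w1 \<in> nbhd k P" "w2 \<in> nbhd k P"
        using h by (auto simp: access_def)
      then have gg: "geodesic h2 a2 b2" "h2 b2 = w2" by (auto simp: geodesic_from_to_def)
      obtain s1 where s1: "s1 \<in> {a1..b1}" "v1 = h1 s1" using Q1(1) trans_points_image[of \<P> \<mu> R h1 a1 b1] by blast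
      obtain s2 where s2: "s2 \<in> {a2..b2}" "v2 = h2 s2" using Q2(1) trans_points_image[of \<P> \<mu> R h2 a2 b2] by blast
      obtain i u v where i: "geodesic_from_to w1 w2 i u v" by (rule obtain_geodesic[OF geod]) blast
      obtain q where q: "q \<in> Trans i u v \<union> Trans h2 a2 b2" "dist v1 q \<le> D" using D[OF hg(1) i hg(2) Q1(1)] by blast
      have "q \<notin> Trans i u v"
      proof
        assume "q \<in> Trans i u v"
        then consider "dist q w1 \<le> K" | "dist q w2 \<le> K" using K[OF P i wP] by blast
        then have "dist w1 v1 \<le> D + K \<or> dist w2 v1 \<le> D + K"
          using q(2) dist_triangle[of w1 v1 q] dist_triangle[of w2 v1 q] by cases (auto simp: dist_commute)
        then have "v1 \<in> nbhd (k + (D + K)) P" using nbhd_dist[OF wP(1)] nbhd_dist[OF wP(2)] by blast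
        then have "dist v1 w1 \<le> G" using G[OF P h(2) s1(1)] s1(2) by auto
        then show False using Q1(6) B0 D0 K0 by (simp add: r0_def)
      qed
      then obtain s where s: "s \<in> {a2..b2}" "q = h2 s" using q trans_points_image[of \<P> \<mu> R h2 a2 b2] by blast
      have "dist v1 w1 \<le> D + dist q w2 + dist w1 w2"
        using q(2) dist_triangle[of v1 w1 q] dist_triangle[of q w1 w2] by (simp add: dist_commute)
      then have qw: "B + 1 < dist q w2" using Q1(6) d D0 K0 G0 by (simp add: r0_def)
      have b2: "b2 \<in> {a2..b2}" using s by auto
      \<comment> \<open>A point of the second access path that both final pieces accompany up to \<open>w2\<close>.\<close>
      define z where "z = b2 - (B + 1)"
      have zs: "s \<le> z" "s2 \<le> z" "z \<le> b2"
        using geodesic_dist[OF gg(1) s(1) b2] geodesic_dist[OF gg(1) s2(1) b2] s s2 gg qw Q2(6) B0 D0 K0 G0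
        by (auto simp: z_def r0_def)
      have "q \<in> nbhd m Q1"
        by (rule nbhd_mono[OF nbhd_dist[OF Q1(4) q(2)]]) (simp add: m_def)
      moreover have "w2 \<in> nbhd m Q1"
        by (rule nbhd_mono[OF nbhd_dist[OF Q1(5) d(2)]]) (use D0 in \<open>simp add: m_def\<close>)
      ultimately have z1: "h2 z \<in> nbhd k2 Q1" "w2 \<in> nbhd k2 Q1"
        using hull[OF Q1(2) geodesic_sub[OF gg(1), of s b2], of z] hull[OF Q1(2) geodesic_sub[OF gg(1), of s b2], of b2]
          zs s gg by auto
      have "v2 \<in> nbhd m Q2" "w2 \<in> nbhd m Q2"
        using nbhd_mono[OF Q2(4), of m] nbhd_mono[OF Q2(5), of m] D0 by (auto simp: m_def)
      then have z2: "h2 z \<in> nbhd k2 Q2" "w2 \<in> nbhd k2 Q2"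
        using hull[OF Q2(2) geodesic_sub[OF gg(1), of s2 b2], of z] hull[OF Q2(2) geodesic_sub[OF gg(1), of s2 b2], of b2]
          zs s2 gg by auto
      have "dist (h2 z) w2 = B + 1"
        using geodesic_dist[OF gg(1) _ b2, of z] zs s gg B0 by (auto simp: z_def)
      then have "Q1 = Q2" using B[OF Q1(2) Q2(2) _ z1(1) z2(1) z1(2) z2(2)] by auto
      then have "dist w1 w2 \<le> l"
        using l(2)[OF P Q1(2), of w1 w2] Q1 Q2 wP nbhd_mono[of _ k _ "max k k1"] nbhd_mono[of _ k1 _ "max k k1"] by auto
      then show False using d by simp
    qed
    note contra = this
    show ?thesis
    proof (intro exI[of _ "max r 0"] conjI ballI allI impI)
      fix P x w0 w1 w2
      assume P: "P \<in> \<P>" and w: "gate k P x w0 \<and> gate k P x w1 \<and> gate k P x w2 \<and> l < dist w1 w2 \<and> dist w1 w2 \<le> l'"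
      show "dist w1 w0 \<le> max r 0 \<or> dist w2 w0 \<le> max r 0"
        using contra[OF P, of x w0 w1 w2] w by (meson not_le)
    qed simp
  qed
  then show ?thesis using that[of l] l(1) by blast
qed

text \<open>If \<open>e\<close> and \<open>e'\<close> are remote gates of \<open>x\<close>, no geodesic from \<open>x\<close> to a point \<open>m\<close> between them stays near
  \<open>P\<close> for long, since otherwise its entrance would be close to both \<open>e\<close> and \<open>e'\<close>. So a gate of \<open>x\<close> lies near
  \<open>m\<close>, and three suitably spaced points \<open>m\<close> contradict \<open>three_gates\<close>.\<close>

lemma coarse_gates: "coarse_gates \<P> \<mu>"
  unfolding coarse_gates_def
proof (intro allI impI)
  fix \<kappa> assume \<kappa>: "\<mu> \<le> \<kappa>"
  obtain k where k: "\<kappa> \<le> k" "\<mu> \<le> k" and hull: "\<And>P g a b t. \<lbrakk>P \<in> \<P>; geodesic g a b; g a \<in> nbhd \<kappa> P; g b \<in> nbhd \<kappa> P;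
      t \<in> {a..b}\<rbrakk> \<Longrightarrow> g t \<in> nbhd k P"
    by (rule hull[of \<kappa>]) blast
  obtain c c' where c0: "0 \<le> c" "0 \<le> c'" and c: "\<And>P x e m h p q s. \<lbrakk>P \<in> \<P>; gate \<kappa> P x e; e \<in> nbhd k P;
     geodesic_from_to x m h p q; m \<in> nbhd k P; s \<in> {p..q}; h s \<in> nbhd k P;
     \<And>r. r \<in> {p..<s} \<Longrightarrow> h r \<notin> nbhd k P; c < q - s\<rbrakk> \<Longrightarrow> dist (h s) e \<le> c'"
    by (rule long_stay_gate[OF \<kappa> k(2)]) blast
  obtain l where l0: "0 \<le> l" and l: "\<And>l'. \<exists>r\<ge>0. \<forall>P\<in>\<P>. \<forall>x w0 w1 w2. gate k P x w0 \<and> gate k P x w1 \<and> gate k P x w2 \<and>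
     l < dist w1 w2 \<and> dist w1 w2 \<le> l' \<longrightarrow> dist w1 w0 \<le> r \<or> dist w2 w0 \<le> r"
    by (rule three_gates[OF k(2)]) blast
  obtain r where r0: "0 \<le> r" and r: "\<forall>P\<in>\<P>. \<forall>x w0 w1 w2. gate k P x w0 \<and> gate k P x w1 \<and> gate k P x w2 \<and>
     l < dist w1 w2 \<and> dist w1 w2 \<le> l + 4 * c + 1 \<longrightarrow> dist w1 w0 \<le> r \<or> dist w2 w0 \<le> r"
    using l[of "l + 4 * c + 1"] by blast
  define \<delta> where "\<delta> = r + l + 6 * c + 2 * c' + 3"
  have "dist e e' \<le> \<delta>" if P: "P \<in> \<P>" and e: "gate \<kappa> P x e" "gate \<kappa> P x e'" for P x e e'
  proof (rule ccontr)
    assume "\<not> ?thesis"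
    then have far: "\<delta> < dist e e'" by simp
    obtain i p q where i: "geodesic_from_to e e' i p q" "q - p = dist e e'" by (rule obtain_geodesic[OF geod]) blast
    then have ii: "geodesic i p q" "i p = e" "i q = e'" by (auto simp: geodesic_from_to_def)
    have ek: "e \<in> nbhd k P" "e' \<in> nbhd k P" using e nbhd_mono[OF gate_nbhd k(1)] by auto
    have near: "\<exists>w. gate k P x w \<and> dist (i t) w \<le> c" if t: "t \<in> {p..q}" for t
    proof -
      have m: "i t \<in> nbhd k P" by (rule hull[OF P ii(1) _ _ t]) (use gate_nbhd e ii in auto)
      obtain h u v where h: "geodesic_from_to x (i t) h u v" by (rule obtain_geodesic[OF geod]) blast
      then have hh: "geodesic h u v" "h v = i t" "v \<in> {u..v}" "h v \<in> nbhd k P" using m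
        by (auto simp: geodesic_from_to_def geodesic_def)
      obtain s where s: "s \<in> {u..v}" "gate k P x (h s)" "\<And>r. r \<in> {u..<s} \<Longrightarrow> h r \<notin> nbhd k P"
        using gate_first[OF h hh(3,4)] by blast
      have "v - s \<le> c"
      proof (rule ccontr)
        assume "\<not> ?thesis"
        then have *: "c < v - s" by simp
        have "dist (h s) e \<le> c'" "dist (h s) e' \<le> c'"
          using c[OF P e(1) ek(1) h m s(1) gate_nbhd[OF s(2)] s(3) *] c[OF P e(2) ek(2) h m s(1) gate_nbhd[OF s(2)] s(3) *]
          by auto
        then have "dist e e' \<le> 2 * c'" using dist_triangle[of e e' "h s"] by (simp add: dist_commute)
        then show False using far r0 l0 c0 by (simp add: \<delta>_def)
      qed
      then have "dist (i t) (h s) \<le> c" using geodesic_dist[OF hh(1) hh(3) s(1)] s(1) hh(2) by auto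
      then show ?thesis using s(2) by blast
    qed
    \<comment> \<open>The summands \<open>2 * c\<close> make up for the distance \<open>c\<close> between each point and its gate.\<close>
    define t1 t2 where "t1 = p + (r + 2 * c + 1)" and "t2 = p + (r + 2 * c + 1) + (l + 2 * c + 1)"
    have t: "p \<in> {p..q}" "t1 \<in> {p..q}" "t2 \<in> {p..q}"
      using i(2) far r0 l0 c0 by (auto simp: t1_def t2_def \<delta>_def)
    obtain w0 w1 w2 where w: "gate k P x w0" "dist (i p) w0 \<le> c" "gate k P x w1" "dist (i t1) w1 \<le> c"
      "gate k P x w2" "dist (i t2) w2 \<le> c" using near t by metis
    have "dist (i t1) (i t2) = l + 2 * c + 1" "dist (i p) (i t1) = r + 2 * c + 1" "dist (i p) (i t2) \<ge> r + 2 * c + 1"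
      using geodesic_dist[OF ii(1)] t r0 l0 c0 by (auto simp: t1_def t2_def)
    then have "l < dist w1 w2" "dist w1 w2 \<le> l + 4 * c + 1" "r < dist w1 w0" "r < dist w2 w0"
      using w dist_triangle[of w1 w2 "i t1"] dist_triangle[of "i t1" w2 "i t2"]
        dist_triangle[of "i t1" "i t2" w1] dist_triangle[of w1 "i t2" w2]
        dist_triangle[of "i p" "i t1" w0] dist_triangle[of w0 "i t1" w1]
        dist_triangle[of "i p" "i t2" w0] dist_triangle[of w0 "i t2" w2] by (auto simp: dist_commute)
    then show False using r P w by (meson not_le)
  qed
  then show "\<exists>\<delta>. \<forall>P\<in>\<P>. \<forall>x e e'. gate \<kappa> P x e \<and> gate \<kappa> P x e' \<longrightarrow> dist e e' \<le> \<delta>" by blast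
qed

lemma weakly_thin: "weakly_thin \<P> \<mu> R"
proof -
  obtain D where D: "\<And>x y z g a b h c d f m n p. \<lbrakk>geodesic_from_to x y g a b; geodesic_from_to y z h c d;
      geodesic_from_to x z f m n; p \<in> Trans g a b\<rbrakk> \<Longrightarrow> \<exists>q\<in>Trans h c d \<union> Trans f m n. dist p q \<le> D"
    by (rule thin_bound) blast
  have "\<exists>q\<in>h ` {c..d} \<union> f ` {m..n}. dist p q \<le> D" if "geodesic_from_to x y g a b" "geodesic_from_to y z h c d"
      "geodesic_from_to x z f m n" "p \<in> Trans g a b" for x y z g a b h c d f m n p
    using D[OF that] trans_points_image[of \<P> \<mu> R h c d] trans_points_image[of \<P> \<mu> R f m n] by blast
  then show ?thesis unfolding weakly_thin_def by (intro exI[of _ D] allI impI ballI) metis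
qed

sublocale gated \<P> \<mu> \<mu>' R
  by unfold_locales (rule weakly_thin coarse_gates)+

end

section \<open>Almost-geodesics\<close>

lemma almost_geodesic_dist:
  assumes "almost_geodesic 1 C g a b" "s \<in> {a..b}" "t \<in> {a..b}"
  shows "\<bar>s - t\<bar> - C \<le> dist (g s) (g t)" "dist (g s) (g t) \<le> \<bar>s - t\<bar> + C"
  using assms by (auto simp: almost_geodesic_def quasi_geodesic_def)

lemma almost_geodesic_sub:
  "almost_geodesic 1 C g a b \<Longrightarrow> a \<le> s \<Longrightarrow> s \<le> u \<Longrightarrow> u \<le> b \<Longrightarrow> almost_geodesic 1 C g s u"
  by (auto simp: almost_geodesic_def quasi_geodesic_def elim: continuous_on_subset)

lemma almost_geodesic_rev:
  assumes "almost_geodesic 1 C g a b"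
  shows "almost_geodesic 1 C (\<lambda>t. g (-t)) (-b) (-a)"
proof -
  have "continuous_on {-b..-a} (\<lambda>t. g (-t))"
    by (rule continuous_on_compose2[of "{a..b}" g])
      (use assms in \<open>auto intro!: continuous_intros simp: almost_geodesic_def\<close>)
  moreover have "\<bar>s - t\<bar> - C \<le> dist (g (-s)) (g (-t)) \<and> dist (g (-s)) (g (-t)) \<le> \<bar>s - t\<bar> + C"
    if "s \<in> {-b..-a}" "t \<in> {-b..-a}" for s t
    using almost_geodesic_dist[OF assms, of "-s" "-t"] that by auto
  then have "quasi_geodesic 1 C (\<lambda>t. g (-t)) (-b) (-a)"
    using assms by (simp add: quasi_geodesic_def almost_geodesic_def)
  ultimately show ?thesis by (simp add: almost_geodesic_def)
qed

lemma geodesic_almost_geodesic: "geodesic g a b \<Longrightarrow> 0 \<le> C \<Longrightarrow> almost_geodesic 1 C g a b"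
  using geodesic_continuous[of g a b]
  by (auto simp: almost_geodesic_def quasi_geodesic_def geodesic_def)

lemma all_less_3: "(\<forall>i<3. Q i) \<longleftrightarrow> Q 0 \<and> Q 1 \<and> Q (2::nat)"
  by (auto simp: numeral_3_eq_3 numeral_2_eq_2 less_Suc_eq)

context gated
begin

text \<open>If \<open>x\<close> and \<open>y\<close> are close to \<open>P\<close> relative to their distance, then so are they to their gates, which are
  therefore far apart unless \<open>x\<close> and \<open>y\<close> are within a fixed distance. In the latter case
  \<open>x\<close> itself is close to \<open>P\<close>.\<close>

lemma alpha2: "alpha2 \<P>"
proof -
  define k where "k = max \<mu> 0"
  have k: "\<mu> \<le> k" "0 \<le> k" by (auto simp: k_def)
  obtain L K where L0: "0 \<le> L" "0 \<le> K" and
    pass: "\<And>P x y e f g a b. \<lbrakk>P \<in> \<P>; gate k P x e; gate k P y f; L < dist e f; geodesic_from_to x y g a b\<rbrakk>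
       \<Longrightarrow> \<exists>t\<in>{a..b}. dist (g t) e \<le> K"
    by (rule geodesic_passes_gate[OF k(1)]) blast
  define M where "M = k + K + L + 2"
  have "g ` {a..b} \<inter> nbhd M P \<noteq> {}"
    if P: "P \<in> \<P>" and x: "x \<in> nbhd (1/4 * dist x y) P" and y: "y \<in> nbhd (1/4 * dist x y) P"
      and g: "geodesic_from_to x y g a b" for P x y g a b
  proof -
    obtain p where p: "p \<in> P" "dist x p \<le> 1/4 * dist x y + 1" by (rule nbhd_obtain[OF x])
    obtain q where q: "q \<in> P" "dist y q \<le> 1/4 * dist x y + 1" by (rule nbhd_obtain[OF y])
    have pq: "p \<in> nbhd k P" "q \<in> nbhd k P" using p q k by (auto intro: nbhd_mem)
    obtain e where e: "gate k P x e" "dist x e \<le> dist x p" by (rule gate_exists[OF geod pq(1)])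
    obtain f where f: "gate k P y f" "dist y f \<le> dist y q" by (rule gate_exists[OF geod pq(2)])
    show ?thesis
    proof (cases "L < dist e f")
      case True
      then obtain t where t: "t \<in> {a..b}" "dist (g t) e \<le> K" using pass[OF P e(1) f(1) _ g] by blast
      then have "g t \<in> nbhd (k + K) P" using nbhd_dist[OF gate_nbhd[OF e(1)]] by (simp add: dist_commute)
      then have "g t \<in> nbhd M P" by (rule nbhd_mono) (use L0 in \<open>simp add: M_def\<close>)
      then show ?thesis using t by blast
    next
      case False
      then have "dist x y \<le> 2 * L + 4"
        using e f p q dist_triangle[of x y e] dist_triangle[of e y f] by (simp add: dist_commute)
      then have "x \<in> nbhd M P" using L0 k by (intro nbhd_mono[OF x]) (simp add: M_def)
      moreover have "x \<in> g ` {a..b}" using g by (auto simp: geodesic_from_to_def geodesic_def)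
      ultimately show ?thesis by blast
    qed
  qed
  then show ?thesis unfolding alpha2_def using L0 k
    by (intro exI[of _ "1/4"] exI[of _ M]) (auto simp: M_def)
qed

text \<open>Take the point \<open>q\<close> of the almost-geodesic at the same distance from \<open>x\<close> as \<open>p\<close>. Since an
  almost-geodesic is longer than a geodesic by a bounded amount only, \<open>q\<close> is hardly farther from \<open>y\<close> than
  \<open>p\<close> is. A point near \<open>p\<close> on a geodesic from \<open>q\<close> to \<open>x\<close> or to \<open>y\<close> must then be close to \<open>q\<close>.\<close>

lemma almost_geodesic_near_transient:
  assumes C: "0 \<le> C"
  obtains J where "0 \<le> J" "\<And>x y g a b p \<alpha> c d. \<lbrakk>geodesic_from_to x y g a b; p \<in> Trans g a b;
     almost_geodesic 1 C \<alpha> c d; \<alpha> c = x; \<alpha> d = y\<rbrakk> \<Longrightarrow> \<exists>s\<in>{c..d}. dist p (\<alpha> s) \<le> J"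
proof -
  obtain D where D: "\<And>x y z g a b h c d f m n p. \<lbrakk>geodesic_from_to x y g a b; geodesic_from_to y z h c d;
      geodesic_from_to x z f m n; p \<in> Trans g a b\<rbrakk> \<Longrightarrow> \<exists>q\<in>h ` {c..d} \<union> f ` {m..n}. dist p q \<le> D"
    using weakly_thin unfolding weakly_thin_def by metis
  define J where "J = 3 * C + 2 * max D 0"
  have "\<exists>s\<in>{c..d}. dist p (\<alpha> s) \<le> J"
    if g: "geodesic_from_to x y g a b" and p: "p \<in> Trans g a b" and \<alpha>: "almost_geodesic 1 C \<alpha> c d" "\<alpha> c = x" "\<alpha> d = y"
    for x y g a b p \<alpha> c d
  proof -
    have gg: "geodesic g a b" "g a = x" "g b = y" "a \<le> b" using g by (auto simp: geodesic_from_to_def geodesic_def)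
    obtain t where t: "t \<in> {a..b}" "p = g t" using p trans_points_image[of \<P> \<mu> R g a b] by blast
    have xpy: "dist x y = dist x p + dist p y"
      using geodesic_dist[OF gg(1), of a t] geodesic_dist[OF gg(1), of t b] geodesic_dist[OF gg(1), of a b] t gg by auto
    have cd: "c \<le> d" and cont: "continuous_on {c..d} \<alpha>" using \<alpha>(1) by (auto simp: almost_geodesic_def quasi_geodesic_def)
    have "\<exists>s\<ge>c. s \<le> d \<and> dist x (\<alpha> s) = dist x p"
      by (rule IVT') (use xpy \<alpha> cd cont in \<open>auto intro!: continuous_intros\<close>)
    then obtain s where s: "s \<in> {c..d}" "dist x (\<alpha> s) = dist x p" by auto
    have qy: "dist (\<alpha> s) y \<le> dist p y + 3 * C"
      using almost_geodesic_dist[OF \<alpha>(1), of c d] almost_geodesic_dist[OF \<alpha>(1), of c s]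
        almost_geodesic_dist[OF \<alpha>(1), of s d] \<alpha> s cd xpy by auto
    obtain h l n where h: "geodesic_from_to (\<alpha> s) y h l n" by (rule obtain_geodesic[OF geod]) blast
    obtain f l' n' where f: "geodesic_from_to x (\<alpha> s) f l' n'" by (rule obtain_geodesic[OF geod]) blast
    obtain w where w: "w \<in> h ` {l..n} \<union> f ` {l'..n'}" "dist p w \<le> D"
      using D[OF g geodesic_from_to_rev[OF h] f p] by (auto simp: rev_image)
    have "dist w (\<alpha> s) \<le> 3 * C + D"
    proof (cases "w \<in> h ` {l..n}")
      case True
      then obtain r where r: "r \<in> {l..n}" "w = h r" by blast
      have "dist (\<alpha> s) w + dist w y = dist (\<alpha> s) y"
        using h geodesic_dist[of h l n l r] geodesic_dist[of h l n r n] geodesic_dist[of h l n l n] r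
        by (auto simp: geodesic_from_to_def)
      then show ?thesis using qy w(2) dist_triangle[of p y w] by (simp add: dist_commute)
    next
      case False
      then obtain r where r: "r \<in> {l'..n'}" "w = f r" using w by blast
      have "dist x w + dist w (\<alpha> s) = dist x (\<alpha> s)"
        using f geodesic_dist[of f l' n' l' r] geodesic_dist[of f l' n' r n'] geodesic_dist[of f l' n' l' n'] r
        by (auto simp: geodesic_from_to_def)
      then show ?thesis using s(2) w(2) dist_triangle[of x p w] C by (simp add: dist_commute)
    qed
    then have "dist p (\<alpha> s) \<le> J" using w(2) dist_triangle[of p "\<alpha> s" w] by (simp add: J_def)
    then show ?thesis using s by blast
  qed
  then show ?thesis using that[of J] C by (auto simp: J_def)
qed

text \<open>Let an almost-geodesic end at its first hit. If this end were far from the point where the geodesic with the same ends enters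
  \<open>N\<^sub>\<sigma>(P)\<close>, then that geodesic
  would have a transient point in \<open>N\<^sub>\<mu>(P)\<close> soon after its entrance, and the almost-geodesic would
  be in \<open>N\<^sub>\<sigma>(P)\<close> near that point, which can only happen at the first hit. The bound \<open>J\<close> occurs in the choice of \<open>\<sigma>\<close>, which is why
  it is provided together with the statement on hits.\<close>

lemma almost_geodesic_first_hit:
  assumes C: "0 \<le> C"
  obtains J where "0 \<le> J"
    "\<And>x y g a b p \<alpha> c d. \<lbrakk>geodesic_from_to x y g a b; p \<in> Trans g a b;
     almost_geodesic 1 C \<alpha> c d; \<alpha> c = x; \<alpha> d = y\<rbrakk> \<Longrightarrow> \<exists>s\<in>{c..d}. dist p (\<alpha> s) \<le> J"
    "\<And>\<sigma>. \<mu> + J \<le> \<sigma> \<Longrightarrow> \<exists>\<delta>. \<forall>P\<in>\<P>. \<forall>\<alpha> c d e. almost_geodesic 1 C \<alpha> c d \<and> \<alpha> d \<in> nbhd \<sigma> P \<and>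
       (\<forall>t\<in>{c..<d}. \<alpha> t \<notin> nbhd \<sigma> P) \<and> gate \<sigma> P (\<alpha> c) e \<longrightarrow> dist (\<alpha> d) e \<le> \<delta>"
proof -
  obtain J where J0: "0 \<le> J" and J: "\<And>x y g a b p \<alpha> c d. \<lbrakk>geodesic_from_to x y g a b; p \<in> Trans g a b;
     almost_geodesic 1 C \<alpha> c d; \<alpha> c = x; \<alpha> d = y\<rbrakk> \<Longrightarrow> \<exists>s\<in>{c..d}. dist p (\<alpha> s) \<le> J"
    by (rule almost_geodesic_near_transient[OF C]) blast
  have "\<exists>\<delta>. \<forall>P\<in>\<P>. \<forall>\<alpha> c d e. almost_geodesic 1 C \<alpha> c d \<and> \<alpha> d \<in> nbhd \<sigma> P \<and>
       (\<forall>t\<in>{c..<d}. \<alpha> t \<notin> nbhd \<sigma> P) \<and> gate \<sigma> P (\<alpha> c) e \<longrightarrow> dist (\<alpha> d) e \<le> \<delta>" if \<sigma>: "\<mu> + J \<le> \<sigma>" for \<sigma>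
  proof -
    have ms: "\<mu> \<le> \<sigma>" using \<sigma> J0 by simp
    obtain \<delta> where d0: "0 \<le> \<delta>" and \<delta>: "\<And>P x e e'. \<lbrakk>P \<in> \<P>; gate \<sigma> P x e; gate \<sigma> P x e'\<rbrakk> \<Longrightarrow> dist e e' \<le> \<delta>"
      by (rule gate_unique[OF ms ms]) blast
    obtain E where E0: "0 \<le> E" and E: "\<And>P g a b e u. \<lbrakk>P \<in> \<P>; geodesic g a b; a \<le> e; e \<le> u; u \<le> b; g e \<in> nbhd \<sigma> P;
       \<And>r. r \<in> {a..<e} \<Longrightarrow> g r \<notin> nbhd \<sigma> P; g u \<in> nbhd \<sigma> P; E < u - e\<rbrakk> \<Longrightarrow>
       \<exists>t\<in>{e..e + E}. t \<le> u \<and> g t \<in> Trans g a b \<and> g t \<in> nbhd \<mu> P"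
      by (rule entry_transient[OF ms]) blast
    have "dist (\<alpha> d) e \<le> E + J + \<delta>"
      if P: "P \<in> \<P>" and \<alpha>: "almost_geodesic 1 C \<alpha> c d" and hit: "\<alpha> d \<in> nbhd \<sigma> P" "\<And>t. t\<in>{c..<d} \<Longrightarrow> \<alpha> t \<notin> nbhd \<sigma> P"
        and e: "gate \<sigma> P (\<alpha> c) e" for P \<alpha> c d e
    proof -
      obtain g a b where g: "geodesic_from_to (\<alpha> c) (\<alpha> d) g a b" by (rule obtain_geodesic[OF geod]) blast
      then have gg: "geodesic g a b" "g b = \<alpha> d" "b \<in> {a..b}" "g b \<in> nbhd \<sigma> P"
        using hit by (auto simp: geodesic_from_to_def geodesic_def)
      obtain s where s: "s \<in> {a..b}" "gate \<sigma> P (\<alpha> c) (g s)" "\<And>r. r \<in> {a..<s} \<Longrightarrow> g r \<notin> nbhd \<sigma> P"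
        using gate_first[OF g gg(3,4)] by blast
      have es: "dist (g s) e \<le> \<delta>" by (rule \<delta>[OF P s(2) e])
      have "dist (\<alpha> d) (g s) \<le> E + J"
      proof (cases "E < b - s")
        case True
        then obtain t where t: "t \<in> {s..s + E}" "t \<le> b" "g t \<in> Trans g a b" "g t \<in> nbhd \<mu> P"
          using E[OF P gg(1), of s b] s gg gate_nbhd[OF s(2)] by auto
        obtain r where r: "r \<in> {c..d}" "dist (g t) (\<alpha> r) \<le> J" using J[OF g t(3) \<alpha> refl refl] by blast
        have "\<alpha> r \<in> nbhd \<sigma> P" by (rule nbhd_mono[OF nbhd_dist[OF t(4) r(2)] \<sigma>])
        then have "r = d" using hit(2)[of r] r by force
        moreover have "dist (g s) (g t) \<le> E" using geodesic_dist[OF gg(1) s(1), of t] t s by auto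
        ultimately show ?thesis using r(2) dist_triangle[of "\<alpha> d" "g s" "g t"] by (simp add: dist_commute)
      next
        case False
        then show ?thesis using geodesic_dist[OF gg(1,3) s(1)] s(1) gg J0 by auto
      qed
      then show ?thesis using es dist_triangle[of "\<alpha> d" e "g s"] by simp
    qed
    note bound = this
    show ?thesis
      by (intro exI[of _ "E + J + \<delta>"] ballI allI impI; elim conjE; rule bound; blast)
  qed
  then show ?thesis using that[of J] J0 J by blast
qed

end

context thin_family
begin

text \<open>Apply \<open>transient_gap\<close> to the first geodesic side with the conditions of being near transient
  points of the third and of the second side. A common point is the centre of a ball meeting all sides.
  Otherwise the piece of the gap is close to transient points of all three sides, and thus to all three
  almost-geodesics. At each vertex, the exit point of one side and the entrance point of
  the next are first hits seen from that vertex, so both are close to its gate.\<close>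

lemma asymptotically_tree_graded: "asymptotically_tree_graded \<P>"
  unfolding asymptotically_tree_graded_def
proof (intro allI impI)
  fix C :: real assume C: "0 \<le> C"
  obtain J where J0: "0 \<le> J"
    and J: "\<And>x y g a b p \<alpha> c d. \<lbrakk>geodesic_from_to x y g a b; p \<in> Trans g a b;
     almost_geodesic 1 C \<alpha> c d; \<alpha> c = x; \<alpha> d = y\<rbrakk> \<Longrightarrow> \<exists>s\<in>{c..d}. dist p (\<alpha> s) \<le> J"
    and hit_ex: "\<And>\<sigma>. \<mu> + J \<le> \<sigma> \<Longrightarrow> \<exists>\<delta>. \<forall>P\<in>\<P>. \<forall>\<alpha> c d e. almost_geodesic 1 C \<alpha> c d \<and> \<alpha> d \<in> nbhd \<sigma> P \<and>
       (\<forall>t\<in>{c..<d}. \<alpha> t \<notin> nbhd \<sigma> P) \<and> gate \<sigma> P (\<alpha> c) e \<longrightarrow> dist (\<alpha> d) e \<le> \<delta>"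
    by (rule almost_geodesic_first_hit[OF C]) blast
  obtain D where D0: "0 \<le> D" and D: "\<And>x y z g a b h c d f m n p. \<lbrakk>geodesic_from_to x y g a b; geodesic_from_to y z h c d;
      geodesic_from_to x z f m n; p \<in> Trans g a b\<rbrakk> \<Longrightarrow> \<exists>q\<in>Trans h c d \<union> Trans f m n. dist p q \<le> D"
    by (rule thin_bound) blast
  define \<sigma> where "\<sigma> = max 0 (max \<mu> \<mu>') + D + 1 + J"
  have \<sigma>: "\<mu> + J \<le> \<sigma>" "\<mu>' + (D + 1 + J) \<le> \<sigma>" "D + 1 + J \<le> \<sigma>" using D0 by (auto simp: \<sigma>_def)
  obtain \<delta> where \<delta>: "\<forall>P\<in>\<P>. \<forall>\<alpha> c d e. almost_geodesic 1 C \<alpha> c d \<and> \<alpha> d \<in> nbhd \<sigma> P \<and>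
       (\<forall>t\<in>{c..<d}. \<alpha> t \<notin> nbhd \<sigma> P) \<and> gate \<sigma> P (\<alpha> c) e \<longrightarrow> dist (\<alpha> d) e \<le> \<delta>"
    using hit_ex[OF \<sigma>(1)] ..
  have "(\<exists>p. \<forall>i<3. cball p \<sigma> \<inter> \<gamma> i ` {a i..b i} \<noteq> {}) \<or>
       (\<exists>P\<in>\<P>. (\<forall>i<3. nbhd \<sigma> P \<inter> \<gamma> i ` {a i..b i} \<noteq> {}) \<and>
          (\<exists>x y. (\<forall>i<3. entrance_point (\<gamma> i) (a i) (b i) (nbhd \<sigma> P) (x i) \<and>
                          exit_point (\<gamma> i) (a i) (b i) (nbhd \<sigma> P) (y i)) \<and>
                 (\<forall>i<3. dist (y i) (x (Suc i mod 3)) \<le> 2 * \<delta>)))"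
    if tri: "cyclic_triangle \<gamma> a b \<and> (\<forall>i<3. almost_geodesic 1 C (\<gamma> i) (a i) (b i))" for \<gamma> a b
  proof -
    have ag: "\<And>i. i < 3 \<Longrightarrow> almost_geodesic 1 C (\<gamma> i) (a i) (b i)" using tri by blast
    have ends_eq: "\<And>i. i < 3 \<Longrightarrow> \<gamma> i (b i) = \<gamma> (Suc i mod 3) (a (Suc i mod 3))" using tri by (simp add: cyclic_triangle_def)
    have v: "\<gamma> 0 (b 0) = \<gamma> 1 (a 1)" "\<gamma> 1 (b 1) = \<gamma> 2 (a 2)" "\<gamma> 2 (b 2) = \<gamma> 0 (a 0)"
      using ends_eq[of 0] ends_eq[of 1] ends_eq[of 2] by (auto simp: numeral_2_eq_2)
    have "\<forall>i. \<exists>g l n. geodesic_from_to (\<gamma> i (a i)) (\<gamma> i (b i)) g l n" using geod unfolding geodesic_metric_space_def by blast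
    then obtain g l n where g: "\<And>i. geodesic_from_to (\<gamma> i (a i)) (\<gamma> i (b i)) (g i) (l i) (n i)" by metis
    have gg: "geodesic (g i) (l i) (n i)" "g i (l i) = \<gamma> i (a i)" "g i (n i) = \<gamma> i (b i)" for i
      using g[of i] by (auto simp: geodesic_from_to_def)
    define T where "T i = Trans (g i) (l i) (n i)" for i
    have T_ends: "\<gamma> i (a i) \<in> T i" "\<gamma> i (b i) \<in> T i" for i
      using trans_points_ends[OF gg(1)[of i], of R \<P> \<mu>] R_pos gg(2,3)[of i] by (auto simp: T_def)
    define A B where "A = nbhd D (T 2)" and "B = nbhd D (T 1)"
    have "closed A" "closed B" by (auto simp: A_def B_def closed_nbhd)
    moreover have "Trans (g 0) (l 0) (n 0) \<subseteq> A \<union> B"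
    proof
      fix p assume p: "p \<in> Trans (g 0) (l 0) (n 0)"
      have g1: "geodesic_from_to (\<gamma> 0 (b 0)) (\<gamma> 2 (a 2)) (g 1) (l 1) (n 1)" using g[of 1] v by simp
      have g2: "geodesic_from_to (\<gamma> 0 (a 0)) (\<gamma> 2 (a 2)) (\<lambda>t. g 2 (-t)) (- n 2) (- l 2)"
        using geodesic_from_to_rev[OF g[of 2]] v by simp
      obtain q where "q \<in> T 1 \<union> T 2" "dist p q \<le> D"
        using D[OF g[of 0] g1 g2 p] unfolding T_def trans_points_rev by blast
      then show "p \<in> A \<union> B" using nbhd_mem by (auto simp: A_def B_def)
    qed
    moreover have "g 0 (l 0) \<in> A" "g 0 (n 0) \<in> B"
      using nbhd_mem[of "\<gamma> 2 (b 2)" "T 2" "g 0 (l 0)" D] nbhd_mem[of "\<gamma> 1 (a 1)" "T 1" "g 0 (n 0)" D] T_ends(1)[of 1] T_ends(2)[of 2] v gg D0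
      by (auto simp: A_def B_def)
    ultimately obtain t1 t2 where t: "t1 \<in> {l 0..n 0}" "t2 \<in> {l 0..n 0}" "t1 \<le> t2" "g 0 t1 \<in> T 0 \<inter> A" "g 0 t2 \<in> T 0 \<inter> B"
        and gap: "t1 = t2 \<or> (\<exists>Q\<in>\<P>. \<forall>t\<in>{t1..t2}. g 0 t \<in> nbhd \<mu>' Q)"
      using transient_gap[OF gg(1)[of 0], of A B] unfolding T_def by metis
    obtain u where u: "u \<in> T 2" "dist (g 0 t1) u \<le> D + 1" using nbhd_obtain[of "g 0 t1" D "T 2"] t(4) by (auto simp: A_def)
    obtain w where w: "w \<in> T 1" "dist (g 0 t2) w \<le> D + 1" using nbhd_obtain[of "g 0 t2" D "T 1"] t(5) by (auto simp: B_def)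
    obtain r0 where r0: "r0 \<in> {a 0..b 0}" "dist (g 0 t1) (\<gamma> 0 r0) \<le> J"
      using J[OF g[of 0] _ ag[of 0] refl refl, of "g 0 t1"] t(4) by (auto simp: T_def)
    obtain r1 where r1: "r1 \<in> {a 1..b 1}" "dist w (\<gamma> 1 r1) \<le> J"
      using J[OF g[of 1] _ ag[of 1] refl refl, of w] w by (auto simp: T_def)
    obtain r2 where r2: "r2 \<in> {a 2..b 2}" "dist u (\<gamma> 2 r2) \<le> J"
      using J[OF g[of 2] _ ag[of 2] refl refl, of u] u by (auto simp: T_def)
    have near: "dist (g 0 t1) (\<gamma> 0 r0) \<le> D + 1 + J" "dist (g 0 t2) (\<gamma> 1 r1) \<le> D + 1 + J" "dist (g 0 t1) (\<gamma> 2 r2) \<le> D + 1 + J"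
      using r0 r1 r2 u w D0 dist_triangle[of "g 0 t2" "\<gamma> 1 r1" w] dist_triangle[of "g 0 t1" "\<gamma> 2 r2" u] by auto
    show ?thesis
    proof (cases "t1 = t2")
      case True
      then have "\<gamma> 0 r0 \<in> cball (g 0 t1) \<sigma>" "\<gamma> 1 r1 \<in> cball (g 0 t1) \<sigma>" "\<gamma> 2 r2 \<in> cball (g 0 t1) \<sigma>"
        using near \<sigma>(3) by auto
      then have "\<forall>i<3. cball (g 0 t1) \<sigma> \<inter> \<gamma> i ` {a i..b i} \<noteq> {}"
        using r0 r1 r2 unfolding all_less_3 by blast
      then show ?thesis by blast
    next
      case False
      then obtain Q where Q: "Q \<in> \<P>" "\<forall>t\<in>{t1..t2}. g 0 t \<in> nbhd \<mu>' Q" using gap by blast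
      then have Qt: "g 0 t1 \<in> nbhd \<mu>' Q" "g 0 t2 \<in> nbhd \<mu>' Q" using t by auto
      have "\<gamma> 0 r0 \<in> nbhd \<sigma> Q" "\<gamma> 1 r1 \<in> nbhd \<sigma> Q" "\<gamma> 2 r2 \<in> nbhd \<sigma> Q"
        using nbhd_mono[OF nbhd_dist[OF Qt(1) near(1)] \<sigma>(2)] nbhd_mono[OF nbhd_dist[OF Qt(2) near(2)] \<sigma>(2)]
          nbhd_mono[OF nbhd_dist[OF Qt(1) near(3)] \<sigma>(2)] by auto
      then have meet: "\<forall>i<3. \<exists>r\<in>{a i..b i}. \<gamma> i r \<in> nbhd \<sigma> Q" using r0 r1 r2 unfolding all_less_3 by blast
      have cont: "continuous_on {a i..b i} (\<gamma> i)" if "i < 3" for i using ag[OF that] by (simp add: almost_geodesic_def)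
      have "\<forall>i. \<exists>X. i < 3 \<longrightarrow> X \<in> {a i..b i} \<and> \<gamma> i X \<in> nbhd \<sigma> Q \<and> (\<forall>s\<in>{a i..<X}. \<gamma> i s \<notin> nbhd \<sigma> Q)"
      proof
        fix i show "\<exists>X. i < 3 \<longrightarrow> X \<in> {a i..b i} \<and> \<gamma> i X \<in> nbhd \<sigma> Q \<and> (\<forall>s\<in>{a i..<X}. \<gamma> i s \<notin> nbhd \<sigma> Q)"
        proof (cases "i < 3")
          case True
          then obtain r where r: "r \<in> {a i..b i}" "\<gamma> i r \<in> nbhd \<sigma> Q" using meet by blast
          show ?thesis by (rule first_hit[OF cont[OF True] closed_nbhd r]) (use r in auto)
        qed simp
      qed
      then obtain X where X: "\<And>i. i < 3 \<Longrightarrow> X i \<in> {a i..b i} \<and> \<gamma> i (X i) \<in> nbhd \<sigma> Q \<and> (\<forall>s\<in>{a i..<X i}. \<gamma> i s \<notin> nbhd \<sigma> Q)"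
        by metis
      have "\<forall>i. \<exists>Y. i < 3 \<longrightarrow> Y \<in> {a i..b i} \<and> \<gamma> i Y \<in> nbhd \<sigma> Q \<and> (\<forall>s\<in>{Y<..b i}. \<gamma> i s \<notin> nbhd \<sigma> Q)"
      proof
        fix i show "\<exists>Y. i < 3 \<longrightarrow> Y \<in> {a i..b i} \<and> \<gamma> i Y \<in> nbhd \<sigma> Q \<and> (\<forall>s\<in>{Y<..b i}. \<gamma> i s \<notin> nbhd \<sigma> Q)"
        proof (cases "i < 3")
          case True
          then obtain r where r: "r \<in> {a i..b i}" "\<gamma> i r \<in> nbhd \<sigma> Q" using meet by blast
          obtain e where "e \<in> {r..b i}" "\<gamma> i e \<in> nbhd \<sigma> Q" "\<And>s. s \<in> {e<..b i} \<Longrightarrow> \<gamma> i s \<notin> nbhd \<sigma> Q"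
            using last_hit[OF cont[OF True] closed_nbhd r] by blast
          then show ?thesis using r by (intro exI[of _ e]) auto
        qed simp
      qed
      then obtain Y where Y: "\<And>i. i < 3 \<Longrightarrow> Y i \<in> {a i..b i} \<and> \<gamma> i (Y i) \<in> nbhd \<sigma> Q \<and> (\<forall>s\<in>{Y i<..b i}. \<gamma> i s \<notin> nbhd \<sigma> Q)"
        by metis
      have close: "dist (\<gamma> i (Y i)) (\<gamma> (Suc i mod 3) (X (Suc i mod 3))) \<le> 2 * \<delta>" if i: "i < 3" for i
      proof -
        define j where "j = Suc i mod 3"
        have j: "j < 3" by (simp add: j_def)
        have ij: "\<gamma> i (b i) = \<gamma> j (a j)" using ends_eq[OF i] by (simp add: j_def)
        obtain e where e: "gate \<sigma> Q (\<gamma> j (a j)) e" using gate_exists[OF geod] X[OF j] by metis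
        have "almost_geodesic 1 C (\<gamma> j) (a j) (X j)" by (rule almost_geodesic_sub[OF ag[OF j]]) (use X[OF j] in auto)
        then have 1: "dist (\<gamma> j (X j)) e \<le> \<delta>" using \<delta> Q(1) X[OF j] e by blast
        \<comment> \<open>Reversed, the exit point becomes a first hit.\<close>
        define \<beta> where "\<beta> = (\<lambda>t. \<gamma> i (-t))"
        have "almost_geodesic 1 C \<beta> (- b i) (- Y i)" unfolding \<beta>_def
          by (intro almost_geodesic_rev almost_geodesic_sub[OF ag[OF i]]) (use Y[OF i] in auto)
        moreover have "\<forall>t\<in>{- b i..<- Y i}. \<beta> t \<notin> nbhd \<sigma> Q" using Y[OF i] by (auto simp: \<beta>_def)
        moreover have "\<beta> (- Y i) \<in> nbhd \<sigma> Q" "gate \<sigma> Q (\<beta> (- b i)) e" using Y[OF i] e ij by (auto simp: \<beta>_def)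
        ultimately have "dist (\<beta> (- Y i)) e \<le> \<delta>" using \<delta> Q(1) by blast
        then show ?thesis using 1 dist_triangle2[of "\<gamma> i (Y i)" "\<gamma> j (X j)" e] by (simp add: \<beta>_def j_def)
      qed
      have "\<forall>i<3. entrance_point (\<gamma> i) (a i) (b i) (nbhd \<sigma> Q) (\<gamma> i (X i)) \<and>
            exit_point (\<gamma> i) (a i) (b i) (nbhd \<sigma> Q) (\<gamma> i (Y i))"
        unfolding entrance_point_def exit_point_def using X Y by blast
      moreover have "\<forall>i<3. nbhd \<sigma> Q \<inter> \<gamma> i ` {a i..b i} \<noteq> {}" using X by blast
      ultimately show ?thesis using Q(1) close
        by (intro disjI2 bexI[of _ Q] conjI exI[of _ "\<lambda>i. \<gamma> i (X i)"] exI[of _ "\<lambda>i. \<gamma> i (Y i)"]) auto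
    qed
  qed
  then show "\<exists>\<sigma> \<delta>. \<forall>\<gamma> a b. cyclic_triangle \<gamma> a b \<and> (\<forall>i<3. almost_geodesic 1 C (\<gamma> i) (a i) (b i)) \<longrightarrow>
       (\<exists>p. \<forall>i<3. cball p \<sigma> \<inter> \<gamma> i ` {a i..b i} \<noteq> {}) \<or>
       (\<exists>P\<in>\<P>. (\<forall>i<3. nbhd \<sigma> P \<inter> \<gamma> i ` {a i..b i} \<noteq> {}) \<and>
          (\<exists>x y. (\<forall>i<3. entrance_point (\<gamma> i) (a i) (b i) (nbhd \<sigma> P) (x i) \<and>
                          exit_point (\<gamma> i) (a i) (b i) (nbhd \<sigma> P) (y i)) \<and>
                 (\<forall>i<3. dist (y i) (x (Suc i mod 3)) \<le> \<delta>)))"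
    by (intro exI[of _ \<sigma>] exI[of _ "2 * \<delta>"] allI impI)
qed

end

section \<open>Triangles in tree-graded spaces\<close>

text \<open>Tree-gradedness for three separately named paths and fixed constants, with both alternatives in terms of
  parameters. Of the entrance point \<open>xi\<close> and the exit point \<open>yi\<close> of the \<open>i\<close>-th side it records
  the membership in the neighbourhood and the closeness at the vertices.\<close>

definition tree_graded_triangles ::
  "'a::metric_space set set \<Rightarrow> real \<Rightarrow> real \<Rightarrow> real \<Rightarrow> bool" where
  "tree_graded_triangles \<P> C \<sigma> \<delta> \<longleftrightarrow> (\<forall>\<alpha> a b \<beta> c d \<gamma> m n.
     almost_geodesic 1 C \<alpha> a b \<and> almost_geodesic 1 C \<beta> c d \<and> almost_geodesic 1 C \<gamma> m n \<and>
     \<alpha> b = \<beta> c \<and> \<beta> d = \<gamma> m \<and> \<gamma> n = \<alpha> a \<longrightarrow>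
     (\<exists>s\<in>{a..b}. \<exists>t\<in>{c..d}. \<exists>u\<in>{m..n}.
        dist (\<alpha> s) (\<beta> t) \<le> 2 * \<sigma> \<and> dist (\<beta> t) (\<gamma> u) \<le> 2 * \<sigma> \<and> dist (\<gamma> u) (\<alpha> s) \<le> 2 * \<sigma>) \<or>
     (\<exists>P\<in>\<P>. \<exists>x1\<in>{a..b}. \<exists>y1\<in>{a..b}. \<exists>x2\<in>{c..d}. \<exists>y2\<in>{c..d}. \<exists>x3\<in>{m..n}. \<exists>y3\<in>{m..n}.
        \<alpha> x1 \<in> nbhd \<sigma> P \<and> \<alpha> y1 \<in> nbhd \<sigma> P \<and> \<beta> x2 \<in> nbhd \<sigma> P \<and> \<beta> y2 \<in> nbhd \<sigma> P \<and>
        \<gamma> x3 \<in> nbhd \<sigma> P \<and> \<gamma> y3 \<in> nbhd \<sigma> P \<and>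
        dist (\<alpha> y1) (\<beta> x2) \<le> \<delta> \<and> dist (\<beta> y2) (\<gamma> x3) \<le> \<delta> \<and> dist (\<gamma> y3) (\<alpha> x1) \<le> \<delta>))"

lemma asymptotically_tree_gradedD:
  assumes "asymptotically_tree_graded \<P>" "0 \<le> C"
  obtains \<sigma> \<delta> where "tree_graded_triangles \<P> C \<sigma> \<delta>"
proof -
  obtain \<sigma> \<delta> where tg: "\<forall>\<gamma> a b. cyclic_triangle \<gamma> a b \<and> (\<forall>i<3. almost_geodesic 1 C (\<gamma> i) (a i) (b i)) \<longrightarrow>
       (\<exists>p. \<forall>i<3. cball p \<sigma> \<inter> \<gamma> i ` {a i..b i} \<noteq> {}) \<or>
       (\<exists>P\<in>\<P>. (\<forall>i<3. nbhd \<sigma> P \<inter> \<gamma> i ` {a i..b i} \<noteq> {}) \<and>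
          (\<exists>x y. (\<forall>i<3. entrance_point (\<gamma> i) (a i) (b i) (nbhd \<sigma> P) (x i) \<and>
                          exit_point (\<gamma> i) (a i) (b i) (nbhd \<sigma> P) (y i)) \<and>
                 (\<forall>i<3. dist (y i) (x (Suc i mod 3)) \<le> \<delta>)))"
    using assms(1)[unfolded asymptotically_tree_graded_def, rule_format, OF assms(2)] by - (elim exE; rule that)
  have "tree_graded_triangles \<P> C \<sigma> \<delta>"
    unfolding tree_graded_triangles_def
  proof (intro allI impI, elim conjE)
    fix \<alpha> :: "real \<Rightarrow> 'a" and a b \<beta> c d \<gamma> m n
    assume ag: "almost_geodesic 1 C \<alpha> a b" "almost_geodesic 1 C \<beta> c d" "almost_geodesic 1 C \<gamma> m n"
      and v: "\<alpha> b = \<beta> c" "\<beta> d = \<gamma> m" "\<gamma> n = \<alpha> a"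
    define G where "G = (\<lambda>i::nat. if i = 0 then \<alpha> else if i = 1 then \<beta> else \<gamma>)"
    define A where "A = (\<lambda>i::nat. if i = 0 then a else if i = 1 then c else m)"
    define B where "B = (\<lambda>i::nat. if i = 0 then b else if i = 1 then d else n)"
    have "cyclic_triangle G A B \<and> (\<forall>i<3. almost_geodesic 1 C (G i) (A i) (B i))"
      unfolding cyclic_triangle_def all_less_3 using ag v by (simp add: G_def A_def B_def)
    from tg[rule_format, OF this]
    consider (ball) p where "\<forall>i<3. cball p \<sigma> \<inter> G i ` {A i..B i} \<noteq> {}"
      | (piece) P x y where "P \<in> \<P>" "\<forall>i<3. entrance_point (G i) (A i) (B i) (nbhd \<sigma> P) (x i) \<and>
                          exit_point (G i) (A i) (B i) (nbhd \<sigma> P) (y i)" "\<forall>i<3. dist (y i) (x (Suc i mod 3)) \<le> \<delta>"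
      by blast
    then show "(\<exists>s\<in>{a..b}. \<exists>t\<in>{c..d}. \<exists>u\<in>{m..n}.
        dist (\<alpha> s) (\<beta> t) \<le> 2 * \<sigma> \<and> dist (\<beta> t) (\<gamma> u) \<le> 2 * \<sigma> \<and> dist (\<gamma> u) (\<alpha> s) \<le> 2 * \<sigma>) \<or>
     (\<exists>P\<in>\<P>. \<exists>x1\<in>{a..b}. \<exists>y1\<in>{a..b}. \<exists>x2\<in>{c..d}. \<exists>y2\<in>{c..d}. \<exists>x3\<in>{m..n}. \<exists>y3\<in>{m..n}.
        \<alpha> x1 \<in> nbhd \<sigma> P \<and> \<alpha> y1 \<in> nbhd \<sigma> P \<and> \<beta> x2 \<in> nbhd \<sigma> P \<and> \<beta> y2 \<in> nbhd \<sigma> P \<and>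
        \<gamma> x3 \<in> nbhd \<sigma> P \<and> \<gamma> y3 \<in> nbhd \<sigma> P \<and>
        dist (\<alpha> y1) (\<beta> x2) \<le> \<delta> \<and> dist (\<beta> y2) (\<gamma> x3) \<le> \<delta> \<and> dist (\<gamma> y3) (\<alpha> x1) \<le> \<delta>)"
    proof cases
      case ball
      then have "cball p \<sigma> \<inter> \<alpha> ` {a..b} \<noteq> {}" "cball p \<sigma> \<inter> \<beta> ` {c..d} \<noteq> {}" "cball p \<sigma> \<inter> \<gamma> ` {m..n} \<noteq> {}"
        unfolding all_less_3 by (simp_all add: G_def A_def B_def)
      then obtain s t u where st: "s \<in> {a..b}" "t \<in> {c..d}" "u \<in> {m..n}"
        "dist p (\<alpha> s) \<le> \<sigma>" "dist p (\<beta> t) \<le> \<sigma>" "dist p (\<gamma> u) \<le> \<sigma>" by fastforce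
      then have "dist (\<alpha> s) (\<beta> t) \<le> 2 * \<sigma>" "dist (\<beta> t) (\<gamma> u) \<le> 2 * \<sigma>" "dist (\<gamma> u) (\<alpha> s) \<le> 2 * \<sigma>"
        using dist_triangle3[of "\<alpha> s" "\<beta> t" p] dist_triangle3[of "\<beta> t" "\<gamma> u" p] dist_triangle3[of "\<gamma> u" "\<alpha> s" p]
        by linarith+
      then show ?thesis using st(1-3) by blast
    next
      case piece
      have "\<exists>X Y. X \<in> {A i..B i} \<and> Y \<in> {A i..B i} \<and> x i = G i X \<and> y i = G i Y \<and> G i X \<in> nbhd \<sigma> P \<and> G i Y \<in> nbhd \<sigma> P"
        if "i < 3" for i using piece(2) that unfolding entrance_point_def exit_point_def by blast
      then obtain X Y where XY: "\<And>i. i < 3 \<Longrightarrow> X i \<in> {A i..B i} \<and> Y i \<in> {A i..B i} \<and> x i = G i (X i) \<and> y i = G i (Y i) \<and>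
          G i (X i) \<in> nbhd \<sigma> P \<and> G i (Y i) \<in> nbhd \<sigma> P"
        by metis
      have d: "dist (y 0) (x 1) \<le> \<delta>" "dist (y 1) (x 2) \<le> \<delta>" "dist (y 2) (x 0) \<le> \<delta>"
        using piece(3) unfolding all_less_3 by (simp_all add: numeral_2_eq_2)
      have XY0: "X 0 \<in> {a..b}" "Y 0 \<in> {a..b}" "\<alpha> (X 0) \<in> nbhd \<sigma> P" "\<alpha> (Y 0) \<in> nbhd \<sigma> P" "x 0 = \<alpha> (X 0)" "y 0 = \<alpha> (Y 0)"
        using XY[of 0] by (auto simp: G_def A_def B_def)
      have XY1: "X 1 \<in> {c..d}" "Y 1 \<in> {c..d}" "\<beta> (X 1) \<in> nbhd \<sigma> P" "\<beta> (Y 1) \<in> nbhd \<sigma> P" "x 1 = \<beta> (X 1)" "y 1 = \<beta> (Y 1)"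
        using XY[of 1] by (auto simp: G_def A_def B_def)
      have XY2: "X 2 \<in> {m..n}" "Y 2 \<in> {m..n}" "\<gamma> (X 2) \<in> nbhd \<sigma> P" "\<gamma> (Y 2) \<in> nbhd \<sigma> P" "x 2 = \<gamma> (X 2)" "y 2 = \<gamma> (Y 2)"
        using XY[of 2] by (auto simp: G_def A_def B_def)
      have d': "dist (\<alpha> (Y 0)) (\<beta> (X 1)) \<le> \<delta>" "dist (\<beta> (Y 1)) (\<gamma> (X 2)) \<le> \<delta>" "dist (\<gamma> (Y 2)) (\<alpha> (X 0)) \<le> \<delta>"
        using d unfolding XY0(5,6) XY1(5,6) XY2(5,6) by auto
      show ?thesis
        using XY0 XY1 XY2 d' piece(1)
        by - (rule disjI2, rule bexI[of _ P], rule bexI[of _ "X 0"], rule bexI[of _ "Y 0"], rule bexI[of _ "X 1"],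
            rule bexI[of _ "Y 1"], rule bexI[of _ "X 2"], rule bexI[of _ "Y 2"], simp_all)
    qed
  qed
  then show ?thesis by (rule that)
qed

lemma tree_graded_triangles_cases:
  assumes "tree_graded_triangles \<P> C \<sigma> \<delta>"
    and "almost_geodesic 1 C \<alpha> a b" "almost_geodesic 1 C \<beta> c d" "almost_geodesic 1 C \<gamma> m n"
    and "\<alpha> b = \<beta> c" "\<beta> d = \<gamma> m" "\<gamma> n = \<alpha> a"
  obtains (ball) s t u where "s \<in> {a..b}" "t \<in> {c..d}" "u \<in> {m..n}"
      "dist (\<alpha> s) (\<beta> t) \<le> 2 * \<sigma>" "dist (\<beta> t) (\<gamma> u) \<le> 2 * \<sigma>" "dist (\<gamma> u) (\<alpha> s) \<le> 2 * \<sigma>"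
    | (piece) P x1 y1 x2 y2 x3 y3 where "P \<in> \<P>" "x1 \<in> {a..b}" "y1 \<in> {a..b}" "x2 \<in> {c..d}" "y2 \<in> {c..d}"
      "x3 \<in> {m..n}" "y3 \<in> {m..n}" "\<alpha> x1 \<in> nbhd \<sigma> P" "\<alpha> y1 \<in> nbhd \<sigma> P" "\<beta> x2 \<in> nbhd \<sigma> P" "\<beta> y2 \<in> nbhd \<sigma> P"
      "\<gamma> x3 \<in> nbhd \<sigma> P" "\<gamma> y3 \<in> nbhd \<sigma> P"
      "dist (\<alpha> y1) (\<beta> x2) \<le> \<delta>" "dist (\<beta> y2) (\<gamma> x3) \<le> \<delta>" "dist (\<gamma> y3) (\<alpha> x1) \<le> \<delta>"
proof -
  have "almost_geodesic 1 C \<alpha> a b \<and> almost_geodesic 1 C \<beta> c d \<and> almost_geodesic 1 C \<gamma> m n \<and>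
     \<alpha> b = \<beta> c \<and> \<beta> d = \<gamma> m \<and> \<gamma> n = \<alpha> a" using assms(2-) by simp
  from assms(1)[unfolded tree_graded_triangles_def, rule_format, OF this] show ?thesis
    by - (elim disjE bexE conjE; (rule ball; assumption | rule piece; assumption))
qed

text \<open>Going through a short first segment costs at most twice its length.\<close>

lemma join_almost_geodesic:
  assumes g: "geodesic g a b" and h: "geodesic h b c" and e: "g b = h b" and c: "b - a \<le> c0"
  shows "almost_geodesic 1 (2 * c0) (\<lambda>t. if t \<le> b then g t else h t) a c"
proof -
  define f where "f = (\<lambda>t. if t \<le> b then g t else h t)"
  have ab: "a \<le> b" "b \<le> c" using g h by (auto simp: geodesic_def)
  have le: "dist (f s) (f t) \<le> t - s \<and> t - s - 2 * c0 \<le> dist (f s) (f t)"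
    if "s \<in> {a..c}" "t \<in> {a..c}" "s \<le> t" for s t
  proof -
    consider "t \<le> b" | "b < s" | "s \<le> b" "b < t" by linarith
    then show ?thesis
    proof cases
      case 1 then show ?thesis using that geodesic_dist[OF g, of s t] ab c by (auto simp: f_def)
    next
      case 2 then show ?thesis using that geodesic_dist[OF h, of s t] ab c by (auto simp: f_def)
    next
      case 3
      then have "dist (f s) (g b) = b - s" "dist (g b) (f t) = t - b"
        using that geodesic_dist[OF g, of s b] geodesic_dist[OF h, of b t] ab e by (auto simp: f_def)
      then show ?thesis using dist_triangle[of "f s" "f t" "g b"] dist_triangle3[of "g b" "f t" "f s"] c that by auto
    qed
  qed
  have both: "dist (f s) (f t) \<le> \<bar>s - t\<bar> \<and> \<bar>s - t\<bar> - 2 * c0 \<le> dist (f s) (f t)"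
    if "s \<in> {a..c}" "t \<in> {a..c}" for s t
    using le[OF that] le[OF that(2,1)] by (cases "s \<le> t") (auto simp: dist_commute)
  then have "continuous_on {a..c} f"
    unfolding continuous_on_iff by (metis abs_minus_commute dist_real_def le_less_trans)
  moreover have "0 \<le> c0" using ab c by simp
  then have "quasi_geodesic 1 (2 * c0) f a c"
    unfolding quasi_geodesic_def using both ab by fastforce
  ultimately show ?thesis by (simp add: almost_geodesic_def f_def)
qed

context peripheral
begin

text \<open>In the triangle with vertices \<open>x\<close>, \<open>e\<close>, \<open>e'\<close> the side between the gates runs along \<open>P\<close>. A ball meeting all
  sides meets the access paths near \<open>P\<close>, hence near the gates. The same holds if \<open>P\<close> is the
  piece met by all sides, while another piece stays near the middle side only for a bounded
  distance, so that its exit and entrance points on the access paths are near \<open>P\<close> and close to each other.\<close>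

lemma tree_graded_coarse_gates:
  assumes tg: "tree_graded_triangles \<P> 0 \<sigma> \<delta>"
  shows "coarse_gates \<P> \<mu>"
  unfolding coarse_gates_def
proof (intro allI impI)
  fix \<kappa> assume \<kappa>: "\<mu> \<le> \<kappa>"
  obtain k where k: "\<kappa> \<le> k" and hull: "\<And>P g a b t. \<lbrakk>P \<in> \<P>; geodesic g a b; g a \<in> nbhd \<kappa> P; g b \<in> nbhd \<kappa> P;
      t \<in> {a..b}\<rbrakk> \<Longrightarrow> g t \<in> nbhd k P"
    by (rule hull[of \<kappa>]) blast
  define k' where "k' = max (max k \<sigma>) (max (k + 2 * \<sigma>) (k + \<delta>))"
  have k': "k \<le> k'" "\<sigma> \<le> k'" "k + 2 * \<sigma> \<le> k'" "k + \<delta> \<le> k'" by (auto simp: k'_def)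
  obtain B where B0: "0 \<le> B" and B: "\<And>P Q x y. \<lbrakk>P \<in> \<P>; Q \<in> \<P>; P \<noteq> Q; x \<in> nbhd k' P; x \<in> nbhd k' Q;
     y \<in> nbhd k' P; y \<in> nbhd k' Q\<rbrakk> \<Longrightarrow> dist x y \<le> B"
    by (rule intersection_bound[of k']) blast
  obtain G where G0: "0 \<le> G" and G: "\<And>P x e g a b t. \<lbrakk>P \<in> \<P>; access \<kappa> P x e g a b; t \<in> {a..b};
     g t \<in> nbhd k' P\<rbrakk> \<Longrightarrow> dist (g t) e \<le> G"
    by (rule access_bound[OF \<kappa>, of k']) blast
  have "dist e e' \<le> 2 * G + B + 2 * \<bar>\<sigma>\<bar> + 2 * \<bar>\<delta>\<bar>"
    if P: "P \<in> \<P>" and e: "gate \<kappa> P x e" "gate \<kappa> P x e'" for P x e e'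
  proof -
    obtain f a b f' a' b' where f: "access \<kappa> P x e f a b" "access \<kappa> P x e' f' a' b'" using e by (auto simp: gate_def)
    obtain i p q where "geodesic_from_to e e' i p q" by (rule obtain_geodesic[OF geod]) blast
    then have i: "geodesic i p q" "i p = e" "i q = e'" by (auto simp: geodesic_from_to_def)
    have ff: "geodesic f a b" "f a = x" "f b = e" "geodesic f' a' b'" "f' a' = x" "f' b' = e'"
      using f by (auto simp: access_def geodesic_from_to_def)
    have ik: "i t \<in> nbhd k P" if "t \<in> {p..q}" for t
      by (rule hull[OF P i(1) _ _ that]) (use i gate_nbhd[OF e(1)] gate_nbhd[OF e(2)] in auto)
    define h where "h = (\<lambda>t. f' (-t))"
    have ag: "almost_geodesic 1 0 f a b" "almost_geodesic 1 0 i p q" "almost_geodesic 1 0 h (-b') (-a')"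
      unfolding h_def using ff i by (auto intro: geodesic_almost_geodesic geodesic_rev)
    have v: "f b = i p" "i q = h (-b')" "h (-a') = f a" using ff i by (auto simp: h_def)
    show ?thesis
    proof (rule tree_graded_triangles_cases[OF tg ag v])
      fix s t u
      assume ball: "s \<in> {a..b}" "t \<in> {p..q}" "u \<in> {-b'..-a'}"
        "dist (f s) (i t) \<le> 2 * \<sigma>" "dist (i t) (h u) \<le> 2 * \<sigma>" "dist (h u) (f s) \<le> 2 * \<sigma>"
      have "f s \<in> nbhd k' P" using nbhd_mono[OF nbhd_dist[OF ik[OF ball(2)]] k'(3)] ball(4) by (simp add: dist_commute)
      then have 1: "dist (f s) e \<le> G" by (rule G[OF P f(1) ball(1)])
      have "h u \<in> nbhd k' P" using nbhd_mono[OF nbhd_dist[OF ik[OF ball(2)]] k'(3)] ball(5) by simp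
      then have 2: "dist (h u) e' \<le> G" using G[OF P f(2), of "-u"] ball(3) by (auto simp: h_def)
      show ?thesis using 1 2 ball(6) dist_triangle3[of e e' "f s"] dist_triangle[of "f s" e' "h u"] B0
        by (simp add: dist_commute)
    next
      fix Q x1 y1 x2 y2 x3 y3
      assume piece: "Q \<in> \<P>" "x1 \<in> {a..b}" "y1 \<in> {a..b}" "x2 \<in> {p..q}" "y2 \<in> {p..q}"
        "x3 \<in> {-b'..-a'}" "y3 \<in> {-b'..-a'}" "f x1 \<in> nbhd \<sigma> Q" "i x2 \<in> nbhd \<sigma> Q" "i y2 \<in> nbhd \<sigma> Q" "h y3 \<in> nbhd \<sigma> Q"
        "dist (f y1) (i x2) \<le> \<delta>" "dist (i y2) (h x3) \<le> \<delta>" "dist (h y3) (f x1) \<le> \<delta>"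
      show ?thesis
      proof (cases "Q = P")
        case True
        have 1: "dist (f x1) e \<le> G" using G[OF P f(1) piece(2)] nbhd_mono[OF piece(8) k'(2)] True by simp
        have 2: "dist (h y3) e' \<le> G" using G[OF P f(2), of "-y3"] nbhd_mono[OF piece(11) k'(2)] True piece(7)
          by (auto simp: h_def)
        show ?thesis using 1 2 piece(14) dist_triangle3[of e e' "f x1"] dist_triangle[of "f x1" e' "h y3"] B0
          by (simp add: dist_commute)
      next
        case False
        have "dist (i x2) (i y2) \<le> B"
          by (rule B[OF P piece(1)])
            (use False nbhd_mono[OF ik k'(1)] nbhd_mono[OF piece(9) k'(2)] nbhd_mono[OF piece(10) k'(2)] piece(4,5) in auto)
        moreover have "f y1 \<in> nbhd k' P" using nbhd_mono[OF nbhd_dist[OF ik[OF piece(4)]] k'(4)] piece(12)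
          by (simp add: dist_commute)
        then have "dist (f y1) e \<le> G" by (rule G[OF P f(1) piece(3)])
        moreover have "h x3 \<in> nbhd k' P" using nbhd_mono[OF nbhd_dist[OF ik[OF piece(5)]] k'(4)] piece(13) by simp
        then have "dist (h x3) e' \<le> G" using G[OF P f(2), of "-x3"] piece(6) by (auto simp: h_def)
        ultimately show ?thesis
          using piece(12,13) dist_triangle3[of e e' "f y1"] dist_triangle[of "f y1" e' "i x2"]
            dist_triangle[of "i x2" e' "i y2"] dist_triangle[of "i y2" e' "h x3"] by (simp add: dist_commute)
      qed
    qed
  qed
  then show "\<exists>\<delta>. \<forall>P\<in>\<P>. \<forall>x e e'. gate \<kappa> P x e \<and> gate \<kappa> P x e' \<longrightarrow> dist e e' \<le> \<delta>" by blast
qed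

text \<open>Regard the two halves of \<open>\<alpha>\<close> cut at \<open>\<alpha> t\<close> as two sides of a triangle with third side
  \<open>\<beta>\<close>. A ball meeting both halves is near \<open>\<alpha> t\<close>. If all sides meet a piece, then \<open>\<alpha> t\<close> lies
  between two points near that piece, each close to \<open>\<beta>\<close>, and transience puts it within \<open>R\<close> of
  one of them; for this, points of \<open>N\<^sub>\<sigma>(P)\<close> have to be points of \<open>N\<^sub>\<mu>(P)\<close>.\<close>

lemma transient_near_almost_geodesic:
  assumes tg: "tree_graded_triangles \<P> C \<sigma> \<delta>" and C: "0 \<le> C" and \<sigma>: "\<sigma> \<le> \<mu>"
    and \<alpha>: "geodesic \<alpha> a b" and t: "t \<in> {a..b}" "\<alpha> t \<in> Trans \<alpha> a b"
    and \<beta>: "almost_geodesic 1 C \<beta> c d" "\<beta> c = \<alpha> b" "\<beta> d = \<alpha> a"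
  shows "\<exists>r\<in>{c..d}. dist (\<alpha> t) (\<beta> r) \<le> 4 * \<bar>\<sigma>\<bar> + \<bar>\<delta>\<bar> + R"
proof -
  have ag: "almost_geodesic 1 C \<alpha> a t" "almost_geodesic 1 C \<alpha> t b"
    using geodesic_almost_geodesic[OF \<alpha> C] t(1) by (auto intro: almost_geodesic_sub)
  show ?thesis
  proof (rule tree_graded_triangles_cases[OF tg ag \<beta>(1) refl \<beta>(2)[symmetric] \<beta>(3)])
    fix s s' u
    assume ball: "s \<in> {a..t}" "s' \<in> {t..b}" "u \<in> {c..d}" "dist (\<alpha> s) (\<alpha> s') \<le> 2 * \<sigma>" "dist (\<beta> u) (\<alpha> s) \<le> 2 * \<sigma>"
    have "dist (\<alpha> t) (\<alpha> s) \<le> dist (\<alpha> s) (\<alpha> s')"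
      using geodesic_dist[OF \<alpha>, of t s] geodesic_dist[OF \<alpha>, of s s'] ball(1,2) t(1) by auto
    then have "dist (\<alpha> t) (\<beta> u) \<le> 4 * \<bar>\<sigma>\<bar> + \<bar>\<delta>\<bar> + R"
      using ball(4,5) dist_triangle[of "\<alpha> t" "\<beta> u" "\<alpha> s"] R_pos by (simp add: dist_commute)
    then show ?thesis using ball(3) by blast
  next
    fix P x1 y2 x3 y3
    assume piece: "P \<in> \<P>" "x1 \<in> {a..t}" "y2 \<in> {t..b}" "x3 \<in> {c..d}" "y3 \<in> {c..d}"
      "\<alpha> x1 \<in> nbhd \<sigma> P" "\<alpha> y2 \<in> nbhd \<sigma> P" "dist (\<alpha> y2) (\<beta> x3) \<le> \<delta>" "dist (\<beta> y3) (\<alpha> x1) \<le> \<delta>"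
    have "\<not> (a \<le> x1 \<and> x1 < t - R \<and> t + R < y2 \<and> y2 \<le> b \<and> (\<exists>P\<in>\<P>. \<alpha> x1 \<in> nbhd \<mu> P \<and> \<alpha> y2 \<in> nbhd \<mu> P))"
      using t(2) trans_points_iff[OF \<alpha> t(1), of R \<P> \<mu>] R_pos by auto
    then consider "t - x1 \<le> R" | "y2 - t \<le> R"
      using piece nbhd_mono[OF piece(6) \<sigma>] nbhd_mono[OF piece(7) \<sigma>] by force
    then show ?thesis
    proof cases
      case 1
      then have "dist (\<alpha> t) (\<alpha> x1) \<le> R" using geodesic_dist[OF \<alpha> t(1), of x1] piece(2) t(1) by auto
      then have "dist (\<alpha> t) (\<beta> y3) \<le> 4 * \<bar>\<sigma>\<bar> + \<bar>\<delta>\<bar> + R"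
        using piece(9) dist_triangle[of "\<alpha> t" "\<beta> y3" "\<alpha> x1"] by (simp add: dist_commute)
      then show ?thesis using piece(5) by blast
    next
      case 2
      then have "dist (\<alpha> t) (\<alpha> y2) \<le> R" using geodesic_dist[OF \<alpha> t(1), of y2] piece(3) t(1) by auto
      then have "dist (\<alpha> t) (\<beta> x3) \<le> 4 * \<bar>\<sigma>\<bar> + \<bar>\<delta>\<bar> + R"
        using piece(8) dist_triangle[of "\<alpha> t" "\<beta> x3" "\<alpha> y2"] by simp
      then show ?thesis using piece(4) by blast
    qed
  qed
qed

text \<open>Attaching a short segment from the end of \<open>\<alpha>\<close> to the start of \<open>f\<close> turns \<open>f\<close> into an almost-geodesic
  with the ends of \<open>\<alpha>\<close>.\<close>

lemma transient_near_fellow_geodesic: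
  assumes tg: "tree_graded_triangles \<P> (2 * c) \<sigma> \<delta>" and c: "0 \<le> c" and \<sigma>: "\<sigma> \<le> \<mu>"
    and \<alpha>: "geodesic \<alpha> a b" and t: "t \<in> {a..b}" "\<alpha> t \<in> Trans \<alpha> a b"
    and f: "geodesic f m n" "f n = \<alpha> a" and close: "dist (\<alpha> b) (f m) \<le> c"
  shows "\<exists>r\<in>{m..n}. dist (\<alpha> t) (f r) \<le> 4 * \<bar>\<sigma>\<bar> + \<bar>\<delta>\<bar> + R + c"
proof -
  obtain j l l' where j: "geodesic_from_to (\<alpha> b) (f m) j l l'" "l' - l = dist (\<alpha> b) (f m)"
    by (rule obtain_geodesic[OF geod]) blast
  define i where "i = (\<lambda>r. j (r - m + l'))"
  \<comment> \<open>The parametrization of the short segment is shifted so that it ends where \<open>f\<close> starts.\<close>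
  define k where "k = m - (l' - l)"
  have jj: "geodesic j l l'" "j l = \<alpha> b" "j l' = f m" "l \<le> l'" using j by (auto simp: geodesic_from_to_def geodesic_def)
  have i: "geodesic i k m" "i k = \<alpha> b" "i m = f m"
    using jj unfolding geodesic_def by (auto simp: i_def k_def)
  define \<beta> where "\<beta> = (\<lambda>r. if r \<le> m then i r else f r)"
  have mk: "m - k \<le> c" "k \<le> m" "m \<le> n" using j(2) close jj f(1) by (auto simp: k_def geodesic_def)
  have "almost_geodesic 1 (2 * c) \<beta> k n" unfolding \<beta>_def by (rule join_almost_geodesic[OF i(1) f(1) i(3) mk(1)])
  moreover have "\<beta> k = \<alpha> b" using i mk by (simp add: \<beta>_def)
  moreover have "\<beta> n = \<alpha> a" using i f mk by (auto simp: \<beta>_def)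
  ultimately obtain r where r: "r \<in> {k..n}" "dist (\<alpha> t) (\<beta> r) \<le> 4 * \<bar>\<sigma>\<bar> + \<bar>\<delta>\<bar> + R"
    using transient_near_almost_geodesic[OF tg _ \<sigma> \<alpha> t] c by fastforce
  show ?thesis
  proof (cases "r \<le> m")
    case True
    have "dist (\<beta> r) (f m) \<le> c" using geodesic_dist[OF i(1), of r m] r True mk i(3) by (auto simp: \<beta>_def)
    then have "dist (\<alpha> t) (f m) \<le> 4 * \<bar>\<sigma>\<bar> + \<bar>\<delta>\<bar> + R + c"
      using r(2) dist_triangle[of "\<alpha> t" "f m" "\<beta> r"] by simp
    then show ?thesis using mk by (intro bexI[of _ m]) auto
  next
    case False
    then have "dist (\<alpha> t) (f r) \<le> 4 * \<bar>\<sigma>\<bar> + \<bar>\<delta>\<bar> + R + c" using r(2) c by (simp add: \<beta>_def)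
    then show ?thesis using r False by (intro bexI[of _ r]) auto
  qed
qed

text \<open>Tree-gradedness gives one or two points on the first side close to the adjacent sides. Between two such
  points, which are near a common piece, transient points are close to one of them. The rest of the first side
  fellow-travels the adjacent sides, up to a gap \<open>c\<close> that depends only on the
  constants of geodesic triangles. So \<open>\<mu>\<close> can be chosen after \<open>\<sigma>1\<close> and before \<open>R\<close>.\<close>

lemma tree_graded_weakly_thin:
  assumes tg0: "tree_graded_triangles \<P> 0 \<sigma>0 \<delta>0" and \<sigma>0: "\<sigma>0 \<le> \<mu>"
    and c: "0 \<le> c" "2 * \<sigma>0 \<le> c" "\<delta>0 \<le> c"
    and tg1: "tree_graded_triangles \<P> (2 * c) \<sigma>1 \<delta>1" and \<sigma>1: "\<sigma>1 \<le> \<mu>"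
  shows "weakly_thin \<P> \<mu> R"
proof -
  define D where "D = 4 * \<bar>\<sigma>1\<bar> + \<bar>\<delta>1\<bar> + R + c"
  have "\<exists>q\<in>h ` {k..l} \<union> f ` {m..n}. dist p q \<le> D"
    if g: "geodesic_from_to x y g a b" and h: "geodesic_from_to y z h k l" and f: "geodesic_from_to x z f m n"
      and p: "p \<in> Trans g a b" for x y z g a b h k l f m n p
  proof -
    have gg: "geodesic g a b" "g a = x" "g b = y" and hh: "geodesic h k l" "h k = y" "h l = z"
      and ff: "geodesic f m n" "f m = x" "f n = z"
      using g h f by (auto simp: geodesic_from_to_def)
    obtain t where t: "t \<in> {a..b}" "p = g t" using p trans_points_image[of \<P> \<mu> R g a b] by blast
    have left: "\<exists>q\<in>f ` {m..n}. dist p q \<le> D"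
      if s: "s \<in> {a..b}" "t \<le> s" and v: "v \<in> {m..n}" "dist (g s) (f v) \<le> c" for s v
    proof -
      have "geodesic (\<lambda>r. f (-r)) (-v) (-m)" by (rule geodesic_rev, rule geodesic_sub[OF ff(1)]) (use v in auto)
      then have "\<exists>r\<in>{-v..-m}. dist (g t) (f (-r)) \<le> D" unfolding D_def
        by (intro transient_near_fellow_geodesic[OF tg1 c(1) \<sigma>1 geodesic_sub[OF gg(1), of a s]])
          (use s t v gg ff p R_pos trans_points_sub[OF gg(1), of R a s t \<P> \<mu>] in auto)
      then obtain r where "r \<in> {-v..-m}" "dist (g t) (f (-r)) \<le> D" by blast
      then show ?thesis using v t by (intro bexI[of _ "f (-r)"]) auto
    qed
    have right: "\<exists>q\<in>h ` {k..l}. dist p q \<le> D"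
      if s: "s \<in> {a..b}" "s \<le> t" and v: "v \<in> {k..l}" "dist (g s) (h v) \<le> c" for s v
    proof -
      define g' where "g' = (\<lambda>r. g (-r))"
      have g': "geodesic g' (-b) (-s)" unfolding g'_def
        by (rule geodesic_rev, rule geodesic_sub[OF gg(1)]) (use s in auto)
      have tT: "g' (-t) \<in> Trans g' (-b) (-s)"
        using trans_points_sub[OF gg(1), of R s b t \<P> \<mu>] s t p R_pos
        by (auto simp: g'_def trans_points_rev)
      have "geodesic (\<lambda>r. h (-r)) (-v) (-k)" by (rule geodesic_rev, rule geodesic_sub[OF hh(1)]) (use v in auto)
      then have "\<exists>r\<in>{-v..-k}. dist (g' (-t)) (h (-r)) \<le> D" unfolding D_def
        by (intro transient_near_fellow_geodesic[OF tg1 c(1) \<sigma>1 g' _ tT])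
          (use s t v gg hh in \<open>auto simp: g'_def\<close>)
      then obtain r where "r \<in> {-v..-k}" "dist (g t) (h (-r)) \<le> D" by (auto simp: g'_def)
      then show ?thesis using v t by (intro bexI[of _ "h (-r)"]) auto
    qed
    define f' where "f' = (\<lambda>r. f (-r))"
    have ag: "almost_geodesic 1 0 g a b" "almost_geodesic 1 0 h k l" "almost_geodesic 1 0 f' (-n) (-m)"
      unfolding f'_def using gg hh ff by (auto intro: geodesic_almost_geodesic geodesic_rev)
    have v: "g b = h k" "h l = f' (-n)" "f' (-m) = g a" using gg hh ff by (auto simp: f'_def)
    show ?thesis
    proof (rule tree_graded_triangles_cases[OF tg0 ag v])
      fix s v u
      assume ball: "s \<in> {a..b}" "v \<in> {k..l}" "u \<in> {-n..-m}" "dist (g s) (h v) \<le> 2 * \<sigma>0" "dist (f' u) (g s) \<le> 2 * \<sigma>0"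
      show ?thesis
      proof (cases "t \<le> s")
        case True
        have "\<exists>q\<in>f ` {m..n}. dist p q \<le> D"
          by (rule left[OF ball(1) True, of "-u"]) (use ball c in \<open>auto simp: f'_def dist_commute\<close>)
        then show ?thesis by blast
      next
        case False
        have "\<exists>q\<in>h ` {k..l}. dist p q \<le> D"
          by (rule right[OF ball(1) _ ball(2)]) (use ball c False in auto)
        then show ?thesis by blast
      qed
    next
      fix P x1 y1 x2 y3
      assume piece: "P \<in> \<P>" "x1 \<in> {a..b}" "y1 \<in> {a..b}" "x2 \<in> {k..l}" "y3 \<in> {-n..-m}"
        "g x1 \<in> nbhd \<sigma>0 P" "g y1 \<in> nbhd \<sigma>0 P" "dist (g y1) (h x2) \<le> \<delta>0" "dist (f' y3) (g x1) \<le> \<delta>0"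
      have y3: "-y3 \<in> {m..n}" "dist (g x1) (f (-y3)) \<le> c" using piece(5,9) c by (auto simp: f'_def dist_commute)
      have x2: "dist (g y1) (h x2) \<le> c" using piece(8) c by simp
      have "\<not> (a \<le> x1 \<and> x1 < t - R \<and> t + R < y1 \<and> y1 \<le> b \<and> (\<exists>P\<in>\<P>. g x1 \<in> nbhd \<mu> P \<and> g y1 \<in> nbhd \<mu> P))"
        using p t trans_points_iff[OF gg(1) t(1), of R \<P> \<mu>] R_pos by auto
      then have "t \<le> x1 + R \<or> y1 \<le> t + R"
        using piece nbhd_mono[OF piece(6) \<sigma>0] nbhd_mono[OF piece(7) \<sigma>0] by force
      then consider "t \<le> x1" | "y1 \<le> t" | "x1 \<le> t" "t \<le> x1 + R" | "t \<le> y1" "y1 \<le> t + R" by linarith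
      then show ?thesis
      proof cases
        case 1 then show ?thesis using left[OF piece(2) _ y3] by blast
      next
        case 2 then show ?thesis using right[OF piece(3) _ piece(4) x2] by blast
      next
        case 3
        then have "dist p (g x1) \<le> R" using geodesic_dist[OF gg(1) t(1) piece(2)] t by auto
        then have "dist p (f (-y3)) \<le> D" using y3(2) dist_triangle[of p "f (-y3)" "g x1"] by (simp add: D_def)
        then show ?thesis using y3(1) by blast
      next
        case 4
        then have "dist p (g y1) \<le> R" using geodesic_dist[OF gg(1) t(1) piece(3)] t by auto
        then have "dist p (h x2) \<le> D" using x2 dist_triangle[of p "h x2" "g y1"] by (simp add: D_def)
        then show ?thesis using piece(4) by blast
      qed
    qed
  qed
  note near = this
  show ?thesis unfolding weakly_thin_def
    by (intro exI[of _ D] allI impI ballI; elim conjE; rule near)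
qed

end

section \<open>The equivalence\<close>

text \<open>Trimming a long excursion by one unit on both sides leaves a geodesic whose ends are close to
  \<open>P\<close> relative to its length but which avoids \<open>N\<^sub>\<mu>(P)\<close>.\<close>

lemma alpha2_bounded_excursions:
  assumes "0 < \<epsilon>" "M \<le> \<mu>"
    and near: "\<And>P x y g a b. \<lbrakk>P \<in> \<P>; x \<in> nbhd (\<epsilon> * dist x y) P; y \<in> nbhd (\<epsilon> * dist x y) P; geodesic_from_to x y g a b\<rbrakk>
      \<Longrightarrow> g ` {a..b} \<inter> nbhd M P \<noteq> {}"
  shows "bounded_excursions \<P> \<mu>"
  unfolding bounded_excursions_def
proof (intro allI)
  fix k
  define K where "K = 2 + (\<bar>k\<bar> + 1) / \<epsilon>"
  have "b - a \<le> K"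
    if P: "P \<in> \<P>" and g: "geodesic g a b" "g a \<in> nbhd k P" "g b \<in> nbhd k P"
      and out: "\<And>t. t\<in>{a<..<b} \<Longrightarrow> g t \<notin> nbhd \<mu> P" for P g a b
  proof (rule ccontr)
    assume "\<not> ?thesis"
    then have long: "(\<bar>k\<bar> + 1) / \<epsilon> < b - a - 2" by (simp add: K_def)
    then have "0 < b - a - 2" using assms(1) by (smt (verit) divide_nonneg_pos)
    then have d: "dist (g a) (g (a + 1)) = 1" "dist (g b) (g (b - 1)) = 1" "dist (g (a + 1)) (g (b - 1)) = b - a - 2"
      using geodesic_dist[OF g(1)] by auto
    have le: "k + 1 \<le> \<epsilon> * (b - a - 2)" using long assms(1) by (simp add: field_simps)
    have "g (a + 1) \<in> nbhd (\<epsilon> * dist (g (a + 1)) (g (b - 1))) P" "g (b - 1) \<in> nbhd (\<epsilon> * dist (g (a + 1)) (g (b - 1))) P"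
      using nbhd_mono[OF nbhd_dist[OF g(2), of "g (a + 1)" 1] le] nbhd_mono[OF nbhd_dist[OF g(3), of "g (b - 1)" 1] le] d
      by auto
    moreover have "geodesic_from_to (g (a + 1)) (g (b - 1)) g (a + 1) (b - 1)"
      using geodesic_sub[OF g(1)] \<open>0 < b - a - 2\<close> by (auto simp: geodesic_from_to_def)
    ultimately have "g ` {a + 1..b - 1} \<inter> nbhd M P \<noteq> {}" by (rule near[OF P])
    then obtain t where "t \<in> {a + 1..b - 1}" "g t \<in> nbhd M P" by blast
    then show False using out[of t] nbhd_mono[OF _ assms(2)] by auto
  qed
  then show "\<exists>K. \<forall>P\<in>\<P>. \<forall>g a b. geodesic g a b \<and> g a \<in> nbhd k P \<and> g b \<in> nbhd k P \<and>
     (\<forall>t\<in>{a<..<b}. g t \<notin> nbhd \<mu> P) \<longrightarrow> b - a \<le> K" by blast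
qed

lemma alpha1_intersections:
  assumes "alpha1 \<P>"
  shows "\<exists>B. \<forall>P\<in>\<P>. \<forall>Q\<in>\<P>. P \<noteq> Q \<longrightarrow>
        (\<forall>x\<in>nbhd k P \<inter> nbhd k Q. \<forall>y\<in>nbhd k P \<inter> nbhd k Q. dist x y \<le> B)"
proof -
  obtain B where B: "\<forall>P\<in>\<P>. \<forall>Q\<in>\<P>. P \<noteq> Q \<longrightarrow>
     bounded (nbhd k P \<inter> nbhd k Q) \<and> diameter (nbhd k P \<inter> nbhd k Q) \<le> B"
    using assms[unfolded alpha1_def, rule_format, of k] ..
  show ?thesis
  proof (intro exI[of _ B] ballI impI)
    fix P Q x y
    assume PQ: "P \<in> \<P>" "Q \<in> \<P>" "P \<noteq> Q" and xy: "x \<in> nbhd k P \<inter> nbhd k Q" "y \<in> nbhd k P \<inter> nbhd k Q"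
    have b: "bounded (nbhd k P \<inter> nbhd k Q)" "diameter (nbhd k P \<inter> nbhd k Q) \<le> B" using B PQ by auto
    show "dist x y \<le> B" using diameter_bounded_bound[OF b(1) xy] b(2) by simp
  qed
qed

lemma peripheral_for_large_radius:
  fixes \<P> :: "'a::metric_space set set"
  assumes geod: "geodesic_metric_space TYPE('a)" and a1: "alpha1 \<P>" and ex: "bounded_excursions \<P> \<mu>"
  obtains \<mu>' R1 where "0 < R1" "\<And>R. R1 \<le> R \<Longrightarrow> peripheral \<P> \<mu> \<mu>' R"
proof -
  obtain \<mu>' where hull: "\<And>P g a b t. \<lbrakk>P \<in> \<P>; geodesic g a b; g a \<in> nbhd \<mu> P; g b \<in> nbhd \<mu> P; t \<in> {a..b}\<rbrakk>
      \<Longrightarrow> g t \<in> nbhd \<mu>' P"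
    by (rule bounded_excursions_hull[OF ex, of \<mu>]) blast
  obtain B where B: "\<forall>P\<in>\<P>. \<forall>Q\<in>\<P>. P \<noteq> Q \<longrightarrow>
        (\<forall>x\<in>nbhd \<mu>' P \<inter> nbhd \<mu>' Q. \<forall>y\<in>nbhd \<mu>' P \<inter> nbhd \<mu>' Q. dist x y \<le> B)"
    using alpha1_intersections[OF a1] ..
  have "peripheral \<P> \<mu> \<mu>' R" if R: "\<bar>B\<bar> + 1 \<le> R" for R
  proof
    show "geodesic_metric_space TYPE('a)" by (rule geod)
    show "0 < R" using R by simp
    show "\<exists>B. \<forall>P\<in>\<P>. \<forall>Q\<in>\<P>. P \<noteq> Q \<longrightarrow>
        (\<forall>x\<in>nbhd k P \<inter> nbhd k Q. \<forall>y\<in>nbhd k P \<inter> nbhd k Q. dist x y \<le> B)" for k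
      by (rule alpha1_intersections[OF a1])
    show "bounded_excursions \<P> \<mu>" by (rule ex)
    show "g t \<in> nbhd \<mu>' P" if "P \<in> \<P>" "geodesic g a b" "g a \<in> nbhd \<mu> P" "g b \<in> nbhd \<mu> P" "t \<in> {a..b}" for P g a b t
      by (rule hull[OF that])
    show "dist x y < R" if "P \<in> \<P>" "Q \<in> \<P>" "P \<noteq> Q" "x \<in> nbhd \<mu>' P" "x \<in> nbhd \<mu>' Q" "y \<in> nbhd \<mu>' P" "y \<in> nbhd \<mu>' Q"
      for P Q x y
    proof -
      have "dist x y \<le> B" using B that by blast
      then show ?thesis using R by simp
    qed
  qed
  then show ?thesis using that[of "\<bar>B\<bar> + 1" \<mu>'] by auto
qed

text \<open>The ends condition and the thinness condition of the equivalence for a single radius, so that each can be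
  derived and used at a fixed \<open>R\<close>.\<close>

definition transient_ends_condition :: "'a::metric_space set set \<Rightarrow> real \<Rightarrow> real \<Rightarrow> bool" where
  "transient_ends_condition \<P> \<mu> R \<longleftrightarrow> (\<forall>k. \<exists>K. \<forall>x y. \<forall>P\<in>\<P>.
         P \<noteq> {} \<and> infdist x P + infdist y P \<le> k \<and> dist x y \<ge> K \<longrightarrow>
         (\<forall>g a b. geodesic_from_to x y g a b \<longrightarrow>
            trans_points \<P> \<mu> R g a b \<subseteq> cball x K \<union> cball y K \<and>
            (\<exists>z. z \<in> trans_points \<P> \<mu> R g a b \<inter> nbhd \<mu> P)))"

definition transient_thin_condition :: "'a::metric_space set set \<Rightarrow> real \<Rightarrow> real \<Rightarrow> bool" where
  "transient_thin_condition \<P> \<mu> R \<longleftrightarrow> (\<exists>D. \<forall>\<gamma> a b.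
         cyclic_triangle \<gamma> a b \<and> (\<forall>i<3. geodesic (\<gamma> i) (a i) (b i)) \<longrightarrow>
         trans_points \<P> \<mu> R (\<gamma> 0) (a 0) (b 0) \<subseteq>
           nbhd D (trans_points \<P> \<mu> R (\<gamma> 1) (a 1) (b 1) \<union>
                   trans_points \<P> \<mu> R (\<gamma> 2) (a 2) (b 2)))"

text \<open>The order in which constants are chosen matters: geodesic triangles determine the gap \<open>c\<close>, this determines
  the almost-geodesic constant \<open>2 * c\<close>, and only then is \<open>\<mu>\<close> fixed above all of the tree-graded radii.\<close>

lemma hyperbolic_imp_transient_conditions:
  fixes \<P> :: "'a::metric_space set set"
  assumes geod: "geodesic_metric_space TYPE('a)" and hyp: "hyperbolic_relative_to \<P>"
  obtains \<mu> R0 where "0 \<le> \<mu>" "0 \<le> R0"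
    "\<And>R. R0 \<le> R \<Longrightarrow> transient_ends_condition \<P> \<mu> R \<and> transient_thin_condition \<P> \<mu> R"
proof -
  have a1: "alpha1 \<P>" and a2: "alpha2 \<P>" and tg: "asymptotically_tree_graded \<P>"
    using hyp by (auto simp: hyperbolic_relative_to_def)
  obtain \<epsilon> M where \<epsilon>: "0 < \<epsilon>" and near: "\<And>P x y g a b. \<lbrakk>P \<in> \<P>; x \<in> nbhd (\<epsilon> * dist x y) P; y \<in> nbhd (\<epsilon> * dist x y) P;
      geodesic_from_to x y g a b\<rbrakk> \<Longrightarrow> g ` {a..b} \<inter> nbhd M P \<noteq> {}"
    using a2 unfolding alpha2_def by metis
  obtain \<sigma>0 \<delta>0 where tg0: "tree_graded_triangles \<P> 0 \<sigma>0 \<delta>0" by (rule asymptotically_tree_gradedD[OF tg order_refl])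
  define c where "c = max 0 (max (2 * \<sigma>0) \<delta>0)"
  have c: "0 \<le> c" "2 * \<sigma>0 \<le> c" "\<delta>0 \<le> c" by (auto simp: c_def)
  obtain \<sigma>1 \<delta>1 where tg1: "tree_graded_triangles \<P> (2 * c) \<sigma>1 \<delta>1"
    by (rule asymptotically_tree_gradedD[OF tg, of "2 * c"]) (use c in auto)
  define \<mu> where "\<mu> = max (max 0 M) (max \<sigma>0 \<sigma>1)"
  have \<mu>: "0 \<le> \<mu>" "M \<le> \<mu>" "\<sigma>0 \<le> \<mu>" "\<sigma>1 \<le> \<mu>" by (auto simp: \<mu>_def)
  have ex: "bounded_excursions \<P> \<mu>" by (rule alpha2_bounded_excursions[OF \<epsilon> \<mu>(2)]) (rule near)
  obtain \<mu>' R1 where R1: "0 < R1" "\<And>R. R1 \<le> R \<Longrightarrow> peripheral \<P> \<mu> \<mu>' R"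
    by (rule peripheral_for_large_radius[OF geod a1 ex]) blast
  have "transient_ends_condition \<P> \<mu> R \<and> transient_thin_condition \<P> \<mu> R" if R: "R1 \<le> R" for R
  proof -
    interpret peripheral \<P> \<mu> \<mu>' R by (rule R1(2)[OF R])
    interpret gated \<P> \<mu> \<mu>' R
      by unfold_locales
        (rule tree_graded_weakly_thin[OF tg0 \<mu>(3) c tg1 \<mu>(4)] tree_graded_coarse_gates[OF tg0])+
    have "transient_ends_condition \<P> \<mu> R"
      unfolding transient_ends_condition_def
    proof
      fix k
      obtain K where K: "\<And>P x y g a b. \<lbrakk>P \<in> \<P>; x \<in> nbhd k P; y \<in> nbhd k P; K \<le> dist x y; geodesic_from_to x y g a b\<rbrakk>
          \<Longrightarrow> Trans g a b \<subseteq> cball x K \<union> cball y K \<and> (\<exists>z. z \<in> Trans g a b \<inter> nbhd \<mu> P)"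
        by (rule transient_near_ends[of k]) blast
      show "\<exists>K. \<forall>x y. \<forall>P\<in>\<P>.
         P \<noteq> {} \<and> infdist x P + infdist y P \<le> k \<and> dist x y \<ge> K \<longrightarrow>
         (\<forall>g a b. geodesic_from_to x y g a b \<longrightarrow>
            Trans g a b \<subseteq> cball x K \<union> cball y K \<and> (\<exists>z. z \<in> Trans g a b \<inter> nbhd \<mu> P))"
      proof (intro exI[of _ K] allI ballI impI, elim conjE)
        fix x y P g a b
        assume P: "P \<in> \<P>" and ne: "P \<noteq> {}" and k: "infdist x P + infdist y P \<le> k" and d: "K \<le> dist x y"
          and g: "geodesic_from_to x y g a b"
        have "x \<in> nbhd k P" "y \<in> nbhd k P" using ne k infdist_nonneg[of x P] infdist_nonneg[of y P] by (auto simp: nbhd_def)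
        then show "Trans g a b \<subseteq> cball x K \<union> cball y K \<and> (\<exists>z. z \<in> Trans g a b \<inter> nbhd \<mu> P)"
          using K[OF P _ _ d g] by blast
      qed
    qed
    moreover have "transient_thin_condition \<P> \<mu> R"
    proof -
      obtain D where D: "\<And>x y z g a b h c d f m n p. \<lbrakk>geodesic_from_to x y g a b; geodesic_from_to y z h c d;
          geodesic_from_to x z f m n; p \<in> Trans g a b\<rbrakk> \<Longrightarrow> \<exists>q\<in>Trans h c d \<union> Trans f m n. dist p q \<le> D"
        using thin_triangles unfolding thin_def by metis
      show ?thesis unfolding transient_thin_condition_def
      proof (intro exI[of _ D] allI impI subsetI, elim conjE)
        fix \<gamma> a b p
        assume tri: "cyclic_triangle \<gamma> a b" and g: "\<forall>i<3. geodesic (\<gamma> i) (a i) (b i)" and p: "p \<in> Trans (\<gamma> 0) (a 0) (b 0)"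
        have v: "\<gamma> 0 (b 0) = \<gamma> 1 (a 1)" "\<gamma> 1 (b 1) = \<gamma> 2 (a 2)" "\<gamma> 2 (b 2) = \<gamma> 0 (a 0)"
          using tri unfolding cyclic_triangle_def all_less_3 by (simp_all add: numeral_2_eq_2)
        have "geodesic_from_to (\<gamma> 0 (a 0)) (\<gamma> 0 (b 0)) (\<gamma> 0) (a 0) (b 0)"
          "geodesic_from_to (\<gamma> 0 (b 0)) (\<gamma> 1 (b 1)) (\<gamma> 1) (a 1) (b 1)"
          "geodesic_from_to (\<gamma> 0 (a 0)) (\<gamma> 1 (b 1)) (\<lambda>t. \<gamma> 2 (-t)) (- b 2) (- a 2)"
          using g v unfolding all_less_3 by (auto simp: geodesic_from_to_def intro: geodesic_rev)
        from D[OF this p] obtain q where "q \<in> Trans (\<gamma> 1) (a 1) (b 1) \<union> Trans (\<gamma> 2) (a 2) (b 2)" "dist p q \<le> D"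
          by (auto simp: trans_points_rev)
        then show "p \<in> nbhd D (Trans (\<gamma> 1) (a 1) (b 1) \<union> Trans (\<gamma> 2) (a 2) (b 2))" by (rule nbhd_mem)
      qed
    qed
    ultimately show ?thesis by blast
  qed
  then show ?thesis using that[of \<mu> R1] \<mu>(1) R1(1) by auto
qed

text \<open>Bounded excursions follow from the transient point in \<open>N\<^sub>\<mu>(P)\<close>: applied to an excursion trimmed by
  one unit at both ends, it would yield an interior point of \<open>N\<^sub>\<mu>(P)\<close>. The radius \<open>R\<close> is enlarged
  afterwards, since the bound on intersections depends on these excursions.\<close>

lemma transient_conditions_imp_hyperbolic:
  fixes \<P> :: "'a::metric_space set set"
  assumes geod: "geodesic_metric_space TYPE('a)" and a1: "alpha1 \<P>"
    and cond: "\<And>R. R0 \<le> R \<Longrightarrow> transient_ends_condition \<P> \<mu> R \<and> transient_thin_condition \<P> \<mu> R"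
  shows "hyperbolic_relative_to \<P>"
proof -
  have ends: "\<exists>K. \<forall>P\<in>\<P>. \<forall>x y g a b. x \<in> nbhd k P \<and> y \<in> nbhd k P \<and> geodesic_from_to x y g a b \<and> K \<le> dist x y \<longrightarrow>
      trans_points \<P> \<mu> R g a b \<subseteq> cball x K \<union> cball y K \<and> (\<exists>z. z \<in> trans_points \<P> \<mu> R g a b \<inter> nbhd \<mu> P)"
    if R: "R0 \<le> R" for R k
  proof -
    obtain K where K: "\<forall>x y. \<forall>P\<in>\<P>.
         P \<noteq> {} \<and> infdist x P + infdist y P \<le> 2 * k \<and> dist x y \<ge> K \<longrightarrow>
         (\<forall>g a b. geodesic_from_to x y g a b \<longrightarrow>
            trans_points \<P> \<mu> R g a b \<subseteq> cball x K \<union> cball y K \<and>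
            (\<exists>z. z \<in> trans_points \<P> \<mu> R g a b \<inter> nbhd \<mu> P))"
      using cond[OF R, THEN conjunct1, unfolded transient_ends_condition_def, rule_format, of "2 * k"] ..
    show ?thesis
    proof (intro exI[of _ K] ballI allI impI, elim conjE)
      fix P x y g a b
      assume P: "P \<in> \<P>" and xy: "x \<in> nbhd k P" "y \<in> nbhd k P" and g: "geodesic_from_to x y g a b" and d: "K \<le> dist x y"
      have "P \<noteq> {} \<and> infdist x P + infdist y P \<le> 2 * k \<and> dist x y \<ge> K" using xy d by (auto simp: nbhd_def)
      then show "trans_points \<P> \<mu> R g a b \<subseteq> cball x K \<union> cball y K \<and> (\<exists>z. z \<in> trans_points \<P> \<mu> R g a b \<inter> nbhd \<mu> P)"
        using K P g by blast
    qed
  qed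
  have ex: "bounded_excursions \<P> \<mu>"
    unfolding bounded_excursions_def
  proof
    fix k
    obtain K where K: "\<forall>P\<in>\<P>. \<forall>x y g a b. x \<in> nbhd (k + 1) P \<and> y \<in> nbhd (k + 1) P \<and> geodesic_from_to x y g a b \<and> K \<le> dist x y \<longrightarrow>
      trans_points \<P> \<mu> R0 g a b \<subseteq> cball x K \<union> cball y K \<and> (\<exists>z. z \<in> trans_points \<P> \<mu> R0 g a b \<inter> nbhd \<mu> P)"
      using ends[OF order_refl, of "k + 1"] ..
    have "b - a \<le> max K 0 + 2"
      if P: "P \<in> \<P>" and g: "geodesic g a b" "g a \<in> nbhd k P" "g b \<in> nbhd k P"
        and out: "\<And>t. t\<in>{a<..<b} \<Longrightarrow> g t \<notin> nbhd \<mu> P" for P g a b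
    proof (rule ccontr)
      assume "\<not> ?thesis"
      then have long: "K < b - a - 2" "0 < b - a - 2" by auto
      then have d: "dist (g a) (g (a + 1)) = 1" "dist (g b) (g (b - 1)) = 1" "dist (g (a + 1)) (g (b - 1)) = b - a - 2"
        using geodesic_dist[OF g(1)] by auto
      have "g (a + 1) \<in> nbhd (k + 1) P" "g (b - 1) \<in> nbhd (k + 1) P"
        using nbhd_dist[OF g(2), of "g (a + 1)" 1] nbhd_dist[OF g(3), of "g (b - 1)" 1] d by auto
      moreover have "geodesic_from_to (g (a + 1)) (g (b - 1)) g (a + 1) (b - 1)"
        using geodesic_sub[OF g(1)] long by (auto simp: geodesic_from_to_def)
      ultimately have "\<exists>z. z \<in> trans_points \<P> \<mu> R0 g (a + 1) (b - 1) \<inter> nbhd \<mu> P"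
        using K P d(3) long(1) by (metis less_imp_le)
      then obtain z where "z \<in> g ` {a + 1..b - 1}" "z \<in> nbhd \<mu> P"
        using trans_points_image[of \<P> \<mu> R0 g "a + 1" "b - 1"] by blast
      then show False using out by auto
    qed
    then show "\<exists>K. \<forall>P\<in>\<P>. \<forall>g a b. geodesic g a b \<and> g a \<in> nbhd k P \<and> g b \<in> nbhd k P \<and>
       (\<forall>t\<in>{a<..<b}. g t \<notin> nbhd \<mu> P) \<longrightarrow> b - a \<le> K" by blast
  qed
  obtain \<mu>' R1 where R1: "0 < R1" "\<And>R. R1 \<le> R \<Longrightarrow> peripheral \<P> \<mu> \<mu>' R"
    by (rule peripheral_for_large_radius[OF geod a1 ex]) blast
  define R where "R = max R0 R1"
  have R: "R0 \<le> R" "R1 \<le> R" by (auto simp: R_def)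
  interpret peripheral \<P> \<mu> \<mu>' R by (rule R1(2)[OF R(2)])
  interpret thin_family \<P> \<mu> \<mu>' R
  proof unfold_locales
    fix k
    obtain K where K: "\<forall>P\<in>\<P>. \<forall>x y g a b. x \<in> nbhd k P \<and> y \<in> nbhd k P \<and> geodesic_from_to x y g a b \<and> K \<le> dist x y \<longrightarrow>
      Trans g a b \<subseteq> cball x K \<union> cball y K \<and> (\<exists>z. z \<in> Trans g a b \<inter> nbhd \<mu> P)"
      using ends[OF R(1), of k] ..
    show "\<exists>K. \<forall>P\<in>\<P>. \<forall>g a b. geodesic g a b \<and> g a \<in> nbhd k P \<and> g b \<in> nbhd k P \<longrightarrow>
      (\<forall>p\<in>Trans g a b. dist p (g a) \<le> K \<or> dist p (g b) \<le> K)"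
    proof (intro exI[of _ K] ballI allI impI, elim conjE)
      fix P g a b p
      assume P: "P \<in> \<P>" and g: "geodesic g a b" "g a \<in> nbhd k P" "g b \<in> nbhd k P" and p: "p \<in> Trans g a b"
      show "dist p (g a) \<le> K \<or> dist p (g b) \<le> K"
      proof (cases "K \<le> dist (g a) (g b)")
        case True
        have "geodesic_from_to (g a) (g b) g a b" using g by (simp add: geodesic_from_to_def)
        then have "Trans g a b \<subseteq> cball (g a) K \<union> cball (g b) K" using K P g True by blast
        then show ?thesis using p by (auto simp: dist_commute)
      next
        case False
        obtain t where t: "t \<in> {a..b}" "p = g t" using p trans_points_image[of \<P> \<mu> R g a b] by blast
        then have "dist p (g a) \<le> dist (g a) (g b)"
          using geodesic_dist[OF g(1), of t a] geodesic_dist[OF g(1), of a b] by auto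
        then show ?thesis using False by auto
      qed
    qed
  next
    obtain D where D: "\<forall>\<gamma> a b. cyclic_triangle \<gamma> a b \<and> (\<forall>i<3. geodesic (\<gamma> i) (a i) (b i)) \<longrightarrow>
         Trans (\<gamma> 0) (a 0) (b 0) \<subseteq> nbhd D (Trans (\<gamma> 1) (a 1) (b 1) \<union> Trans (\<gamma> 2) (a 2) (b 2))"
      using cond[OF R(1), THEN conjunct2, unfolded transient_thin_condition_def] ..
    show "thin \<P> \<mu> R"
      unfolding thin_def
    proof (intro exI[of _ "D + 1"] allI impI ballI, elim conjE)
      fix x y z g a b h c d f m n p
      assume g: "geodesic_from_to x y g a b" and h: "geodesic_from_to y z h c d" and f: "geodesic_from_to x z f m n"
        and p: "p \<in> Trans g a b"
      define G where "G = (\<lambda>i::nat. if i = 0 then g else if i = 1 then h else (\<lambda>t. f (-t)))"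
      define A where "A = (\<lambda>i::nat. if i = 0 then a else if i = 1 then c else -n)"
      define B where "B = (\<lambda>i::nat. if i = 0 then b else if i = 1 then d else -m)"
      have "cyclic_triangle G A B \<and> (\<forall>i<3. geodesic (G i) (A i) (B i))"
        unfolding cyclic_triangle_def all_less_3 using g h f
        by (auto simp: G_def A_def B_def geodesic_from_to_def intro: geodesic_rev)
      then have "Trans (G 0) (A 0) (B 0) \<subseteq> nbhd D (Trans (G 1) (A 1) (B 1) \<union> Trans (G 2) (A 2) (B 2))" using D by blast
      then have "p \<in> nbhd D (Trans h c d \<union> Trans f m n)" using p
        by (auto simp: G_def A_def B_def trans_points_rev)
      then obtain q where "q \<in> Trans h c d \<union> Trans f m n" "dist p q \<le> D + 1" by (rule nbhd_obtain)
      then show "\<exists>q\<in>Trans h c d \<union> Trans f m n. dist p q \<le> D + 1" by blast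
    qed
  qed
  show ?thesis unfolding hyperbolic_relative_to_def using a1 alpha2 asymptotically_tree_graded by blast
qed

theorem proposition4p6:
  fixes \<P> :: "'a::metric_space set set"
  assumes "geodesic_metric_space TYPE('a)"
  shows "hyperbolic_relative_to \<P> \<longleftrightarrow>
    (\<exists>\<mu> R\<^sub>0. 0 \<le> \<mu> \<and> 0 \<le> R\<^sub>0 \<and>
      (\<forall>K. \<exists>B. \<forall>P\<in>\<P>. \<forall>Q\<in>\<P>. P \<noteq> Q \<longrightarrow>
         bounded (nbhd K P \<inter> nbhd K Q) \<and> diameter (nbhd K P \<inter> nbhd K Q) \<le> B) \<and>
      (\<forall>k. \<forall>R\<ge>R\<^sub>0. \<exists>K. \<forall>x y. \<forall>P\<in>\<P>.
         P \<noteq> {} \<and> infdist x P + infdist y P \<le> k \<and> dist x y \<ge> K \<longrightarrow>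
         (\<forall>g a b. geodesic_from_to x y g a b \<longrightarrow>
            trans_points \<P> \<mu> R g a b \<subseteq> cball x K \<union> cball y K \<and>
            (\<exists>z. z \<in> trans_points \<P> \<mu> R g a b \<inter> nbhd \<mu> P))) \<and>
      (\<forall>R\<ge>R\<^sub>0. \<exists>D. \<forall>\<gamma> a b.
         cyclic_triangle \<gamma> a b \<and> (\<forall>i<3. geodesic (\<gamma> i) (a i) (b i)) \<longrightarrow>
         trans_points \<P> \<mu> R (\<gamma> 0) (a 0) (b 0) \<subseteq>
           nbhd D (trans_points \<P> \<mu> R (\<gamma> 1) (a 1) (b 1) \<union>
                   trans_points \<P> \<mu> R (\<gamma> 2) (a 2) (b 2))))"
    (is "_ \<longleftrightarrow> (\<exists>\<mu> R\<^sub>0. 0 \<le> \<mu> \<and> 0 \<le> R\<^sub>0 \<and> ?a1 \<and> ?ends \<mu> R\<^sub>0 \<and> ?thin \<mu> R\<^sub>0)")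
proof -
  have conv: "?ends \<mu> R\<^sub>0 \<and> ?thin \<mu> R\<^sub>0 \<longleftrightarrow>
      (\<forall>R\<ge>R\<^sub>0. transient_ends_condition \<P> \<mu> R \<and> transient_thin_condition \<P> \<mu> R)" for \<mu> R\<^sub>0
    unfolding transient_ends_condition_def transient_thin_condition_def
    by (rule iffI) (elim conjE, intro allI impI conjI, blast, blast, intro conjI allI impI, blast, blast)
  have a1: "?a1 \<longleftrightarrow> alpha1 \<P>" by (simp only: alpha1_def)
  show ?thesis
    unfolding conv a1
  proof
    assume hyp: "hyperbolic_relative_to \<P>"
    obtain \<mu> R0 where "0 \<le> \<mu>" "0 \<le> R0"
      "\<And>R. R0 \<le> R \<Longrightarrow> transient_ends_condition \<P> \<mu> R \<and> transient_thin_condition \<P> \<mu> R"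
      by (rule hyperbolic_imp_transient_conditions[OF assms hyp]) blast
    then show "\<exists>\<mu> R\<^sub>0. 0 \<le> \<mu> \<and> 0 \<le> R\<^sub>0 \<and> alpha1 \<P> \<and>
        (\<forall>R\<ge>R\<^sub>0. transient_ends_condition \<P> \<mu> R \<and> transient_thin_condition \<P> \<mu> R)"
      using hyp by (intro exI[of _ \<mu>] exI[of _ R0]) (simp add: hyperbolic_relative_to_def)
  next
    assume "\<exists>\<mu> R\<^sub>0. 0 \<le> \<mu> \<and> 0 \<le> R\<^sub>0 \<and> alpha1 \<P> \<and>
        (\<forall>R\<ge>R\<^sub>0. transient_ends_condition \<P> \<mu> R \<and> transient_thin_condition \<P> \<mu> R)"
    then obtain \<mu> R0 where a1: "alpha1 \<P>"
      and cond: "\<forall>R\<ge>R0. transient_ends_condition \<P> \<mu> R \<and> transient_thin_condition \<P> \<mu> R" by blast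
    show "hyperbolic_relative_to \<P>"
      by (rule transient_conditions_imp_hyperbolic[OF assms a1, of R0 \<mu>]) (use cond in blast)
  qed
qed

end
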